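(* Let $\alpha_1,\rho_1:\mathbb{R}^3\to\mathbb{R}$ and $P^{(0)}:\mathbb{R}^3\to\mathbb{R}$ be smooth functions supported in a bounded domain $\Omega\subset\mathbb{R}^3$. For $\varepsilon>0$ (in a range $(0,\varepsilon_0)$) put $\rho(x;\varepsilon)=1+\varepsilon\rho_1(x)$ and $\alpha(x;\varepsilon)=1+\varepsilon\alpha_1(x)$, and suppose that for each such $\varepsilon$ there are constants with $0<\rho_{\varepsilon,\min}\le\rho(x;\varepsilon)\le\rho_{\varepsilon,\max}$ and $0<\alpha_{\varepsilon,\min}\le\alpha(x;\varepsilon)\le\alpha_{\varepsilon,\max}$ for all $x\in\mathbb{R}^3$. Let $P(\cdot,\cdot;\varepsilon)$ be the solution on $[0,\infty)\times\mathbb{R}^3$ of $$\partial_{tt}P(t,x;\varepsilon)=\rho(x;\varepsilon)\,\alpha(x;\varepsilon)\,\mathrm{div}_x\Big(\frac{1}{\rho(x;\varepsilon)}\nabla_xP(t,x;\varepsilon)\Big),\qquad \partial_tP(0,x;\varepsilon)=0,\qquad P(0,x;\varepsilon)=P^{(0)}(x).$$ Let $P_0,P_1$ be the zeroth and first order terms, $P_2(\cdot,\cdot;\varepsilon)$ the remainder, and $F(\cdot,\cdot;\varepsilon)$ the source term defined in the context. Then, for all $t\ge0$ and $x\in\mathbb{R}^3$ (with one-sided time derivatives at $t=0$), $$P(t,x;\varepsilon)=\frac{\partial^4}{\partial t^4}\left(\int_{B_t(x)}K(t,x,y;\varepsilon)\,P^{(0)}(y)\,\mathrm{d}y\right)+\varepsilon^2P_2(t,x;\varepsilon),$$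 where $$\begin{aligned}K(t,x,y;\varepsilon)&=\frac{(t-|y-x|)^2}{8\pi|y-x|}\,(1-\varepsilon\alpha_1(y))+\int_{\mathscr E_t(x,y)}\frac{1}{16\pi^2|z-x||z-y|}\,\varepsilon\alpha_1(z)\,\mathrm{d}z\\&\quad+\int_{\mathscr E_t(x,y)}\frac{t-|z-x|-|z-y|}{16\pi^2|z-x||z-y|}\,\varepsilon\nabla\rho_1(z)\cdot\frac{z-y}{|z-y|}\,\mathrm{d}z\\&\quad+\int_{\mathscr E_t(x,y)}\frac{(t-|z-x|-|z-y|)^2}{32\pi^2|z-x||z-y|^2}\,\varepsilon\nabla\rho_1(z)\cdot\frac{z-y}{|z-y|}\,\mathrm{d}z,\end{aligned}$$ $$\mathscr E_t(x,y)=\{z\in\mathbb{R}^3\mid |z-x|+|z-y|\le t\}.$$ Moreover, for every integer $k\ge0$ and every $T>0$ there are constants $C_{k,T;\varepsilon}$ (depending only on $k$, $T$, $\varepsilon$ and the fixed functions $\alpha_1,\rho_1$) with $C_{k,T;\varepsilon}=\mathcal{O}(1)$ as $\varepsilon\to0$ such that $$\sup_{0\le t\le T}\Big(\|P_2(t,\cdot;\varepsilon)\|_{H^{k+1}(\mathbb{R}^3)}+\|\partial_tP_2(t,\cdot;\varepsilon)\|_{H^k(\mathbb{R}^3)}\Big)\le C_{k,T;\varepsilon}\int_0^T\|F(t,\cdot;\varepsilon)\|_{H^k(\mathbb{R}^3)}\,\mathrm{d}t.$$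
   Context: $B_t(x)$ is the ball of radius $t$ around $x$ in $\mathbb{R}^3$; $H^k(\mathbb{R}^3)$ are the usual $L^2$-based Sobolev spaces. $P_0$ is the solution of $\partial_{tt}P_0=\Delta P_0$ on $[0,\infty)\times\mathbb{R}^3$ with $\partial_tP_0(0,x)=0$, $P_0(0,x)=P^{(0)}(x)$. $P_1$ is the solution of $\partial_{tt}P_1(t,x)=\Delta P_1(t,x)+\alpha_1(x)\Delta P_0(t,x)-\nabla\rho_1(x)\cdot\nabla P_0(t,x)$ with $\partial_tP_1(0,x)=0$, $P_1(0,x)=0$. $P_2$ is defined by $P(t,x;\varepsilon)=P_0(t,x)+\varepsilon P_1(t,x)+\varepsilon^2P_2(t,x;\varepsilon)$. Equivalently, $P_2$ solves $$\partial_{tt}P_2=\rho\,\alpha\,\mathrm{div}_x\Big(\frac1\rho\nabla_xP_2\Big)+F,\qquad \partial_tP_2(0,\cdot)=0,\quad P_2(0,\cdot)=0,$$ with $$F(t,x;\varepsilon)=\frac{\rho_1(x)-\alpha_1(x)}{\rho(x;\varepsilon)}\nabla\rho_1(x)\cdot\nabla P_0(t,x)+\alpha_1(x)\Delta P_1(t,x)-\frac{\alpha(x;\varepsilon)}{\rho(x;\varepsilon)}\nabla\rho_1(x)\cdot\nabla P_1(t,x).$$ (In the application, $P^{(0)}=P^{(0)}_{r,\theta}$ is the initial pressure produced by illuminating the plane $\{x\cdot\theta=r\}$; $r,\theta$ are fixed parameters and are suppressed in the notation.) *)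

theory Defs
  imports "HOL-Analysis.Analysis" "HOL-Library.Landau_Symbols"
begin

type_synonym R3 = "real ^ 3"

section \<open>Smooth functions and differential operators\<close>

text \<open>The derivatives are taken within \<open>S\<close>, so that on a half-space such as
  \<open>[0,\<infinity>) \<times> \<real>\<^sup>3\<close> the notion means smoothness up to the boundary, with one-sided derivatives
  there.  It is only meant for sets \<open>S\<close> on which the derivative within \<open>S\<close> is unique.\<close>

primrec Ck_on :: "nat \<Rightarrow> 'a::euclidean_space set \<Rightarrow> ('a \<Rightarrow> real) \<Rightarrow> bool" where
  "Ck_on 0 S f \<longleftrightarrow> continuous_on S f"
| "Ck_on (Suc k) S f \<longleftrightarrow> f differentiable_on S \<and>
     (\<forall>b\<in>Basis. Ck_on k S (\<lambda>x. frechet_derivative f (at x within S) b))"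

definition smooth_on :: "'a::euclidean_space set \<Rightarrow> ('a \<Rightarrow> real) \<Rightarrow> bool" where
  "smooth_on S f \<longleftrightarrow> (\<forall>k. Ck_on k S f)"

definition supported_in :: "R3 set \<Rightarrow> (R3 \<Rightarrow> real) \<Rightarrow> bool" where
  "supported_in \<Omega> f \<longleftrightarrow> closure {x. f x \<noteq> 0} \<subseteq> \<Omega>"

definition partial :: "3 \<Rightarrow> (R3 \<Rightarrow> real) \<Rightarrow> R3 \<Rightarrow> real" where
  "partial i f x = frechet_derivative f (at x) (axis i 1)"

definition grad :: "(R3 \<Rightarrow> real) \<Rightarrow> R3 \<Rightarrow> R3" where
  "grad f x = (\<chi> i. partial i f x)"

definition divergence :: "(R3 \<Rightarrow> R3) \<Rightarrow> R3 \<Rightarrow> real" where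
  "divergence V x = (\<Sum>i\<in>UNIV. partial i (\<lambda>y. V y $ i) x)"

definition laplacian :: "(R3 \<Rightarrow> real) \<Rightarrow> R3 \<Rightarrow> real" where
  "laplacian f = divergence (grad f)"

text \<open>Time derivative on \<open>[0,\<infinity>)\<close>, one-sided at \<open>0\<close>.\<close>

definition time_deriv :: "(real \<Rightarrow> real) \<Rightarrow> real \<Rightarrow> real" where
  "time_deriv f t = vector_derivative f (at t within {0..})"

section \<open>The Sobolev norms of \<open>H\<^sup>k(\<real>\<^sup>3)\<close>\<close>

definition order_of :: "nat ^ 3 \<Rightarrow> nat" where
  "order_of \<beta> = (\<Sum>i\<in>UNIV. \<beta> $ i)"

definition partials :: "nat ^ 3 \<Rightarrow> (R3 \<Rightarrow> real) \<Rightarrow> R3 \<Rightarrow> real" where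
  "partials \<beta> f = (partial 1 ^^ (\<beta> $ 1)) ((partial 2 ^^ (\<beta> $ 2)) ((partial 3 ^^ (\<beta> $ 3)) f))"

definition test_function :: "(R3 \<Rightarrow> real) \<Rightarrow> bool" where
  "test_function \<phi> \<longleftrightarrow> smooth_on UNIV \<phi> \<and> bounded {x. \<phi> x \<noteq> 0}"

definition locally_integrable :: "(R3 \<Rightarrow> real) \<Rightarrow> bool" where
  "locally_integrable u \<longleftrightarrow> (\<forall>R. set_integrable lebesgue (cball 0 R) u)"

definition weak_partials :: "nat ^ 3 \<Rightarrow> (R3 \<Rightarrow> real) \<Rightarrow> (R3 \<Rightarrow> real) \<Rightarrow> bool" where
  "weak_partials \<beta> u v \<longleftrightarrow> locally_integrable u \<and> locally_integrable v \<and>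
     (\<forall>\<phi>. test_function \<phi> \<longrightarrow>
        (LINT x|lebesgue. u x * partials \<beta> \<phi> x) =
        (-1) ^ order_of \<beta> * (LINT x|lebesgue. v x * \<phi> x))"

definition square_integrable :: "(R3 \<Rightarrow> real) \<Rightarrow> bool" where
  "square_integrable v \<longleftrightarrow> v \<in> borel_measurable lebesgue \<and> integrable lebesgue (\<lambda>x. (v x)\<^sup>2)"

text \<open>Weak derivatives are unique almost everywhere, so all members of the infimum are equal:
  the value is the usual norm if \<open>u \<in> H\<^sup>k(\<real>\<^sup>3)\<close>, and \<open>\<infinity>\<close> (infimum of the empty set) otherwise.\<close>

definition sobolev_norm :: "nat \<Rightarrow> (R3 \<Rightarrow> real) \<Rightarrow> ennreal" where
  "sobolev_norm k u =
     (INF v \<in> {v. \<forall>\<beta>. order_of \<beta> \<le> k \<longrightarrow> weak_partials \<beta> u (v \<beta>) \<and> square_integrable (v \<beta>)}.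
        ennreal (sqrt (\<Sum>\<beta> | order_of \<beta> \<le> k. LINT x|lebesgue. (v \<beta> x)\<^sup>2)))"

section \<open>The wave equations\<close>

text \<open>Throughout, \<open>A\<close> and \<open>R\<close> stand for the first-order perturbations \<open>\<alpha>\<^sub>1\<close>, \<open>\<rho>\<^sub>1\<close>, and \<open>p\<close>
  for the initial pressure.  With smooth coefficients and data, ``the solution'' of each initial
  value problem is the one that is smooth on \<open>[0,\<infinity>) \<times> \<real>\<^sup>3\<close>; no decay is required, as solutions
  are unique by finite propagation speed.\<close>

definition smooth_spacetime :: "(real \<Rightarrow> R3 \<Rightarrow> real) \<Rightarrow> bool" where
  "smooth_spacetime u \<longleftrightarrow> smooth_on ({0..} \<times> UNIV) (\<lambda>(t, x). u t x)"

definition perturbed :: "(R3 \<Rightarrow> real) \<Rightarrow> real \<Rightarrow> R3 \<Rightarrow> real" where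
  "perturbed f \<epsilon> x = 1 + \<epsilon> * f x"

definition full_solution ::
  "(R3 \<Rightarrow> real) \<Rightarrow> (R3 \<Rightarrow> real) \<Rightarrow> (R3 \<Rightarrow> real) \<Rightarrow> real \<Rightarrow> (real \<Rightarrow> R3 \<Rightarrow> real) \<Rightarrow> bool" where
  "full_solution A R p \<epsilon> u \<longleftrightarrow> smooth_spacetime u \<and>
     (\<forall>t\<ge>0. \<forall>x. (time_deriv ^^ 2) (\<lambda>s. u s x) t =
        perturbed R \<epsilon> x * perturbed A \<epsilon> x *
        divergence (\<lambda>y. (1 / perturbed R \<epsilon> y) *\<^sub>R grad (u t) y) x) \<and>
     (\<forall>x. time_deriv (\<lambda>s. u s x) 0 = 0) \<and>
     (\<forall>x. u 0 x = p x)"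

definition zeroth_order_term :: "(R3 \<Rightarrow> real) \<Rightarrow> (real \<Rightarrow> R3 \<Rightarrow> real) \<Rightarrow> bool" where
  "zeroth_order_term p P0 \<longleftrightarrow> smooth_spacetime P0 \<and>
     (\<forall>t\<ge>0. \<forall>x. (time_deriv ^^ 2) (\<lambda>s. P0 s x) t = laplacian (P0 t) x) \<and>
     (\<forall>x. time_deriv (\<lambda>s. P0 s x) 0 = 0) \<and>
     (\<forall>x. P0 0 x = p x)"

definition first_order_term ::
  "(R3 \<Rightarrow> real) \<Rightarrow> (R3 \<Rightarrow> real) \<Rightarrow> (real \<Rightarrow> R3 \<Rightarrow> real) \<Rightarrow> (real \<Rightarrow> R3 \<Rightarrow> real) \<Rightarrow> bool" where
  "first_order_term A R P0 P1 \<longleftrightarrow> smooth_spacetime P1 \<and>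
     (\<forall>t\<ge>0. \<forall>x. (time_deriv ^^ 2) (\<lambda>s. P1 s x) t =
        laplacian (P1 t) x + A x * laplacian (P0 t) x - grad R x \<bullet> grad (P0 t) x) \<and>
     (\<forall>x. time_deriv (\<lambda>s. P1 s x) 0 = 0) \<and>
     (\<forall>x. P1 0 x = 0)"

definition remainder_source ::
  "(R3 \<Rightarrow> real) \<Rightarrow> (R3 \<Rightarrow> real) \<Rightarrow> (real \<Rightarrow> R3 \<Rightarrow> real) \<Rightarrow> (real \<Rightarrow> R3 \<Rightarrow> real) \<Rightarrow>
     real \<Rightarrow> real \<Rightarrow> R3 \<Rightarrow> real" where
  "remainder_source A R P0 P1 \<epsilon> t x =
     (R x - A x) / perturbed R \<epsilon> x * (grad R x \<bullet> grad (P0 t) x)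
     + A x * laplacian (P1 t) x
     - perturbed A \<epsilon> x / perturbed R \<epsilon> x * (grad R x \<bullet> grad (P1 t) x)"

section \<open>The kernel\<close>

definition ellipsoid :: "real \<Rightarrow> R3 \<Rightarrow> R3 \<Rightarrow> R3 set" where
  "ellipsoid t x y = {z. norm (z - x) + norm (z - y) \<le> t}"

definition green_kernel :: "(R3 \<Rightarrow> real) \<Rightarrow> (R3 \<Rightarrow> real) \<Rightarrow> real \<Rightarrow> real \<Rightarrow> R3 \<Rightarrow> R3 \<Rightarrow> real" where
  "green_kernel A R \<epsilon> t x y =
     (t - norm (y - x))\<^sup>2 / (8 * pi * norm (y - x)) * (1 - \<epsilon> * A y)
     + (LINT z:ellipsoid t x y|lborel.
          1 / (16 * pi\<^sup>2 * norm (z - x) * norm (z - y)) * (\<epsilon> * A z))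
     + (LINT z:ellipsoid t x y|lborel.
          (t - norm (z - x) - norm (z - y)) / (16 * pi\<^sup>2 * norm (z - x) * norm (z - y)) *
          (\<epsilon> * (grad R z \<bullet> ((1 / norm (z - y)) *\<^sub>R (z - y)))))
     + (LINT z:ellipsoid t x y|lborel.
          (t - norm (z - x) - norm (z - y))\<^sup>2 / (32 * pi\<^sup>2 * norm (z - x) * (norm (z - y))\<^sup>2) *
          (\<epsilon> * (grad R z \<bullet> ((1 / norm (z - y)) *\<^sub>R (z - y)))))"

end

theory Submission
  imports Defs
begin

text \<open>If \<open>U\<close> and \<open>U\<^sub>t\<close> vanish at time \<open>0\<close> and \<open>F = U\<^sub>t\<^sub>t - \<Delta>U\<close>, then
  \<open>4\<pi> U(t,x) = \<integral>\<^bsub>|z| \<le> t\<^esub> F(t - |z|, x + z) / |z| dz\<close>.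
  This is the divergence theorem for a field built from \<open>U\<close> at the retarded time, with \<open>|z|\<close>
  regularised to \<open>sqrt(|z|\<^sup>2 + d\<^sup>2)\<close> so that no surface integral is needed.  The initial data of
  \<open>P\<^sub>0\<close> become such a source after integrating four times in time, so the kernel formula
  is this representation of the fourfold antiderivatives of \<open>P\<^sub>0\<close> and \<open>P\<^sub>1\<close>, rearranged by Fubini's
  theorem; the fourth time derivative then costs nothing.

  The same representation shows that \<open>P\<^sub>2\<close> has compact support in \<open>x\<close>, because its source with
  respect to \<open>\<partial>\<^sub>t\<^sub>t - \<Delta>\<close> lives on the support of \<open>\<alpha>\<^sub>1\<close> and \<open>\<rho>\<^sub>1\<close>.  Hence the \<open>H\<^sup>k\<close> energy estimate
  may integrate by parts freely; commutators with the coefficients are of lower order, and their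
  coefficients are bounded uniformly for small \<open>\<epsilon>\<close>.\<close>

text \<open>The summands of the kernel have separate origins. Four antiderivatives turn the data
  \<open>p\<close> of \<open>P0\<close> into the source \<open>s\<^sup>2 / 2 * p\<close>, whose
  retarded potential is the summand free of \<epsilon>. The source of the fourfold antiderivative of
  \<open>P1\<close> contains the Laplacian of that of \<open>P0\<close>, which its own wave equation
  trades for the twofold antiderivative minus \<open>s\<^sup>2 / 2 * p\<close>. The twofold one is a
  potential of \<open>p\<close> itself and gives the ellipsoid integral with \<alpha>1; the
  subtracted term gives the factor \<open>1 - \<epsilon> * A y\<close>. The gradient term is a
  potential of the gradient of \<open>s\<^sup>2 / 2 * p\<close>; moving the derivative off
  \<open>p\<close> produces the two integrals with \<rho>1.

  The constants have to be fixed before the pressure and the solutions are known, and for all small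
  \<epsilon> at once. The energy estimate is therefore stated for families of coefficients indexed
  by a parameter set, with derivative bounds uniform over the set. Its derivatives are indexed by
  words in the three coordinate directions, so that raising the order means prepending a letter;
  multiindices return only in the comparison with the Sobolev norms.\<close>

text \<open>In such sets derivatives within the set are unique.\<close>

definition rich :: "'a::euclidean_space set \<Rightarrow> bool" where
  "rich S \<longleftrightarrow> (\<forall>x\<in>S. \<forall>i\<in>Basis. \<forall>e>0. \<exists>d. 0 < \<bar>d\<bar> \<and> \<bar>d\<bar> < e \<and> x + d *\<^sub>R i \<in> S)"

lemma rich_UNIV [simp]: "rich UNIV"
  unfolding rich_def by (metis UNIV_I abs_of_pos dense)

lemma rich_halfspace [simp]: "rich ({0::real..} \<times> (UNIV :: R3 set))"
  unfolding rich_def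
proof (intro ballI allI impI)
  fix x i :: "real \<times> R3" and e :: real
  assume x: "x \<in> {0..} \<times> UNIV" and i: "i \<in> Basis" and e: "0 < e"
  have "0 \<le> fst i" using i by (auto simp: Basis_prod_def)
  then show "\<exists>d. 0 < \<bar>d\<bar> \<and> \<bar>d\<bar> < e \<and> x + d *\<^sub>R i \<in> {0..} \<times> UNIV"
    using x e by (intro exI[of _ "e/2"]) (auto simp: mem_Times_iff)
qed

lemma frechet_derivative_rich:
  assumes "rich S" "x \<in> S" "(f has_derivative f') (at x within S)"
  shows "frechet_derivative f (at x within S) = f'"
proof (rule frechet_derivative_unique_within)
  show "(f has_derivative frechet_derivative f (at x within S)) (at x within S)"
    using assms(3) frechet_derivative_works differentiable_def by blast
qed (use assms in \<open>auto simp: rich_def\<close>)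

section \<open>Closure properties of differentiability classes on sets with unique
  derivatives\<close>

lemma Ck_on_cong:
  assumes "Ck_on k S f" "\<And>x. x \<in> S \<Longrightarrow> f x = g x"
  shows "Ck_on k S g"
  using assms
proof (induction k arbitrary: f g)
  case 0
  then show ?case by (auto cong: continuous_on_cong)
next
  case (Suc k)
  have eq: "(f has_derivative D) (at x within S) \<longleftrightarrow> (g has_derivative D) (at x within S)" if "x \<in> S" for x D
    using Suc.prems(2) that by (metis has_derivative_transform)
  then have fr: "frechet_derivative f (at x within S) = frechet_derivative g (at x within S)" if "x \<in> S" for x
    using that by (simp add: frechet_derivative_def)
  have "g differentiable_on S"
    using Suc.prems(1) eq by (auto simp: differentiable_on_def differentiable_def)
  moreover have "Ck_on k S (\<lambda>x. frechet_derivative g (at x within S) b)" if "b \<in> Basis" for b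
  proof (rule Suc.IH)
    show "Ck_on k S (\<lambda>x. frechet_derivative f (at x within S) b)" using Suc.prems(1) that by simp
  qed (simp only: fr)
  ultimately show ?case by simp
qed

text \<open>The recursive clause of \<open>Ck_on\<close> speaks of a chosen derivative. On a rich
  set that choice is forced, so any family of derivatives delivered by the calculus rules may take
  its place; the inductive closure proofs run through this rule.\<close>

lemma Ck_on_SucI:
  assumes S: "rich S" and f: "\<And>x. x \<in> S \<Longrightarrow> (f has_derivative f' x) (at x within S)"
    and C: "\<And>b. b \<in> Basis \<Longrightarrow> Ck_on k S (\<lambda>x. f' x b)"
  shows "Ck_on (Suc k) S f"
proof -
  have "f differentiable_on S"
    using f by (auto simp: differentiable_on_def differentiable_def)
  moreover have "Ck_on k S (\<lambda>x. frechet_derivative f (at x within S) b)" if "b \<in> Basis" for b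
    by (rule Ck_on_cong[OF C[OF that]]) (simp add: frechet_derivative_rich[OF S _ f])
  ultimately show ?thesis by simp
qed

lemma Ck_on_SucE:
  assumes "Ck_on (Suc k) S f"
  obtains f' where "\<And>x. x \<in> S \<Longrightarrow> (f has_derivative f' x) (at x within S)"
    "\<And>b. b \<in> Basis \<Longrightarrow> Ck_on k S (\<lambda>x. f' x b)"
proof
  show "(f has_derivative frechet_derivative f (at x within S)) (at x within S)" if "x \<in> S" for x
    using assms that by (auto simp: differentiable_on_def frechet_derivative_works)
qed (use assms in auto)

lemma Ck_on_imp_continuous_on: "Ck_on k S f \<Longrightarrow> continuous_on S f"
  by (cases k) (auto simp: differentiable_imp_continuous_on)

lemma Ck_on_Suc_imp: "Ck_on (Suc k) S f \<Longrightarrow> Ck_on k S f"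
proof (induction k arbitrary: f)
  case 0
  then show ?case by (auto simp: differentiable_imp_continuous_on)
next
  case (Suc k)
  from Suc.prems have "f differentiable_on S"
    and "\<forall>b\<in>Basis. Ck_on (Suc k) S (\<lambda>x. frechet_derivative f (at x within S) b)"
    unfolding Ck_on.simps(2)[of "Suc k"] by blast+
  then show ?case
    using Suc.IH by (subst Ck_on.simps(2)) blast
qed

lemma Ck_on_const: "rich S \<Longrightarrow> Ck_on k S (\<lambda>x. c)"
proof (induction k arbitrary: c)
  case (Suc k)
  show ?case
    by (rule Ck_on_SucI[OF Suc.prems, where f' = "\<lambda>x h. 0"]) (auto intro: Suc)
qed simp

lemma Ck_on_add: "rich S \<Longrightarrow> Ck_on k S f \<Longrightarrow> Ck_on k S g \<Longrightarrow> Ck_on k S (\<lambda>x. f x + g x)"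
proof (induction k arbitrary: f g)
  case (Suc k)
  obtain f' where f': "\<And>x. x \<in> S \<Longrightarrow> (f has_derivative f' x) (at x within S)"
    "\<And>b. b \<in> Basis \<Longrightarrow> Ck_on k S (\<lambda>x. f' x b)" using Suc.prems(2) by (rule Ck_on_SucE) blast
  obtain g' where g': "\<And>x. x \<in> S \<Longrightarrow> (g has_derivative g' x) (at x within S)"
    "\<And>b. b \<in> Basis \<Longrightarrow> Ck_on k S (\<lambda>x. g' x b)" using Suc.prems(3) by (rule Ck_on_SucE) blast
  show ?case
    by (rule Ck_on_SucI[OF Suc.prems(1), where f' = "\<lambda>x h. f' x h + g' x h"])
      (auto intro!: Suc.IH has_derivative_add f' g' Suc.prems(1))
qed (auto intro: continuous_intros)

lemma Ck_on_sum: "rich S \<Longrightarrow> (\<And>i. i \<in> I \<Longrightarrow> Ck_on k S (f i)) \<Longrightarrow> Ck_on k S (\<lambda>x. \<Sum>i\<in>I. f i x)"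
  by (induction I rule: infinite_finite_induct) (auto intro: Ck_on_const Ck_on_add)

lemma Ck_on_mult: "rich S \<Longrightarrow> Ck_on k S f \<Longrightarrow> Ck_on k S g \<Longrightarrow> Ck_on k S (\<lambda>x. f x * g x)"
proof (induction k arbitrary: f g)
  case (Suc k)
  obtain f' where f': "\<And>x. x \<in> S \<Longrightarrow> (f has_derivative f' x) (at x within S)"
    "\<And>b. b \<in> Basis \<Longrightarrow> Ck_on k S (\<lambda>x. f' x b)" using Suc.prems(2) by (rule Ck_on_SucE) blast
  obtain g' where g': "\<And>x. x \<in> S \<Longrightarrow> (g has_derivative g' x) (at x within S)"
    "\<And>b. b \<in> Basis \<Longrightarrow> Ck_on k S (\<lambda>x. g' x b)" using Suc.prems(3) by (rule Ck_on_SucE) blast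
  show ?case
    by (rule Ck_on_SucI[OF Suc.prems(1), where f' = "\<lambda>x h. f x * g' x h + f' x h * g x"])
      (auto intro!: Suc.IH Ck_on_add has_derivative_mult f' g' Suc.prems(1)
        Ck_on_Suc_imp[OF Suc.prems(2)] Ck_on_Suc_imp[OF Suc.prems(3)])
qed (auto intro: continuous_intros)

lemma Ck_on_inverse:
  "rich S \<Longrightarrow> Ck_on k S f \<Longrightarrow> (\<And>x. x \<in> S \<Longrightarrow> f x \<noteq> 0) \<Longrightarrow> Ck_on k S (\<lambda>x. inverse (f x))"
proof (induction k)
  case (Suc k)
  obtain f' where f': "\<And>x. x \<in> S \<Longrightarrow> (f has_derivative f' x) (at x within S)"
    "\<And>b. b \<in> Basis \<Longrightarrow> Ck_on k S (\<lambda>x. f' x b)" using Suc.prems(2) by (rule Ck_on_SucE) blast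
  have "Ck_on k S (\<lambda>x. inverse (f x))"
    using Suc Ck_on_Suc_imp by blast
  then have C: "Ck_on k S (\<lambda>x. - 1 * (inverse (f x) * f' x b * inverse (f x)))" if "b \<in> Basis" for b
    by (intro Ck_on_mult Ck_on_const f' that Suc.prems(1))
  show ?case
  proof (rule Ck_on_SucI[OF Suc.prems(1)])
    show "((\<lambda>x. inverse (f x)) has_derivative (\<lambda>h. - (inverse (f x) * f' x h * inverse (f x)))) (at x within S)"
      if "x \<in> S" for x
      by (rule Deriv.has_derivative_inverse[OF Suc.prems(3)[OF that] f'(1)[OF that]])
    show "Ck_on k S (\<lambda>x. - (inverse (f x) * f' x b * inverse (f x)))" if "b \<in> Basis" for b
      using C[OF that] by (simp only: mult_minus_left mult_1_left)
  qed
qed (auto intro: continuous_intros)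

text \<open>The derivative of the composition in a basis direction is a combination, with constant
  coefficients, of basis derivatives of \<open>f\<close> at the image point, so the induction on the
  order closes. Slices at fixed time, lifts from space to spacetime and shifts along an axis are all
  of this affine form.\<close>

lemma Ck_on_compose_affine:
  assumes "rich T" "rich S" "bounded_linear L" "\<And>x. x \<in> T \<Longrightarrow> c + L x \<in> S" "Ck_on k S f"
  shows "Ck_on k T (\<lambda>x. f (c + L x))"
  using assms(5)
proof (induction k arbitrary: f)
  case 0
  have "continuous_on T (\<lambda>x. c + L x)"
    by (intro continuous_on_add continuous_on_const linear_continuous_on[OF assms(3)])
  then show ?case using 0 assms(4) by (auto intro!: continuous_on_compose2[of S f])
next
  case (Suc k)
  obtain f' where f': "\<And>x. x \<in> S \<Longrightarrow> (f has_derivative f' x) (at x within S)"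
    "\<And>b. b \<in> Basis \<Longrightarrow> Ck_on k S (\<lambda>x. f' x b)" using Suc.prems(1) by (rule Ck_on_SucE) blast
  have L: "((\<lambda>x. c + L x) has_derivative L) (at x within T)" for x
    using has_derivative_add[OF has_derivative_const[of c] bounded_linear_imp_has_derivative[OF assms(3)]]
    by simp
  show ?case
  proof (rule Ck_on_SucI[OF assms(1), where f' = "\<lambda>x h. f' (c + L x) (L h)"])
    fix x assume x: "x \<in> T"
    have "(f has_derivative f' (c + L x)) (at (c + L x) within (\<lambda>x. c + L x) ` T)"
      using f'(1)[OF assms(4)[OF x]] by (rule has_derivative_subset) (use assms(4) in auto)
    from diff_chain_within[OF L this]
    show "((\<lambda>x. f (c + L x)) has_derivative (\<lambda>h. f' (c + L x) (L h))) (at x within T)"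
      by (simp add: o_def)
  next
    fix b :: 'a
    have lin: "f' (c + L x) (L b) = (\<Sum>a\<in>Basis. (L b \<bullet> a) * f' (c + L x) a)" if "x \<in> T" for x
    proof -
      have "bounded_linear (f' (c + L x))"
        using f'(1)[OF assms(4)[OF that]] has_derivative_bounded_linear by blast
      then have "linear (f' (c + L x))" by (rule bounded_linear.linear)
      then show ?thesis
        by (subst euclidean_representation[of "L b", symmetric])
          (simp only: linear_sum linear_scale real_scaleR_def)
    qed
    have "Ck_on k T (\<lambda>x. \<Sum>a\<in>Basis. (L b \<bullet> a) * f' (c + L x) a)"
      by (intro Ck_on_sum Ck_on_mult Ck_on_const assms(1) Suc.IH f')
    then show "Ck_on k T (\<lambda>x. f' (c + L x) (L b))"
      by (rule Ck_on_cong) (simp add: lin)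
  qed
qed

lemma smooth_on_cong: "smooth_on S f \<Longrightarrow> (\<And>x. x \<in> S \<Longrightarrow> f x = g x) \<Longrightarrow> smooth_on S g"
  unfolding smooth_on_def using Ck_on_cong by blast

lemma smooth_on_const: "rich S \<Longrightarrow> smooth_on S (\<lambda>x. c)"
  and smooth_on_add: "rich S \<Longrightarrow> smooth_on S f \<Longrightarrow> smooth_on S g \<Longrightarrow> smooth_on S (\<lambda>x. f x + g x)"
  and smooth_on_mult: "rich S \<Longrightarrow> smooth_on S f \<Longrightarrow> smooth_on S g \<Longrightarrow> smooth_on S (\<lambda>x. f x * g x)"
  and smooth_on_sum: "rich S \<Longrightarrow> (\<And>i. i \<in> I \<Longrightarrow> smooth_on S (h i)) \<Longrightarrow> smooth_on S (\<lambda>x. \<Sum>i\<in>I. h i x)"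
  and smooth_on_inverse: "rich S \<Longrightarrow> smooth_on S f \<Longrightarrow> (\<And>x. x \<in> S \<Longrightarrow> f x \<noteq> 0) \<Longrightarrow> smooth_on S (\<lambda>x. inverse (f x))"
  by (simp_all add: smooth_on_def Ck_on_const Ck_on_add Ck_on_mult Ck_on_sum Ck_on_inverse)

lemma smooth_on_compose_affine:
  assumes "rich T" "rich S" "bounded_linear L" "\<And>x. x \<in> T \<Longrightarrow> c + L x \<in> S" "smooth_on S f"
  shows "smooth_on T (\<lambda>x. f (c + L x))"
  using assms Ck_on_compose_affine unfolding smooth_on_def by blast

lemma smooth_on_imp_continuous_on: "smooth_on S f \<Longrightarrow> continuous_on S f"
  by (auto simp: smooth_on_def dest: spec[of _ 0])

lemma smooth_on_has_derivative:
  assumes "smooth_on S f" "x \<in> S"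
  shows "(f has_derivative frechet_derivative f (at x within S)) (at x within S)"
proof -
  have "Ck_on (Suc 0) S f" using assms(1) unfolding smooth_on_def by blast
  then show ?thesis using assms(2)
    by (auto simp: differentiable_on_def frechet_derivative_works)
qed

lemma smooth_on_frechet:
  assumes "smooth_on S f" "b \<in> Basis"
  shows "smooth_on S (\<lambda>x. frechet_derivative f (at x within S) b)"
  unfolding smooth_on_def
proof
  fix k
  have "Ck_on (Suc k) S f" using assms(1) unfolding smooth_on_def by blast
  then show "Ck_on k S (\<lambda>x. frechet_derivative f (at x within S) b)" using assms(2) by simp
qed

text \<open>The averages \<open>\<integral>\<^sub>0\<^sup>1 \<tau>\<^sup>j f(\<tau>t,x) d\<tau>\<close> are closed under differentiation, which makes them
  (and with them the time antiderivative) smooth.\<close>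

lemma Ck_on_scaled_average:
  fixes f :: "real \<times> R3 \<Rightarrow> real"
  assumes "Ck_on k ({0..} \<times> UNIV) f"
  shows "Ck_on k ({0..} \<times> UNIV) (\<lambda>p. integral (cbox 0 1) (\<lambda>s. s ^ j * f (s * fst p, snd p)))"
  using assms
proof (induction k arbitrary: f j)
  case 0
  have "continuous_on (({0..} \<times> UNIV) \<times> cbox 0 (1::real)) (\<lambda>q. f (snd q * fst (fst q), snd (fst q)))"
    by (rule continuous_on_compose2[of "{0..} \<times> UNIV" f]) (use 0 in \<open>auto intro!: continuous_intros\<close>)
  then have "continuous_on (({0..} \<times> UNIV) \<times> cbox 0 1)
      (\<lambda>(p, s). s ^ j * f (s * fst p, snd p))"
    unfolding split_beta by (intro continuous_intros)
  then show ?case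
    unfolding Ck_on.simps(1) by (rule integral_continuous_on_param)
next
  case (Suc k)
  let ?H = "{0::real..} \<times> (UNIV :: R3 set)"
  obtain f' where f': "\<And>x. x \<in> ?H \<Longrightarrow> (f has_derivative f' x) (at x within ?H)"
    "\<And>b. b \<in> Basis \<Longrightarrow> Ck_on k ?H (\<lambda>x. f' x b)" using Suc.prems(1) by (rule Ck_on_SucE) blast
  define g where "g p s = s ^ j * f (s * fst p, snd p)" for p :: "real \<times> R3" and s :: real
  define D where "D p s h = s ^ j * f' (s * fst p, snd p) (s * fst h, snd h)" for p h :: "real \<times> R3" and s
  have bl: "bounded_linear (f' p)" if "p \<in> ?H" for p
    using f'(1)[OF that] has_derivative_bounded_linear by blast
  have scale_bl: "bounded_linear (\<lambda>h::real \<times> R3. (s * fst h, snd h))" for s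
    by (intro bounded_linear_Pair bounded_linear_const_mult bounded_linear_fst bounded_linear_snd)
  have gD: "((\<lambda>p. g p s) has_derivative D p s) (at p within ?H)"
    if "p \<in> ?H" "s \<in> cbox 0 1" for p s
  proof -
    have in_H: "(s * fst p, snd p) \<in> ?H" if "p \<in> ?H" for p using that \<open>s \<in> cbox 0 1\<close> by auto
    have 1: "(f has_derivative f' (s * fst p, snd p)) (at (s * fst p, snd p) within (\<lambda>p. (s * fst p, snd p)) ` ?H)"
      using f'(1)[OF in_H[OF that(1)]] by (rule has_derivative_subset) (use in_H in auto)
    have 2: "((\<lambda>p. (s * fst p, snd p)) has_derivative (\<lambda>h. (s * fst h, snd h))) (at p within ?H)"
      by (rule bounded_linear_imp_has_derivative[OF scale_bl])
    show ?thesis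
      unfolding g_def D_def
      using diff_chain_within[OF 2 1] by (auto simp: o_def intro: has_derivative_mult_right)
  qed
  have blD: "bounded_linear (D p s)" if "p \<in> ?H" "s \<in> cbox 0 1" for p s
    using gD[OF that] by (rule has_derivative_bounded_linear)
  have contf': "continuous_on (?H \<times> cbox 0 1) (\<lambda>q. f' (snd q * fst (fst q), snd (fst q)) b)" if "b \<in> Basis" for b
    by (rule continuous_on_compose2[OF Ck_on_imp_continuous_on[OF f'(2)[OF that]]])
      (auto intro!: continuous_intros)
  \<comment> \<open>In the time direction the chain rule for the point
    \<open>(s * fst p, snd p)\<close> brings out one more factor \<open>s\<close>. This raises
    \<open>j\<close> by one and is why the statement carries an arbitrary power.\<close>
  have D_Basis: "D p s (a, 0) = s ^ Suc j * (a * f' (s * fst p, snd p) (1, 0))"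
      "D p s (0, b) = s ^ j * f' (s * fst p, snd p) (0, b)"
    if "p \<in> ?H" "s \<in> cbox 0 1" for p s a b
  proof -
    interpret bounded_linear "f' (s * fst p, snd p)" by (rule bl) (use that in auto)
    have "f' (s * fst p, snd p) (s * a, 0) = f' (s * fst p, snd p) ((s * a) *\<^sub>R (1, 0))" by simp
    also have "\<dots> = (s * a) * f' (s * fst p, snd p) (1, 0)" by (simp only: scaleR real_scaleR_def)
    finally show "D p s (a, 0) = s ^ Suc j * (a * f' (s * fst p, snd p) (1, 0))"
      by (simp add: D_def)
  qed (simp add: D_def)
  have 10: "(1, 0) \<in> (Basis :: (real \<times> R3) set)" by (simp add: Basis_prod_def)
  have 0: "(0, i) \<in> (Basis :: (real \<times> R3) set)" if "i \<in> Basis" for i using that by (simp add: Basis_prod_def)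
  have contD: "continuous_on (?H \<times> cbox 0 1) (\<lambda>q. D (fst q) (snd q) b)" if b: "b \<in> Basis" for b
  proof -
    consider "b = (1, 0)" | i where "b = (0, i)" "i \<in> Basis" using b by (auto simp: Basis_prod_def)
    then show ?thesis
    proof cases
      case 1
      have "continuous_on (?H \<times> cbox 0 1) (\<lambda>q. snd q ^ Suc j * (1 * f' (snd q * fst (fst q), snd (fst q)) (1, 0)))"
        by (intro continuous_intros contf' 10)
      then show ?thesis unfolding 1
        by (rule continuous_on_eq) (subst D_Basis, auto)
    next
      case 2
      have "continuous_on (?H \<times> cbox 0 1) (\<lambda>q. snd q ^ j * (f' (snd q * fst (fst q), snd (fst q)) (0, i)))"
        by (intro continuous_intros contf' 0 2)
      then show ?thesis unfolding 2
        by (rule continuous_on_eq) (subst D_Basis, auto)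
    qed
  qed
  define B where "B p s = Blinfun (D p s)" for p s
  have B: "blinfun_apply (B p s) = D p s" if "p \<in> ?H" "s \<in> cbox 0 1" for p s
    unfolding B_def by (rule bounded_linear_Blinfun_apply[OF blD[OF that]])
  have contB: "continuous_on (?H \<times> cbox 0 1) (\<lambda>(p, s). B p s)"
    unfolding split_beta
    by (rule continuous_on_blinfun_componentwise, rule continuous_on_eq[OF contD]) (auto simp: B)
  have der: "((\<lambda>p. integral (cbox 0 1) (g p)) has_derivative integral (cbox 0 1) (B p)) (at p within ?H)"
    if "p \<in> ?H" for p
  proof (rule leibniz_rule[OF _ _ contB that])
    show "((\<lambda>p. g p s) has_derivative B p s) (at p within ?H)" if "p \<in> ?H" "s \<in> cbox 0 1" for p s
      using gD[OF that] B[OF that] by simp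
    show "g p integrable_on cbox 0 1" if "p \<in> ?H" for p
    proof (rule integrable_continuous)
      have "continuous_on (cbox 0 1) (\<lambda>s. f (s * fst p, snd p))"
        by (rule continuous_on_compose2[OF Ck_on_imp_continuous_on[OF Suc.prems]])
          (use that in \<open>auto intro!: continuous_intros\<close>)
      then show "continuous_on (cbox 0 1) (g p)" unfolding g_def by (intro continuous_intros)
    qed
    show "convex ?H" by (intro convex_Times) auto
  qed
  have Bint: "B p integrable_on cbox 0 1" if "p \<in> ?H" for p
    by (rule integrable_continuous, rule continuous_on_compose2[OF contB, of _ "\<lambda>s. (p, s)", simplified])
      (use that in \<open>auto intro!: continuous_intros\<close>)
  have app: "blinfun_apply (integral (cbox 0 1) (B p)) b = integral (cbox 0 1) (\<lambda>s. D p s b)" if "p \<in> ?H" for p b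
    by (subst blinfun_apply_integral[OF Bint[OF that]]) (auto intro!: integral_cong simp: B that)
  have "Ck_on (Suc k) ?H (\<lambda>p. integral (cbox 0 1) (g p))"
  proof (rule Ck_on_SucI[OF rich_halfspace der])
    fix b :: "real \<times> R3" assume b: "b \<in> Basis"
    then consider "b = (1, 0)" | i where "b = (0, i)" "i \<in> Basis" by (auto simp: Basis_prod_def)
    then show "Ck_on k ?H (\<lambda>p. blinfun_apply (integral (cbox 0 1) (B p)) b)"
    proof cases
      case 1
      show ?thesis unfolding 1
        by (rule Ck_on_cong[OF Suc.IH[OF f'(2)[OF 10], of "Suc j"]])
          (subst app, (auto)[1], rule integral_cong, subst D_Basis, auto)
    next
      case 2
      show ?thesis unfolding 2
        by (rule Ck_on_cong[OF Suc.IH[OF f'(2)[OF 0[OF 2(2)]], of "j"]])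
          (subst app, (auto)[1], rule integral_cong, subst D_Basis, auto)
    qed
  qed auto
  then show ?case unfolding g_def .
qed

section \<open>Rules for partial derivatives on three-dimensional space\<close>

lemma partial_eqI: "(f has_derivative f') (at x) \<Longrightarrow> partial i f x = f' (axis i 1)"
  unfolding partial_def using frechet_derivative_at by metis

lemma smooth_on_partial: "smooth_on UNIV f \<Longrightarrow> smooth_on UNIV (partial i f)"
  using smooth_on_frechet[of UNIV f "axis i 1"] by (simp add: partial_def[abs_def] axis_in_Basis_iff)

lemma smooth_on_differentiable: "smooth_on UNIV f \<Longrightarrow> f differentiable (at x)"
  using smooth_on_has_derivative[of UNIV f x] by (auto simp: differentiable_def)

lemma has_real_derivative_line:
  assumes "(f has_derivative f') (at (x + h *\<^sub>R v))"
  shows "((\<lambda>h. f (x + h *\<^sub>R v)) has_real_derivative f' v) (at h)"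
proof -
  have "((\<lambda>h. x + h *\<^sub>R v) has_derivative (\<lambda>h. h *\<^sub>R v)) (at h)"
    by (auto intro!: derivative_eq_intros)
  from diff_chain_at[OF this assms]
  have "((\<lambda>h. f (x + h *\<^sub>R v)) has_derivative (\<lambda>h. f' (h *\<^sub>R v))) (at h)"
    by (simp add: o_def)
  moreover have "f' (h *\<^sub>R v) = f' v * h" for h
    using bounded_linear.linear[OF has_derivative_bounded_linear[OF assms]]
    by (simp add: linear_scale)
  ultimately show ?thesis by (simp add: has_field_derivative_def)
qed

lemma partial_line_at:
  "f differentiable (at (x + h *\<^sub>R axis i 1)) \<Longrightarrow>
    ((\<lambda>h. f (x + h *\<^sub>R axis i 1)) has_real_derivative partial i f (x + h *\<^sub>R axis i 1)) (at h)"
  unfolding partial_def by (rule has_real_derivative_line) (simp add: frechet_derivative_works)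

lemma partial_line:
  "f differentiable (at x) \<Longrightarrow> ((\<lambda>h. f (x + h *\<^sub>R axis i 1)) has_real_derivative partial i f x) (at 0)"
  using partial_line_at[of f x 0 i] by simp

lemma partial_const [simp]: "partial i (\<lambda>x. c) x = 0"
  by (simp add: partial_def)

lemma partial_add:
  assumes "f differentiable (at x)" "g differentiable (at x)"
  shows "partial i (\<lambda>y. f y + g y) x = partial i f x + partial i g x"
  using partial_eqI[OF has_derivative_add[OF assms[unfolded frechet_derivative_works]]]
  by (simp add: partial_def)

lemma partial_mult:
  assumes "f differentiable (at x)" "g differentiable (at x)"
  shows "partial i (\<lambda>y. f y * g y) x = partial i f x * g x + f x * partial i g x"
  using partial_eqI[OF has_derivative_mult[OF assms[unfolded frechet_derivative_works]]]
  by (simp add: partial_def)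

lemma partial_cmult:
  "f differentiable (at x) \<Longrightarrow> partial i (\<lambda>y. c * f y) x = c * partial i f x"
  by (subst partial_mult) auto

lemma partial_sum:
  "finite I \<Longrightarrow> (\<And>j. j \<in> I \<Longrightarrow> f j differentiable (at x)) \<Longrightarrow>
    partial i (\<lambda>y. \<Sum>j\<in>I. f j y) x = (\<Sum>j\<in>I. partial i (f j) x)"
  by (induction I rule: finite_induct) (auto simp: partial_add differentiable_sum)

lemma partial_inverse:
  assumes "f differentiable (at x)" "f x \<noteq> 0"
  shows "partial i (\<lambda>y. inverse (f y)) x = - (inverse (f x) * partial i f x * inverse (f x))"
  using partial_eqI[OF Deriv.has_derivative_inverse[OF assms(2) assms(1)[unfolded frechet_derivative_works]]]
  by (simp add: partial_def)

lemma partial_zero_on_open: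
  assumes "open S" "x \<in> S" "\<And>y. y \<in> S \<Longrightarrow> f y = 0"
  shows "partial i f x = 0"
proof -
  have "(f has_derivative (\<lambda>h. 0)) (at x)"
    by (rule has_derivative_transform_within_open[OF has_derivative_const[of 0] assms(1,2)])
      (use assms(3) in auto)
  then show ?thesis by (simp add: partial_eqI)
qed

lemma partial_zero_outside_cball:
  assumes "\<And>y. B < norm y \<Longrightarrow> f y = 0" "B < norm x"
  shows "partial i f x = 0"
proof (rule partial_zero_on_open[of "- cball 0 B"])
  show "open (- cball (0::R3) B)" by (intro open_Compl closed_cball)
qed (use assms in auto)

lemma smooth_on_linear:
  assumes "rich S" "bounded_linear L"
  shows "smooth_on S L"
  unfolding smooth_on_def
proof
  fix k show "Ck_on k S L"
  proof (cases k)
    case 0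
    then show ?thesis using linear_continuous_on[OF assms(2)] by simp
  next
    case (Suc m)
    show ?thesis unfolding Suc
      by (rule Ck_on_SucI[OF assms(1) bounded_linear_imp_has_derivative[OF assms(2)] Ck_on_const[OF assms(1)]])
  qed
qed

section \<open>Smooth functions on the half-space\<close>

definition Dt :: "(real \<Rightarrow> R3 \<Rightarrow> real) \<Rightarrow> real \<Rightarrow> R3 \<Rightarrow> real" where
  "Dt u t x = time_deriv (\<lambda>s. u s x) t"

definition Dx :: "3 \<Rightarrow> (real \<Rightarrow> R3 \<Rightarrow> real) \<Rightarrow> real \<Rightarrow> R3 \<Rightarrow> real" where
  "Dx i u t x = partial i (u t) x"

definition time_primitive :: "(real \<Rightarrow> R3 \<Rightarrow> real) \<Rightarrow> real \<Rightarrow> R3 \<Rightarrow> real" where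
  "time_primitive u t x = integral {0..t} (\<lambda>s. u s x)"

lemma at_within_Ici_nontrivial: "(0::real) \<le> t \<Longrightarrow> at t within {0..} \<noteq> bot"
  unfolding trivial_limit_within islimpt_approachable_real not_not
proof (intro allI impI)
  fix e :: real assume "0 \<le> t" "0 < e"
  then show "\<exists>x'\<in>{0..}. x' \<noteq> t \<and> \<bar>x' - t\<bar> < e" by (intro bexI[of _ "t + e/2"]) auto
qed

lemma time_deriv_eqI:
  "(f has_real_derivative D) (at t within {0..}) \<Longrightarrow> 0 \<le> t \<Longrightarrow> time_deriv f t = D"
  unfolding time_deriv_def has_real_derivative_iff_has_vector_derivative
  by (rule vector_derivative_within[OF at_within_Ici_nontrivial])

lemma time_deriv_cong:
  assumes "\<And>s. 0 \<le> s \<Longrightarrow> f s = g s" "0 \<le> t"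
  shows "time_deriv f t = time_deriv g t"
proof -
  have "(f has_vector_derivative D) (at t within {0..}) \<longleftrightarrow> (g has_vector_derivative D) (at t within {0..})" for D
    using assms by (intro has_vector_derivative_cong_ev refl) (auto simp: eventually_at_filter)
  then show ?thesis by (simp add: time_deriv_def vector_derivative_def)
qed

lemma smooth_spacetime_imp_continuous_on:
  "smooth_spacetime u \<Longrightarrow> continuous_on ({0..} \<times> UNIV) (\<lambda>(t, x). u t x)"
  unfolding smooth_spacetime_def by (rule smooth_on_imp_continuous_on)

lemma continuous_on_spacetime:
  assumes "smooth_spacetime u" "continuous_on A f" "continuous_on A g" "\<And>a. a \<in> A \<Longrightarrow> 0 \<le> f a"
  shows "continuous_on A (\<lambda>a. u (f a) (g a))"
  using continuous_on_compose2[OF smooth_spacetime_imp_continuous_on[OF assms(1)]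
    continuous_on_Pair[OF assms(2,3)]] assms(4) by auto

text \<open>Composing with the embedding of a time line or of a spatial slice ties the derivative on
  the half-space to \<open>time_deriv\<close> and \<open>partial\<close>, the operators in which the
  equations are written.\<close>

lemma spacetime_derivative:
  fixes x :: R3
  assumes "smooth_spacetime u" "0 \<le> t"
  defines "D \<equiv> frechet_derivative (\<lambda>(t, x). u t x) (at (t, x) within {0..} \<times> UNIV)"
  shows "((\<lambda>s. u s x) has_real_derivative D (1, 0)) (at t within {0..})"
    and "(u t has_derivative (\<lambda>h. D (0, h))) (at x)"
proof -
  have D: "((\<lambda>(t, x). u t x) has_derivative D) (at (t, x) within {0..} \<times> UNIV)"
    unfolding D_def using assms by (intro smooth_on_has_derivative) (auto simp: smooth_spacetime_def)
  have lin: "linear D" using D has_derivative_bounded_linear bounded_linear.linear by blast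
  have 1: "((\<lambda>s. (s, x)) has_derivative (\<lambda>h. (h, 0))) (at t within {0..})"
    by (intro has_derivative_Pair has_derivative_ident has_derivative_const)
  have "((\<lambda>(t, x). u t x) has_derivative D) (at (t, x) within (\<lambda>s. (s, x)) ` {0..})"
    by (rule has_derivative_subset[OF D]) auto
  from diff_chain_within[OF 1 this]
  have "((\<lambda>s. u s x) has_derivative (\<lambda>h. D (h, 0))) (at t within {0..})" by (simp add: o_def)
  moreover have "(\<lambda>h. D (h, 0)) = (*) (D (1, 0))"
  proof
    show "D (h, 0) = D (1, 0) * h" for h
      using linear_scale[OF lin, of h "(1, 0)"] by simp
  qed
  ultimately show "((\<lambda>s. u s x) has_real_derivative D (1, 0)) (at t within {0..})"
    unfolding has_field_derivative_def by (simp only:)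
  have 2: "((\<lambda>y. (t, y)) has_derivative (\<lambda>h. (0, h))) (at x)"
    by (intro has_derivative_Pair has_derivative_ident has_derivative_const)
  have "((\<lambda>(t, x). u t x) has_derivative D) (at (t, x) within (\<lambda>y. (t, y)) ` UNIV)"
    by (rule has_derivative_subset[OF D]) (use assms in auto)
  from diff_chain_within[OF 2 this]
  show "(u t has_derivative (\<lambda>h. D (0, h))) (at x)" by (simp add: o_def)
qed

lemma Dt_frechet:
  "smooth_spacetime u \<Longrightarrow> 0 \<le> t \<Longrightarrow>
    Dt u t x = frechet_derivative (\<lambda>(t, x). u t x) (at (t, x) within {0..} \<times> UNIV) (1, 0)"
  unfolding Dt_def by (rule time_deriv_eqI[OF spacetime_derivative(1)])

lemma Dx_frechet:
  "smooth_spacetime u \<Longrightarrow> 0 \<le> t \<Longrightarrow>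
    Dx i u t x = frechet_derivative (\<lambda>(t, x). u t x) (at (t, x) within {0..} \<times> UNIV) (0, axis i 1)"
  unfolding Dx_def by (rule partial_eqI[OF spacetime_derivative(2)])

lemma Dt_has_derivative:
  "smooth_spacetime u \<Longrightarrow> 0 \<le> t \<Longrightarrow> ((\<lambda>s. u s x) has_real_derivative Dt u t x) (at t within {0..})"
  using spacetime_derivative(1) Dt_frechet by simp

lemma spacetime_differentiable: "smooth_spacetime u \<Longrightarrow> 0 \<le> t \<Longrightarrow> u t differentiable (at x)"
  using spacetime_derivative(2) by (auto simp: differentiable_def)

lemma smooth_spacetime_cong:
  assumes "smooth_spacetime u" "\<And>t x. 0 \<le> t \<Longrightarrow> u t x = v t x"
  shows "smooth_spacetime v"
  using assms unfolding smooth_spacetime_def by (elim smooth_on_cong) auto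

lemma smooth_spacetime_Dt:
  assumes "smooth_spacetime u" shows "smooth_spacetime (Dt u)"
proof -
  have "smooth_on ({0..} \<times> UNIV)
      (\<lambda>p. frechet_derivative (\<lambda>(t, x). u t x) (at p within {0..} \<times> UNIV) (1, 0))"
    using assms unfolding smooth_spacetime_def by (rule smooth_on_frechet) (simp add: Basis_prod_def)
  then show ?thesis unfolding smooth_spacetime_def
    by (rule smooth_on_cong) (auto simp: Dt_frechet assms)
qed

lemma smooth_spacetime_Dx:
  assumes "smooth_spacetime u" shows "smooth_spacetime (Dx i u)"
proof -
  have "smooth_on ({0..} \<times> UNIV)
      (\<lambda>p. frechet_derivative (\<lambda>(t, x). u t x) (at p within {0..} \<times> UNIV) (0, axis i 1))"
    using assms unfolding smooth_spacetime_def by (rule smooth_on_frechet) (auto simp: Basis_prod_def axis_in_Basis_iff)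
  then show ?thesis unfolding smooth_spacetime_def
    by (rule smooth_on_cong) (auto simp: Dx_frechet assms)
qed

lemma smooth_spacetime_slice:
  assumes "smooth_spacetime u" "0 \<le> t" shows "smooth_on UNIV (u t)"
proof -
  have "smooth_on UNIV (\<lambda>x. (\<lambda>(t, x). u t x) ((t, 0) + (0, x)))"
    using assms unfolding smooth_spacetime_def
    by (intro smooth_on_compose_affine[of UNIV "{0..} \<times> UNIV", OF rich_UNIV rich_halfspace])
      (auto intro!: bounded_linear_Pair bounded_linear_zero bounded_linear_ident)
  then show ?thesis by simp
qed

lemma smooth_spacetime_space:
  assumes "smooth_on UNIV f" shows "smooth_spacetime (\<lambda>t. f)"
proof -
  have "smooth_on ({0..} \<times> UNIV) (\<lambda>p::real \<times> R3. f (0 + snd p))"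
    by (rule smooth_on_compose_affine[of _ UNIV]) (auto intro: bounded_linear_snd assms)
  then show ?thesis by (simp add: smooth_spacetime_def case_prod_beta')
qed

lemma smooth_spacetime_time: "smooth_spacetime (\<lambda>t x. t)"
  unfolding smooth_spacetime_def case_prod_beta' by (rule smooth_on_linear) (auto intro: bounded_linear_fst)

lemma smooth_spacetime_const: "smooth_spacetime (\<lambda>t x. c)"
  unfolding smooth_spacetime_def case_prod_beta' by (rule smooth_on_const) auto

lemma smooth_spacetime_add:
  "smooth_spacetime u \<Longrightarrow> smooth_spacetime v \<Longrightarrow> smooth_spacetime (\<lambda>t x. u t x + v t x)"
  unfolding smooth_spacetime_def case_prod_beta' by (rule smooth_on_add) auto

lemma smooth_spacetime_mult:
  "smooth_spacetime u \<Longrightarrow> smooth_spacetime v \<Longrightarrow> smooth_spacetime (\<lambda>t x. u t x * v t x)"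
  unfolding smooth_spacetime_def case_prod_beta' by (rule smooth_on_mult) auto

lemma smooth_spacetime_diff:
  "smooth_spacetime u \<Longrightarrow> smooth_spacetime v \<Longrightarrow> smooth_spacetime (\<lambda>t x. u t x - v t x)"
  using smooth_spacetime_add[OF _ smooth_spacetime_mult[OF smooth_spacetime_const[of "-1"]], of u v] by simp

lemma smooth_spacetime_sum:
  "(\<And>i. i \<in> I \<Longrightarrow> smooth_spacetime (u i)) \<Longrightarrow> smooth_spacetime (\<lambda>t x. \<Sum>i\<in>I. u i t x)"
  unfolding smooth_spacetime_def case_prod_beta' by (rule smooth_on_sum) auto

lemmas smooth_intros = smooth_spacetime_Dt smooth_spacetime_Dx smooth_spacetime_space smooth_spacetime_time
  smooth_spacetime_const smooth_spacetime_add smooth_spacetime_mult smooth_spacetime_diff smooth_spacetime_sum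

lemma Dt_cong: "(\<And>t. 0 \<le> t \<Longrightarrow> u t x = v t x) \<Longrightarrow> 0 \<le> t \<Longrightarrow> Dt u t x = Dt v t x"
  unfolding Dt_def by (rule time_deriv_cong) auto

lemma Dx_cong: "(\<And>x. u t x = v t x) \<Longrightarrow> Dx i u t x = Dx i v t x"
  unfolding Dx_def by (metis ext)

lemma Dx_add: "smooth_spacetime u \<Longrightarrow> smooth_spacetime v \<Longrightarrow> 0 \<le> t \<Longrightarrow>
    Dx i (\<lambda>t x. u t x + v t x) t x = Dx i u t x + Dx i v t x"
  by (simp add: Dx_def partial_add spacetime_differentiable)

lemma Dx_cmult: "smooth_spacetime u \<Longrightarrow> 0 \<le> t \<Longrightarrow>
    Dx i (\<lambda>t x. c * u t x) t x = c * Dx i u t x"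
  by (simp add: Dx_def partial_cmult spacetime_differentiable)

lemma Dx_diff: "smooth_spacetime u \<Longrightarrow> smooth_spacetime v \<Longrightarrow> 0 \<le> t \<Longrightarrow>
    Dx i (\<lambda>t x. u t x - v t x) t x = Dx i u t x - Dx i v t x"
  using Dx_add[of u "\<lambda>t x. -1 * v t x" t i x] Dx_cmult[of v t i "-1" x]
    smooth_spacetime_mult[OF smooth_spacetime_const[of "-1"], of v] by simp

lemma Dx_has_derivative_line:
  "smooth_spacetime u \<Longrightarrow> 0 \<le> t \<Longrightarrow>
    ((\<lambda>h. u t (x + h *\<^sub>R axis i 1)) has_real_derivative Dx i u t (x + h *\<^sub>R axis i 1)) (at h)"
  unfolding Dx_def by (rule partial_line_at[OF spacetime_differentiable])

section \<open>Time antiderivatives and symmetry of second derivatives\<close>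

lemma time_primitive_0 [simp]: "time_primitive u 0 x = 0"
  by (simp add: time_primitive_def)

text \<open>A linear substitution moves \<open>t\<close> from the range of integration into the
  integrand. Over the fixed unit interval smoothness can be read off up to and including
  \<open>t = 0\<close>.\<close>

lemma time_primitive_average:
  assumes "smooth_spacetime u" "0 \<le> t"
  shows "time_primitive u t x = t * integral (cbox 0 1) (\<lambda>s. u (s * t) x)"
proof (cases "t = 0")
  case False
  have "continuous_on {0..t} (\<lambda>s. u s x)"
    by (rule continuous_on_spacetime[OF assms(1)]) (auto intro!: continuous_intros)
  then have "((\<lambda>s. u s x) has_integral time_primitive u t x) (cbox 0 t)"
    unfolding time_primitive_def by (simp add: integrable_integral integrable_continuous_real)
  from has_integral_affinity[OF this, of t 0]
  have "((\<lambda>s. u (t * s) x) has_integral time_primitive u t x / t) ((\<lambda>x. x / t) ` {0..t})"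
    using False assms(2) by (auto simp: divide_inverse mult.commute)
  moreover have "(\<lambda>x. x / t) ` {0..t} = cbox 0 1"
    using False assms(2) by (auto simp: image_iff field_simps intro!: bexI[of _ "t * _"])
  ultimately show ?thesis using False
    by (simp add: integral_unique mult.commute)
qed simp

lemma smooth_spacetime_primitive:
  assumes "smooth_spacetime u"
  shows "smooth_spacetime (time_primitive u)"
proof -
  have "smooth_on ({0..} \<times> UNIV) (\<lambda>p. integral (cbox 0 1) (\<lambda>s. s ^ 0 * (\<lambda>(t, x). u t x) (s * fst p, snd p)))"
    using assms unfolding smooth_spacetime_def smooth_on_def by (intro allI Ck_on_scaled_average) auto
  then have "smooth_spacetime (\<lambda>t x. integral (cbox 0 1) (\<lambda>s. u (s * t) x))"
    by (simp add: smooth_spacetime_def case_prod_beta')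
  from smooth_spacetime_mult[OF smooth_spacetime_time this] show ?thesis
    by (rule smooth_spacetime_cong) (simp add: time_primitive_average[OF assms])
qed

lemma time_primitive_has_derivative:
  assumes "smooth_spacetime u" "0 \<le> t"
  shows "((\<lambda>s. time_primitive u s x) has_real_derivative u t x) (at t within {0..})"
proof -
  have "continuous_on {0..t+1} (\<lambda>s. u s x)"
    by (rule continuous_on_spacetime[OF assms(1)]) (auto intro!: continuous_intros)
  from integral_has_real_derivative[OF this, of t]
  have "((\<lambda>s. time_primitive u s x) has_real_derivative u t x) (at t within {0..t+1})"
    using assms(2) by (simp add: time_primitive_def)
  moreover have "at t within {0..t+1} = at t within {0..}"
    by (rule at_within_nhd[of t "{..<t+1}"]) auto
  ultimately show ?thesis by simp
qed

lemma Dt_primitive: "smooth_spacetime u \<Longrightarrow> 0 \<le> t \<Longrightarrow> Dt (time_primitive u) t x = u t x"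
  unfolding Dt_def by (rule time_deriv_eqI[OF time_primitive_has_derivative])

lemma primitive_Dt:
  assumes "smooth_spacetime u" "0 \<le> t"
  shows "time_primitive (Dt u) t x = u t x - u 0 x"
  unfolding time_primitive_def
proof (rule integral_unique, rule fundamental_theorem_of_calculus[OF assms(2)])
  fix s assume "s \<in> {0..t}"
  then show "((\<lambda>s. u s x) has_vector_derivative Dt u s x) (at s within {0..t})"
    using Dt_has_derivative[OF assms(1), of s x]
    by (auto simp: has_real_derivative_iff_has_vector_derivative intro: has_vector_derivative_within_subset)
qed

lemma Dx_primitive:
  assumes "smooth_spacetime u" "0 \<le> t"
  shows "Dx i (time_primitive u) t x = time_primitive (Dx i u) t x"
proof -
  have "((\<lambda>h. integral (cbox 0 t) (\<lambda>s. u s (x + h *\<^sub>R axis i 1))) has_real_derivative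
      integral (cbox 0 t) (\<lambda>s. Dx i u s (x + 0 *\<^sub>R axis i 1))) (at 0 within UNIV)"
  proof (rule leibniz_rule_field_derivative)
    show "((\<lambda>h. u s (x + h *\<^sub>R axis i 1)) has_real_derivative Dx i u s (x + h *\<^sub>R axis i 1)) (at h within UNIV)"
      if "s \<in> cbox 0 t" for h s
      using Dx_has_derivative_line[OF assms(1)] that by auto
    show "(\<lambda>s. u s (x + h *\<^sub>R axis i 1)) integrable_on cbox 0 t" for h
      by (intro integrable_continuous continuous_on_spacetime[OF assms(1)])
        (auto intro!: continuous_intros)
    show "continuous_on (UNIV \<times> cbox 0 t) (\<lambda>(h, s). Dx i u s (x + h *\<^sub>R axis i 1))"
      unfolding case_prod_beta'
      by (intro continuous_on_spacetime[OF smooth_spacetime_Dx[OF assms(1)]])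
        (auto intro!: continuous_intros)
  qed auto
  then have "((\<lambda>h. time_primitive u t (x + h *\<^sub>R axis i 1)) has_real_derivative
      time_primitive (Dx i u) t x) (at 0)"
    by (simp add: time_primitive_def)
  moreover have "((\<lambda>h. time_primitive u t (x + h *\<^sub>R axis i 1)) has_real_derivative
      Dx i (time_primitive u) t x) (at 0)"
    unfolding Dx_def
    by (rule partial_line[OF spacetime_differentiable[OF smooth_spacetime_primitive[OF assms(1)] assms(2)]])
  ultimately show ?thesis by (metis DERIV_unique)
qed

text \<open>Write \<open>u\<close> as \<open>u 0\<close> plus the time primitive of
  \<open>Dt u\<close>. Differentiating in space under the time integral and applying the fundamental
  theorem of calculus in time gives the claim, also at time 0, where the time derivative is
  one-sided.\<close>

lemma Dt_Dx_commute:
  assumes "smooth_spacetime u" "0 \<le> t"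
  shows "Dt (Dx i u) t x = Dx i (Dt u) t x"
proof -
  have *: "Dx i u s x = Dx i (\<lambda>t. u 0) s x + time_primitive (Dx i (Dt u)) s x" if "0 \<le> s" for s
  proof -
    have u: "u s y = u 0 y + time_primitive (Dt u) s y" for y
      using primitive_Dt[OF assms(1) that] by simp
    have "Dx i u s x = Dx i (\<lambda>t y. u 0 y + time_primitive (Dt u) t y) s x"
      by (rule Dx_cong) (rule u)
    also have "\<dots> = Dx i (\<lambda>t. u 0) s x + Dx i (time_primitive (Dt u)) s x"
      using that by (intro Dx_add smooth_spacetime_space smooth_spacetime_slice[OF assms(1)]
          smooth_spacetime_primitive smooth_intros assms) auto
    finally show ?thesis using that by (simp add: Dx_primitive smooth_intros assms)
  qed
  have "Dt (Dx i u) t x = Dt (\<lambda>s y. Dx i (\<lambda>t. u 0) 0 x + time_primitive (Dx i (Dt u)) s x) t x"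
  proof (rule Dt_cong[OF _ assms(2)])
    fix s :: real assume "0 \<le> s"
    from *[OF this] show "Dx i u s x = Dx i (\<lambda>t. u 0) 0 x + time_primitive (Dx i (Dt u)) s x"
      unfolding Dx_def[of i "\<lambda>t. u 0"] .
  qed
  also have "\<dots> = Dx i (Dt u) t x"
    unfolding Dt_def[of "\<lambda>s y. _ s"]
    by (rule time_deriv_eqI)
      (auto intro!: derivative_eq_intros time_primitive_has_derivative smooth_intros assms)
  finally show ?thesis .
qed

text \<open>Translation along the axis \<open>j\<close> is made into an artificial time: for the
  function \<open>f (y + t *\<^sub>R axis j 1)\<close> the time derivative is
  \<open>partial j\<close>, and the commutation of time and space derivatives at time 0 is the
  claim.\<close>

lemma partial_commute:
  assumes f: "smooth_on UNIV f"
  shows "partial i (partial j f) x = partial j (partial i f) x"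
proof -
  have sm: "smooth_spacetime (\<lambda>t y. g (y + t *\<^sub>R axis j 1))" if "smooth_on UNIV g" for g :: "R3 \<Rightarrow> real"
  proof -
    have "bounded_linear (\<lambda>p::real \<times> R3. snd p + fst p *\<^sub>R axis j (1::real))"
      by (intro bounded_linear_add bounded_linear_snd bounded_linear_scaleR_const bounded_linear_fst)
    then have "smooth_on ({0..} \<times> UNIV) (\<lambda>p. g (0 + (snd p + fst p *\<^sub>R axis j 1)))"
      by (intro smooth_on_compose_affine[of _ UNIV] that) auto
    then show ?thesis by (simp add: smooth_spacetime_def case_prod_beta')
  qed
  have Dtv: "Dt (\<lambda>t y. g (y + t *\<^sub>R axis j 1)) t y = partial j g (y + t *\<^sub>R axis j 1)"
    if "smooth_on UNIV g" "0 \<le> t" for g t y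
    unfolding Dt_def
    by (rule time_deriv_eqI[OF has_field_derivative_at_within[OF partial_line_at[OF smooth_on_differentiable[OF that(1)]]] that(2)])
  have Dxv: "Dx i (\<lambda>t y. g (y + t *\<^sub>R axis j 1)) t y = partial i g (y + t *\<^sub>R axis j 1)"
    if "smooth_on UNIV g" for g t y
  proof -
    have "((\<lambda>y. y + t *\<^sub>R axis j 1) has_derivative (\<lambda>h. h + 0)) (at y)"
      by (intro has_derivative_add has_derivative_ident has_derivative_const)
    from partial_eqI[OF diff_chain_at[OF this smooth_on_differentiable[OF that, unfolded frechet_derivative_works]]]
    show ?thesis unfolding Dx_def by (simp add: o_def partial_def)
  qed
  have "Dt (Dx i (\<lambda>t y. f (y + t *\<^sub>R axis j 1))) 0 x = Dt (\<lambda>t y. partial i f (y + t *\<^sub>R axis j 1)) 0 x"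
    by (rule Dt_cong) (simp_all add: Dxv f)
  also have "\<dots> = partial j (partial i f) x"
    by (subst Dtv) (simp_all add: smooth_on_partial f)
  finally have 1: "Dt (Dx i (\<lambda>t y. f (y + t *\<^sub>R axis j 1))) 0 x = partial j (partial i f) x" .
  have "Dx i (Dt (\<lambda>t y. f (y + t *\<^sub>R axis j 1))) 0 x = Dx i (\<lambda>t y. partial j f (y + t *\<^sub>R axis j 1)) 0 x"
    by (rule Dx_cong) (simp add: Dtv f)
  also have "\<dots> = partial i (partial j f) x"
    by (subst Dxv) (simp_all add: smooth_on_partial f)
  finally show ?thesis using 1 Dt_Dx_commute[OF sm[OF f], of 0 i x] by simp
qed

lemma Dx_commute: "smooth_spacetime u \<Longrightarrow> 0 \<le> t \<Longrightarrow> Dx i (Dx j u) t x = Dx j (Dx i u) t x"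
  using partial_commute[OF smooth_spacetime_slice] by (simp add: Dx_def[abs_def])

section \<open>Integrals over \<open>\<real>\<^sup>3\<close>\<close>

text \<open>Polar coordinates for radial integrands. Both measures give the half-line up to
  \<open>r\<close> the volume \<open>4/3 * pi * r ^ 3\<close> of a ball, and these half-lines form
  an intersection-stable generator.\<close>

lemma distr_norm_lborel:
  "distr (lborel :: R3 measure) borel norm = density lborel (\<lambda>r. ennreal (4 * pi * r\<^sup>2) * indicator {0..} r)"
proof (rule measure_eqI_generator_eq[where E = "range atMost" and \<Omega> = UNIV and A = "\<lambda>n. {..real n}"])
  fix X :: "real set" assume "X \<in> range atMost"
  then obtain r where X: "X = {..r}" by auto
  have 1: "emeasure (distr (lborel :: R3 measure) borel norm) X = emeasure lborel (cball (0::R3) r)"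
    unfolding X by (subst emeasure_distr) (auto intro!: arg_cong[of _ _ "emeasure lborel"])
  show "emeasure (distr (lborel :: R3 measure) borel norm) X =
      emeasure (density lborel (\<lambda>r. ennreal (4 * pi * r\<^sup>2) * indicator {0..} r)) X"
  proof (cases "0 \<le> r")
    case True
    have "emeasure (density lborel (\<lambda>r. ennreal (4 * pi * r\<^sup>2) * indicator {0..} r)) X
        = (\<integral>\<^sup>+x. ennreal (4 * pi * x\<^sup>2) * indicator {0..r} x \<partial>lborel)"
      unfolding X by (subst emeasure_density) (auto intro!: nn_integral_cong simp: indicator_def)
    also have "\<dots> = ennreal (4/3 * pi * r ^ 3 - 4/3 * pi * 0 ^ 3)"
      by (rule nn_integral_FTC_Icc) (use True in \<open>auto intro!: derivative_eq_intros simp: field_simps power2_eq_square\<close>)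
    also have "\<dots> = emeasure lborel (cball (0::R3) r)"
      using True by (simp add: emeasure_cball unit_ball_vol_3)
    finally show ?thesis using 1 by simp
  next
    case False
    then have "cball (0::R3) r = {}" by simp
    moreover have "emeasure (density lborel (\<lambda>r. ennreal (4 * pi * r\<^sup>2) * indicator {0..} r)) X = 0"
      unfolding X using False
      by (subst emeasure_density) (auto simp: indicator_def nn_integral_0_iff_AE)
    ultimately show ?thesis using 1 by simp
  qed
next
  show "sets (distr (lborel :: R3 measure) borel norm) = sigma_sets UNIV (range atMost)"
    by (simp add: borel_eq_atMost)
  show "sets (density lborel (\<lambda>r. ennreal (4 * pi * r\<^sup>2) * indicator {0..} r)) = sigma_sets UNIV (range atMost)"
    by (simp add: borel_eq_atMost)
  show "(\<Union>n. {..real n}) = UNIV"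
    using real_arch_simple by auto
  show "emeasure (distr (lborel :: R3 measure) borel norm) {..real n} \<noteq> \<infinity>" for n
  proof -
    have "emeasure (distr (lborel :: R3 measure) borel norm) {..real n} = emeasure lborel (cball (0::R3) (real n))"
      by (subst emeasure_distr) (auto intro!: arg_cong[of _ _ "emeasure lborel"])
    then show ?thesis by (simp add: emeasure_cball)
  qed
qed (auto simp: Int_stable_def)

lemma nn_integral_radial:
  assumes [measurable]: "f \<in> borel_measurable borel"
  shows "(\<integral>\<^sup>+z. f (norm (z :: R3)) \<partial>lborel) = (\<integral>\<^sup>+r. f r * (ennreal (4 * pi * r\<^sup>2) * indicator {0..} r) \<partial>lborel)"
proof -
  have "(\<integral>\<^sup>+z. f (norm (z :: R3)) \<partial>lborel) = (\<integral>\<^sup>+r. f r \<partial>distr (lborel :: R3 measure) borel norm)"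
    by (subst nn_integral_distr) auto
  also have "\<dots> = (\<integral>\<^sup>+r. f r * (ennreal (4 * pi * r\<^sup>2) * indicator {0..} r) \<partial>lborel)"
    unfolding distr_norm_lborel by (subst nn_integral_density) (auto simp: mult.commute)
  finally show ?thesis .
qed

text \<open>The density \<open>4 * pi * r\<^sup>2\<close> of spheres cancels the singularity
  exactly. Every singular kernel of the limiting potentials, such as \<open>1 / norm z\<close> or
  \<open>z $ i / norm z ^ 3\<close>, is at most of this order at the origin.\<close>

lemma nn_integral_inverse_norm2:
  assumes "0 \<le> B"
  shows "(\<integral>\<^sup>+z. ennreal (indicator (cball 0 B) z / (norm (z::R3))\<^sup>2) \<partial>lborel) = ennreal (4 * pi * B)"
proof -
  have "(\<integral>\<^sup>+z. ennreal (indicator (cball 0 B) z / (norm (z::R3))\<^sup>2) \<partial>lborel) =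
      (\<integral>\<^sup>+z. ennreal (indicator {..B} (norm z) / (norm (z::R3))\<^sup>2) \<partial>lborel)"
    by (intro nn_integral_cong) (auto simp: indicator_def)
  also have "\<dots> = (\<integral>\<^sup>+r. ennreal (indicator {..B} r / r\<^sup>2) * (ennreal (4 * pi * r\<^sup>2) * indicator {0..} r) \<partial>lborel)"
    by (rule nn_integral_radial) simp
  also have "\<dots> = (\<integral>\<^sup>+r. ennreal (4 * pi) * indicator {0..B} r \<partial>lborel)"
  proof (rule nn_integral_cong_AE)
    have "AE r in lborel. r \<noteq> (0::real)" by (rule AE_lborel_singleton)
    then show "AE r in lborel. ennreal (indicator {..B} r / r\<^sup>2) * (ennreal (4 * pi * r\<^sup>2) * indicator {0..} r) =
        ennreal (4 * pi) * indicator {0..B} r"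
      by eventually_elim (auto simp: indicator_def ennreal_mult'[symmetric])
  qed
  also have "\<dots> = ennreal (4 * pi) * ennreal B"
    using assms by (subst nn_integral_cmult_indicator) auto
  finally show ?thesis by (simp add: ennreal_mult')
qed

lemma integrable_inverse_norm2:
  "integrable lborel (\<lambda>z::R3. indicator (cball 0 B) z / (norm z)\<^sup>2)"
proof (cases "0 \<le> B")
  case True
  then show ?thesis
    by (intro integrableI_nonneg borel_measurable_divide)
      (auto simp: nn_integral_inverse_norm2 intro!: borel_measurable_indicator)
next
  case False
  then have "indicator (cball (0::R3) B) z = (0::real)" for z by auto
  then show ?thesis by simp
qed

text \<open>The mass of this profile in the ball of radius \<open>r\<close> is
  \<open>4 * pi * (r / sqrt (r\<^sup>2 + 1)) ^ 3\<close>, which tends to \<open>4 * pi\<close>.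
  Scaled to width \<open>d\<close> the profile is the approximate identity left over by the
  regularisation, and its total mass is the factor \<open>4 * pi\<close> of the retarded
  potential.\<close>

lemma integral_delta_profile:
  "has_bochner_integral lborel (\<lambda>z::R3. 3 / (sqrt ((norm z)\<^sup>2 + 1)) ^ 5) (4 * pi)"
proof (rule has_bochner_integral_nn_integral)
  define F where "F r = 4 * pi * (r / sqrt (r\<^sup>2 + 1)) ^ 3" for r :: real
  have "(\<integral>\<^sup>+z. ennreal (3 / (sqrt ((norm (z::R3))\<^sup>2 + 1)) ^ 5) \<partial>lborel) =
      (\<integral>\<^sup>+r. ennreal (3 / (sqrt (r\<^sup>2 + 1)) ^ 5) * (ennreal (4 * pi * r\<^sup>2) * indicator {0..} r) \<partial>lborel)"
    by (rule nn_integral_radial) simp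
  also have "\<dots> = (\<integral>\<^sup>+r. ennreal (12 * pi * r\<^sup>2 / (sqrt (r\<^sup>2 + 1)) ^ 5) * indicator {0..} r \<partial>lborel)"
    by (intro nn_integral_cong) (auto simp: indicator_def ennreal_mult'[symmetric])
  also have "\<dots> = ennreal (4 * pi - F 0)"
  proof (rule nn_integral_FTC_atLeast)
    fix r :: real
    define q where "q = sqrt (r\<^sup>2 + 1)"
    have pos: "0 < r\<^sup>2 + 1" by (simp add: add_nonneg_pos)
    then have q: "q > 0" "q\<^sup>2 = r\<^sup>2 + 1" unfolding q_def by (auto simp: less_imp_le)
    have "((\<lambda>r. sqrt (r\<^sup>2 + 1)) has_real_derivative inverse q / 2 * (2 * r)) (at r)"
      unfolding q_def using pos by (auto intro!: derivative_eq_intros)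
    then have "((\<lambda>r. sqrt (r\<^sup>2 + 1)) has_real_derivative r / q) (at r)"
      by (simp add: field_simps)
    from DERIV_divide[OF DERIV_ident this]
    have "((\<lambda>r. r / sqrt (r\<^sup>2 + 1)) has_real_derivative (1 * q - r * (r / q)) / (q * q)) (at r)"
      using q(1) by (simp add: q_def)
    from DERIV_cmult[OF DERIV_power[OF this, of 3], of "4 * pi"]
    have "(F has_real_derivative 4 * pi * (3 * ((1 * q - r * (r / q)) / (q * q) * (r / q)\<^sup>2))) (at r)"
      unfolding F_def q_def by simp
    also have "(1 * q - r * (r / q)) / (q * q) = 1 / q ^ 3"
      using q by (simp add: field_simps power2_eq_square power3_eq_cube)
    also have "4 * pi * (3 * (1 / q ^ 3 * (r / q)\<^sup>2)) = 12 * pi * r\<^sup>2 / q ^ 5"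
      using q(1) by (simp add: field_simps eval_nat_numeral)
    finally show "(F has_real_derivative 12 * pi * r\<^sup>2 / (sqrt (r\<^sup>2 + 1)) ^ 5) (at r)" by (simp add: q_def)
  next
    have 1: "((\<lambda>r::real. 1 + inverse r ^ 2) \<longlongrightarrow> 1 + 0 ^ 2) at_top"
      by (intro tendsto_intros tendsto_inverse_0_at_top filterlim_ident)
    have "((\<lambda>r::real. 1 / sqrt (1 + inverse r ^ 2)) \<longlongrightarrow> 1 / sqrt (1 + 0 ^ 2)) at_top"
      by (intro tendsto_divide tendsto_real_sqrt 1 tendsto_const) auto
    moreover have "\<forall>\<^sub>F r::real in at_top. 1 / sqrt (1 + inverse r ^ 2) = r / sqrt (r\<^sup>2 + 1)"
      using eventually_gt_at_top[of 0]
    proof eventually_elim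
      case (elim r)
      have "sqrt (r\<^sup>2 + 1) = sqrt (r\<^sup>2 * (1 + inverse r ^ 2))" using elim by (simp add: field_simps)
      also have "\<dots> = r * sqrt (1 + inverse r ^ 2)" using elim by (simp add: real_sqrt_mult)
      finally show ?case using elim by simp
    qed
    ultimately have "((\<lambda>r::real. r / sqrt (r\<^sup>2 + 1)) \<longlongrightarrow> 1) at_top"
      by (simp add: tendsto_cong)
    then have "(F \<longlongrightarrow> 4 * pi * 1 ^ 3) at_top" unfolding F_def by (intro tendsto_intros)
    then show "(F \<longlongrightarrow> 4 * pi) at_top" by simp
  qed auto
  finally show "(\<integral>\<^sup>+z. ennreal (3 / (sqrt ((norm (z::R3))\<^sup>2 + 1)) ^ 5) \<partial>lborel) = ennreal (4 * pi)"
    by (simp add: F_def)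
qed (auto intro!: AE_I2)

text \<open>Lebesgue measure is translation invariant, and integrability is preserved in both
  directions; if it fails, both sides have the default value 0. The equation can thus recentre
  potentials without side conditions.\<close>

lemma integral_translate:
  fixes f :: "'a::euclidean_space \<Rightarrow> real"
  shows "(LINT z|lborel. f (c + z)) = (LINT z|lborel. f z)"
    and integrable_translate: "integrable lborel f \<Longrightarrow> integrable lborel (\<lambda>z. f (c + z))"
proof -
  have 1: "lborel = distr lborel borel (\<lambda>z. c + z)" for c :: 'a
    using lborel_affine[of 1 c] by (simp add: density_1)
  have int: "integrable lborel (\<lambda>z. f (c + z))" if "integrable lborel f" for c and f :: "'a \<Rightarrow> real"
    using that by (subst (asm) 1[of c], subst (asm) integrable_distr_eq) (auto dest: borel_measurable_integrable)
  then show "integrable lborel f \<Longrightarrow> integrable lborel (\<lambda>z. f (c + z))" .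
  show "(LINT z|lborel. f (c + z)) = (LINT z|lborel. f z)"
  proof (cases "integrable lborel f")
    case True
    show ?thesis by (subst (2) 1[of c], subst integral_distr) (use True in \<open>auto dest: borel_measurable_integrable\<close>)
  next
    case False
    moreover have "\<not> integrable lborel (\<lambda>z. f (c + z))"
      using int[of "\<lambda>z. f (c + z)" "- c"] False by auto
    ultimately show ?thesis by (simp add: not_integrable_integral_eq)
  qed
qed

lemma integral_scale:
  fixes f :: "R3 \<Rightarrow> real"
  assumes "0 < d" and f: "integrable lborel f"
  shows "(LINT z|lborel. f z) = d ^ 3 * (LINT z|lborel. f (d *\<^sub>R z))"
proof -
  have 1: "lborel = density (distr lborel borel (\<lambda>x::R3. d *\<^sub>R x)) (\<lambda>_. ennreal (d ^ 3))"
    using lborel_affine[of d "0::R3"] assms(1) by simp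
  show ?thesis
    using f by (subst 1, subst integral_density)
      (use assms(1) in \<open>auto simp: integral_distr dest: borel_measurable_integrable\<close>)
qed

lemma integral_compact_support:
  fixes f :: "'a::euclidean_space \<Rightarrow> real"
  assumes "continuous_on UNIV f" "\<And>z. z \<notin> cbox a b \<Longrightarrow> f z = 0"
  shows "integrable lborel f" "(LINT z|lborel. f z) = integral (cbox a b) f"
proof -
  have eq: "indicator (cbox a b) z *\<^sub>R f z = f z" for z using assms(2) by (auto simp: indicator_def)
  have "set_integrable lborel (cbox a b) f"
    unfolding set_integrable_def
    by (rule borel_integrable_compact) (auto intro: continuous_on_subset assms)
  from this set_borel_integral_eq_integral(2)[OF this]
  show "integrable lborel f" "(LINT z|lborel. f z) = integral (cbox a b) f"
    unfolding set_integrable_def set_lebesgue_integral_def eq by auto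
qed

lemma cball_subset_cube:
  fixes z :: "'a::euclidean_space"
  shows "norm z \<le> B \<Longrightarrow> z \<in> cbox (- B *\<^sub>R One) (B *\<^sub>R One)"
  unfolding mem_box
proof
  fix i :: 'a assume "norm z \<le> B" "i \<in> Basis"
  then show "- B *\<^sub>R One \<bullet> i \<le> z \<bullet> i \<and> z \<bullet> i \<le> B *\<^sub>R One \<bullet> i"
    using Basis_le_norm[of i z] by (simp add: inner_sum_left_Basis abs_le_iff)
qed

lemma integral_ball_support:
  fixes f :: "R3 \<Rightarrow> real"
  assumes "continuous_on UNIV f" "\<And>z. B < norm z \<Longrightarrow> f z = 0"
  shows "integrable lborel f"
    and "(LINT z|lborel. f z) = integral (cbox (- B *\<^sub>R One) (B *\<^sub>R One)) f"
proof -
  have "f z = 0" if "z \<notin> cbox (- B *\<^sub>R One) (B *\<^sub>R One)" for z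
    using that assms(2)[of z] cball_subset_cube[of z B] by force
  from integral_compact_support[OF assms(1) this]
  show "integrable lborel f" "(LINT z|lborel. f z) = integral (cbox (- B *\<^sub>R One) (B *\<^sub>R One)) f"
    by auto
qed

text \<open>The integral of the translate \<open>f (z + h *\<^sub>R v)\<close> does not depend on
  \<open>h\<close>, so its derivative at 0, taken under the integral sign, vanishes. This is one
  component of the divergence theorem for compact support.\<close>

lemma integral_partial_zero:
  fixes f f' :: "R3 \<Rightarrow> real" and v :: R3
  assumes f: "continuous_on UNIV f" and f': "continuous_on UNIV f'"
    and der: "\<And>z. ((\<lambda>h. f (z + h *\<^sub>R v)) has_real_derivative f' z) (at 0)"
    and supp: "\<And>z. B < norm z \<Longrightarrow> f z = 0"
  shows "(LINT z|lborel. f' z) = 0"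
proof -
  \<comment> \<open>A shift by \<open>h *\<^sub>R v\<close> with \<open>h\<close> between -1 and 1
    moves the support by at most \<open>norm v\<close>, so one cube serves all shifts.\<close>
  define K where "K = B + norm v"
  define c where "c = (cbox (- K *\<^sub>R One) (K *\<^sub>R One) :: R3 set)"
  have supp': "f' z = 0" if "B < norm z" for z
  proof -
    have "\<forall>\<^sub>F h in nhds 0. B < norm (z + h *\<^sub>R v)"
    proof (rule order_tendstoD(1)[of "\<lambda>h. norm (z + h *\<^sub>R v)" "norm z" "nhds 0"])
      have "((\<lambda>h. norm (z + h *\<^sub>R v)) \<longlongrightarrow> norm (z + 0 *\<^sub>R v)) (nhds 0)"
        by (intro tendsto_intros filterlim_ident)
      then show "((\<lambda>h. norm (z + h *\<^sub>R v)) \<longlongrightarrow> norm z) (nhds 0)" by simp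
    qed (use that in simp)
    then have "\<forall>\<^sub>F h in nhds 0. f (z + h *\<^sub>R v) = 0"
      by eventually_elim (use supp in auto)
    then have "((\<lambda>h. f (z + h *\<^sub>R v)) has_real_derivative 0) (at 0)"
      by (subst DERIV_cong_ev[OF refl _ refl]) auto
    then show ?thesis using der[of z] DERIV_unique by blast
  qed
  have line: "((\<lambda>h. f (z + h *\<^sub>R v)) has_real_derivative f' (z + h0 *\<^sub>R v)) (at h0)" for z h0
  proof -
    have "((\<lambda>h. f ((z + h0 *\<^sub>R v) + (h + - h0) *\<^sub>R v)) has_real_derivative f' (z + h0 *\<^sub>R v)) (at h0)"
      using der[of "z + h0 *\<^sub>R v"] DERIV_shift[of "\<lambda>h. f ((z + h0 *\<^sub>R v) + h *\<^sub>R v)" _ h0 "- h0"] by simp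
    then show ?thesis by (simp add: algebra_simps)
  qed
  have cont_shift: "continuous_on UNIV (\<lambda>z. f (z + h *\<^sub>R v))" for h
    by (rule continuous_on_compose2[OF f]) (auto intro!: continuous_intros)
  have const: "integral c (\<lambda>z. f (z + h *\<^sub>R v)) = (LINT z|lborel. f z)" if "h \<in> {-1<..<1}" for h
  proof -
    have "f (z + h *\<^sub>R v) = 0" if "K < norm z" for z
    proof (rule supp)
      have "norm z \<le> norm (z + h *\<^sub>R v) + norm (h *\<^sub>R v)"
        by (metis add_diff_cancel_right' norm_triangle_ineq4)
      moreover have "norm (h *\<^sub>R v) \<le> norm v" using \<open>h \<in> {-1<..<1}\<close>
        by (simp add: mult_left_le_one_le abs_le_iff)
      ultimately show "B < norm (z + h *\<^sub>R v)" using that by (simp add: K_def)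
    qed
    from integral_ball_support(2)[OF cont_shift this]
    show ?thesis using integral_translate[of f "h *\<^sub>R v"] by (simp add: c_def add.commute)
  qed
  have "((\<lambda>h. integral c (\<lambda>z. f (z + h *\<^sub>R v))) has_real_derivative integral c (\<lambda>z. f' (z + 0 *\<^sub>R v)))
      (at 0 within {-1<..<1})"
    unfolding c_def
  proof (rule leibniz_rule_field_derivative)
    show "((\<lambda>h. f (z + h *\<^sub>R v)) has_real_derivative f' (z + h *\<^sub>R v)) (at h within {- 1<..<1})" for h z
      using line by (rule has_field_derivative_at_within)
    show "(\<lambda>z. f (z + h *\<^sub>R v)) integrable_on cbox (- K *\<^sub>R One) (K *\<^sub>R One)" for h
      by (rule integrable_continuous[OF continuous_on_subset[OF cont_shift]]) simp
    show "continuous_on ({- 1<..<1} \<times> cbox (- K *\<^sub>R One) (K *\<^sub>R One)) (\<lambda>(h, z). f' (z + h *\<^sub>R v))"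
      unfolding case_prod_beta' by (rule continuous_on_compose2[OF f']) (auto intro!: continuous_intros)
  qed auto
  then have "((\<lambda>h. integral c (\<lambda>z. f (z + h *\<^sub>R v))) has_real_derivative integral c f') (at 0)"
    by (simp add: at_within_open[of 0 "{-1<..<1::real}"])
  moreover have "((\<lambda>h. integral c (\<lambda>z. f (z + h *\<^sub>R v))) has_real_derivative 0) (at 0)"
  proof -
    have "\<forall>\<^sub>F h in nhds 0. integral c (\<lambda>z. f (z + h *\<^sub>R v)) = (LINT z|lborel. f z)"
      using eventually_nhds_in_open[of "{-1<..<1::real}" 0] by (auto elim!: eventually_mono simp: const)
    then show ?thesis by (subst DERIV_cong_ev[OF refl _ refl]) auto
  qed
  ultimately have "integral c f' = 0" using DERIV_unique by blast
  moreover have "(LINT z|lborel. f' z) = integral c f'"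
    unfolding c_def
  proof (rule integral_ball_support(2)[OF f'])
    fix z :: R3 assume "K < norm z"
    then show "f' z = 0" using supp'[of z] norm_ge_zero[of v] by (simp add: K_def)
  qed
  ultimately show ?thesis by simp
qed

section \<open>Retarded potentials\<close>

definition Lap :: "(real \<Rightarrow> R3 \<Rightarrow> real) \<Rightarrow> real \<Rightarrow> R3 \<Rightarrow> real" where
  "Lap u t x = (\<Sum>i\<in>UNIV. Dx i (Dx i u) t x)"

lemma laplacian_eq_Lap: "laplacian (u t) x = Lap u t x"
  by (simp add: laplacian_def divergence_def grad_def Lap_def Dx_def[abs_def])

lemma smooth_spacetime_Lap: "smooth_spacetime u \<Longrightarrow> smooth_spacetime (Lap u)"
  unfolding Lap_def[abs_def] by (intro smooth_intros)

text \<open>Evaluated at the retarded time \<open>t - norm z\<close>, the extension by zero to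
  negative times cuts every potential off at the ball of radius \<open>t\<close>. All integrals then
  range over the whole space.\<close>

definition zext :: "(real \<Rightarrow> R3 \<Rightarrow> real) \<Rightarrow> real \<Rightarrow> R3 \<Rightarrow> real" where
  "zext h s y = (if 0 \<le> s then h s y else 0)"

lemma continuous_on_zext:
  assumes h: "smooth_spacetime h" "\<And>y. h 0 y = 0" and f: "continuous_on A f" and g: "continuous_on A g"
  shows "continuous_on A (\<lambda>a. zext h (f a) (g a))"
proof -
  \<comment> \<open>Since \<open>h\<close> vanishes at time 0, clamping the time at 0 gives the same
    function and exhibits it as a composition of continuous maps.\<close>
  have "zext h s y = h (max 0 s) y" for s y
    using h(2) by (auto simp: zext_def max_def)
  moreover have "continuous_on A (\<lambda>a. h (max 0 (f a)) (g a))"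
    by (intro continuous_on_spacetime[OF h(1)] continuous_on_max continuous_on_const f g) auto
  ultimately show ?thesis by simp
qed

lemma spacetime_has_derivative:
  assumes "smooth_spacetime h" "0 \<le> s"
  shows "((\<lambda>(s, y). h s y) has_derivative (\<lambda>(a, v). a * Dt h s y + (\<Sum>i\<in>UNIV. v $ i * Dx i h s y)))
    (at (s, y) within {0..} \<times> UNIV)"
proof -
  let ?D = "frechet_derivative (\<lambda>(s, y). h s y) (at (s, y) within {0..} \<times> UNIV)"
  have D: "((\<lambda>(s, y). h s y) has_derivative ?D) (at (s, y) within {0..} \<times> UNIV)"
    using assms unfolding smooth_spacetime_def by (intro smooth_on_has_derivative) auto
  have lin: "linear ?D" using D has_derivative_bounded_linear bounded_linear.linear by blast
  have "?D (a, v) = a * Dt h s y + (\<Sum>i\<in>UNIV. v $ i * Dx i h s y)" for a v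
  proof -
    have "(a, v) = a *\<^sub>R (1, 0) + (\<Sum>i\<in>UNIV. v $ i *\<^sub>R (0, axis i 1))"
    proof -
      have "v = (\<Sum>i\<in>UNIV. v $ i *\<^sub>R axis i 1)"
        using basis_expansion[of v] by (simp add: scalar_mult_eq_scaleR)
      then show ?thesis by (simp add: prod_eq_iff fst_sum snd_sum)
    qed
    then have "?D (a, v) = a *\<^sub>R ?D (1, 0) + (\<Sum>i\<in>UNIV. v $ i *\<^sub>R ?D (0, axis i 1))"
      by (simp only: linear_add[OF lin] linear_scale[OF lin] linear_sum[OF lin])
    then show ?thesis using assms by (simp add: Dt_frechet Dx_frechet)
  qed
  then have "?D = (\<lambda>(a, v). a * Dt h s y + (\<Sum>i\<in>UNIV. v $ i * Dx i h s y))" by auto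
  then show ?thesis using D by metis
qed

lemma Dx_zero_at: "(\<And>y. h s y = 0) \<Longrightarrow> Dx i h s y = 0"
proof -
  assume "\<And>y. h s y = 0"
  then have "Dx i h s y = Dx i (\<lambda>t x. 0) s y" by (intro Dx_cong)
  then show ?thesis by (simp add: Dx_def)
qed

text \<open>At time 0 the function and all its first derivatives vanish, the spatial ones because
  \<open>h 0\<close> is identically zero, so the two halves glue. Each derivative taken of a zero
  extension thus costs one more vanishing datum at time 0.\<close>

lemma zext_has_derivative:
  assumes h: "smooth_spacetime h" and 0: "\<And>y. h 0 y = 0" "\<And>y. Dt h 0 y = 0"
  shows "((\<lambda>(s, y). zext h s y) has_derivative
    (\<lambda>(a, v). a * zext (Dt h) s y + (\<Sum>i\<in>UNIV. v $ i * zext (Dx i h) s y))) (at (s, y))"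
proof -
  let ?S = "{0::real..} \<times> (UNIV :: R3 set)" and ?T = "{..<0::real} \<times> (UNIV :: R3 set)"
  let ?f' = "\<lambda>(s, y) (a, v). a * Dt h s y + (\<Sum>i\<in>UNIV. v $ i * Dx i h s y)"
  have cl: "closure ?S = ?S" "closure ?T = {..0} \<times> UNIV"
    by (simp_all add: closure_Times)
  have Dx0: "Dx i h 0 y = 0" for i y by (rule Dx_zero_at) (rule 0)
  have "((\<lambda>p. if p \<in> ?S then (\<lambda>(s, y). h s y) p else 0) has_derivative
     (if (s, y) \<in> ?S then ?f' (s, y) else (\<lambda>p. 0))) (at (s, y) within (?S \<union> ?T))"
  proof (rule has_derivative_If_within_closures)
    assume "(s, y) \<in> ?S \<union> (closure ?S \<inter> closure ?T)"
    then have s: "0 \<le> s" by (auto simp: cl)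
    have "?S \<union> (closure ?S \<inter> closure ?T) = ?S" by (auto simp: cl)
    then show "((\<lambda>(s, y). h s y) has_derivative ?f' (s, y)) (at (s, y) within ?S \<union> (closure ?S \<inter> closure ?T))"
      using spacetime_has_derivative[OF h s] by (simp add: case_prod_unfold)
  next
    show "(case (s, y) of (s, y) \<Rightarrow> h s y) = 0" if "(s, y) \<in> closure ?S" "(s, y) \<in> closure ?T"
      using that by (auto simp: cl 0)
    show "?f' (s, y) = (\<lambda>p. 0)" if "(s, y) \<in> closure ?S" "(s, y) \<in> closure ?T"
      using that by (auto simp: cl 0 Dx0)
  qed auto
  moreover have "?S \<union> ?T = UNIV" by auto
  moreover have "(\<lambda>p. if p \<in> ?S then (\<lambda>(s, y). h s y) p else 0) = (\<lambda>(s, y). zext h s y)"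
    by (auto simp: zext_def)
  moreover have "(if (s, y) \<in> ?S then ?f' (s, y) else (\<lambda>p. 0)) =
      (\<lambda>(a, v). a * zext (Dt h) s y + (\<Sum>i\<in>UNIV. v $ i * zext (Dx i h) s y))"
    by (auto simp: zext_def)
  ultimately show ?thesis by simp
qed

section \<open>The regularised distance and the divergence identity at the retarded time\<close>

definition rnorm :: "real \<Rightarrow> R3 \<Rightarrow> real" where
  "rnorm d z = sqrt ((norm z)\<^sup>2 + d\<^sup>2)"

lemma rnorm_pos: "0 < d \<Longrightarrow> 0 < rnorm d z"
  unfolding rnorm_def by (simp add: add_nonneg_pos)

lemma rnorm_power2: "(rnorm d z)\<^sup>2 = (norm z)\<^sup>2 + d\<^sup>2"
  unfolding rnorm_def by simp

lemma norm_le_rnorm: "norm z \<le> rnorm d z"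
  unfolding rnorm_def by (rule real_le_rsqrt) simp

lemma le_rnorm: "d \<le> rnorm d z"
  unfolding rnorm_def by (rule real_le_rsqrt) simp

lemma continuous_on_rnorm [continuous_intros]:
  "continuous_on A f \<Longrightarrow> continuous_on A (\<lambda>a. rnorm d (f a))"
  unfolding rnorm_def by (intro continuous_intros)

lemma rnorm_tendsto:
  assumes "d \<longlonglongrightarrow> 0" shows "(\<lambda>n. rnorm (d n) z) \<longlonglongrightarrow> norm z"
proof -
  have "(\<lambda>n. rnorm (d n) z) \<longlonglongrightarrow> sqrt ((norm z)\<^sup>2 + 0\<^sup>2)"
    unfolding rnorm_def by (intro tendsto_intros assms)
  then show ?thesis by simp
qed

lemma rnorm_line:
  assumes "0 < d"
  shows "((\<lambda>h. rnorm d (z + h *\<^sub>R axis i 1)) has_real_derivative z $ i / rnorm d z) (at 0)"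
proof -
  have eq: "(norm (z + h *\<^sub>R axis i 1))\<^sup>2 = (norm z)\<^sup>2 + 2 * h * z $ i + h\<^sup>2" for h :: real
    unfolding power2_norm_eq_inner
    by (simp add: inner_add_left inner_add_right inner_axis inner_axis' power2_eq_square algebra_simps)
  have pos: "0 < (norm z)\<^sup>2 + d\<^sup>2" using assms by (simp add: add_nonneg_pos)
  have "((\<lambda>h. sqrt ((norm z)\<^sup>2 + 2 * h * z $ i + h\<^sup>2 + d\<^sup>2)) has_real_derivative
      inverse (sqrt ((norm z)\<^sup>2 + d\<^sup>2)) / 2 * (2 * z $ i)) (at 0)"
    using pos by (auto intro!: derivative_eq_intros)
  then show ?thesis unfolding rnorm_def eq by (simp add: field_simps)
qed

lemma zext_line:
  assumes h: "smooth_spacetime h" "\<And>y. h 0 y = 0" "\<And>y. Dt h 0 y = 0" and d: "0 < d"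
  shows "((\<lambda>e. zext h (t - rnorm d (z + e *\<^sub>R axis i 1)) (x + (z + e *\<^sub>R axis i 1))) has_real_derivative
    zext (Dx i h) (t - rnorm d z) (x + z) - zext (Dt h) (t - rnorm d z) (x + z) * z $ i / rnorm d z) (at 0)"
proof -
  have 1: "((\<lambda>e. t - rnorm d (z + e *\<^sub>R axis i 1)) has_derivative (\<lambda>e. - (z $ i / rnorm d z) * e)) (at 0)"
    by (rule has_derivative_eq_rhs[OF DERIV_diff[OF DERIV_const[of t] rnorm_line[OF d, of z i],
        unfolded has_field_derivative_def]]) (simp add: fun_eq_iff)
  have 2: "((\<lambda>e. x + (z + e *\<^sub>R axis i 1)) has_derivative (\<lambda>e. 0 + (0 + e *\<^sub>R axis i (1::real)))) (at 0)"
    by (intro has_derivative_add has_derivative_const has_derivative_scaleR_left has_derivative_ident)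
  have 3: "((\<lambda>e. (t - rnorm d (z + e *\<^sub>R axis i 1), x + (z + e *\<^sub>R axis i 1))) has_derivative
     (\<lambda>e. (- (z $ i / rnorm d z) * e, 0 + (0 + e *\<^sub>R axis i 1)))) (at 0)"
    by (rule has_derivative_Pair[OF 1 2])
  have 4: "((\<lambda>(s, y). zext h s y) has_derivative
    (\<lambda>(a, v). a * zext (Dt h) (t - rnorm d z) (x + z) + (\<Sum>j\<in>UNIV. v $ j * zext (Dx j h) (t - rnorm d z) (x + z))))
      (at (t - rnorm d (z + 0 *\<^sub>R axis i 1), x + (z + 0 *\<^sub>R axis i 1)))"
    using zext_has_derivative[OF h] by simp
  have sum: "(\<Sum>j\<in>UNIV. (e *\<^sub>R axis i (1::real)) $ j * w j) = e * w i" for e :: real and w :: "3 \<Rightarrow> real"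
  proof -
    have "(\<Sum>j\<in>UNIV. (e *\<^sub>R axis i (1::real)) $ j * w j) = (\<Sum>j\<in>UNIV. if j = i then e * w i else 0)"
      by (rule sum.cong) (auto simp: axis_def)
    then show ?thesis by simp
  qed
  show ?thesis
    unfolding has_field_derivative_def
    by (rule has_derivative_eq_rhs[OF diff_chain_at[OF 3 4, unfolded o_def split_conv]])
      (unfold split_conv add_0_left sum, auto simp: fun_eq_iff algebra_simps)
qed

text \<open>Along the axis \<open>i\<close> through \<open>z\<close>, the functions
  \<open>p\<close>, \<open>q\<close> and \<open>w\<close> are the retarded values of the spatial
  derivative, the time derivative and the value of one function, \<open>c\<close> is
  \<open>z $ i\<close> and \<open>a\<close> the regularised distance. The mixed derivative
  \<open>pti\<close> enters through \<open>p\<close> and through \<open>q\<close> with opposite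
  signs, and the terms in \<open>p 0\<close> cancel as well.\<close>

lemma component_derivative:
  fixes p q w a :: "real \<Rightarrow> real"
  assumes "(p has_real_derivative pii - pti * c / a 0) (at 0)"
    and "(q has_real_derivative pti - qt * c / a 0) (at 0)"
    and "(w has_real_derivative p 0 - q 0 * c / a 0) (at 0)"
    and "(a has_real_derivative c / a 0) (at 0)" and "0 < a 0"
  shows "((\<lambda>e. (p e + q e * (c + e) / a e) / a e + w e * (c + e) / a e ^ 3) has_real_derivative
     (pii - qt * c\<^sup>2 / (a 0)\<^sup>2) / a 0 + q 0 * (1 / (a 0)\<^sup>2 - 3 * c\<^sup>2 / a 0 ^ 4)
       + w 0 * (1 / a 0 ^ 3 - 3 * c\<^sup>2 / a 0 ^ 5)) (at 0)"
proof -
  have a: "a 0 \<noteq> 0" using assms(5) by simp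
  have c: "((\<lambda>e. c + e) has_real_derivative 1) (at 0)" by (auto intro!: derivative_eq_intros)
  have a3: "((\<lambda>e. a e ^ 3) has_real_derivative 3 * (c / a 0 * (a 0)\<^sup>2)) (at 0)"
    using DERIV_power[OF assms(4), of 3] by simp
  have a3': "a 0 ^ 3 \<noteq> 0" using a by simp
  note D = DERIV_add[OF DERIV_divide[OF DERIV_add[OF assms(1) DERIV_divide[OF DERIV_mult[OF assms(2) c] assms(4) a]] assms(4) a]
    DERIV_divide[OF DERIV_mult[OF assms(3) c] a3 a3']]
  show ?thesis
    by (rule DERIV_cong[OF D]) (use a in \<open>simp add: field_simps eval_nat_numeral\<close>)
qed

text \<open>The vector field integrated here is \<open>([\<nabla>J] + [J\<^sub>t] e) / a + [J] e / a\<^sup>2\<close> with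
  \<open>a = sqrt(|z|\<^sup>2 + d\<^sup>2)\<close>, \<open>e = z / a\<close> and \<open>[h]\<close> the value of \<open>h\<close> at the retarded time \<open>t - a\<close>;
  the regularisation \<open>d\<close> keeps it \<open>C\<^sup>1\<close> at the origin.\<close>

lemma regularised_potential_component:
  fixes x :: R3 and t :: real and i :: 3
  assumes J: "smooth_spacetime J" and 0: "\<And>y. J 0 y = 0" "\<And>y. Dt J 0 y = 0" "\<And>y. Dt (Dt J) 0 y = 0"
    and d: "0 < d"
  defines "a \<equiv> rnorm d"
  defines "G \<equiv> \<lambda>z. (zext (Dx i (Dx i J)) (t - a z) (x + z) - zext (Dt (Dt J)) (t - a z) (x + z) * (z $ i)\<^sup>2 / (a z)\<^sup>2) / a z
       + zext (Dt J) (t - a z) (x + z) * (1 / (a z)\<^sup>2 - 3 * (z $ i)\<^sup>2 / a z ^ 4)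
       + zext J (t - a z) (x + z) * (1 / a z ^ 3 - 3 * (z $ i)\<^sup>2 / a z ^ 5)"
  shows "continuous_on UNIV G" and "\<And>z. t < norm z \<Longrightarrow> G z = 0" and "(LINT z|lborel. G z) = 0"
proof -
  have a: "0 < a z" "a z \<noteq> 0" "norm z \<le> a z" for z using rnorm_pos[OF d, of z] norm_le_rnorm by (auto simp: a_def)
  have ca [continuous_intros]: "continuous_on UNIV a" unfolding a_def by (intro continuous_intros)
  have Dx0: "Dx i J 0 y = 0" "Dx i (Dx i J) 0 y = 0" for y
    by (intro Dx_zero_at 0)+
  have DtDx0: "Dt (Dx i J) 0 y = 0" "Dx i (Dt J) 0 y = 0" for y
  proof -
    show "Dx i (Dt J) 0 y = 0" by (rule Dx_zero_at) (rule 0)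
    then show "Dt (Dx i J) 0 y = 0" by (simp add: Dt_Dx_commute[OF J])
  qed
  have cz: "continuous_on UNIV (\<lambda>z. zext h (t - a z) (x + z))" if "smooth_spacetime h" "\<And>y. h 0 y = 0" for h
    by (intro continuous_on_zext[OF that] continuous_intros)
  note cont = cz[OF J 0(1)] cz[OF smooth_spacetime_Dt[OF J] 0(2)]
    cz[OF smooth_spacetime_Dt[OF smooth_spacetime_Dt[OF J]] 0(3)]
    cz[OF smooth_spacetime_Dx[OF J] Dx0(1)] cz[OF smooth_spacetime_Dx[OF smooth_spacetime_Dx[OF J]] Dx0(2)]
  show cG: "continuous_on UNIV G"
    unfolding G_def by (intro continuous_intros cont) (use a in auto)
  show "G z = 0" if "t < norm z" for z
  proof -
    have "t - a z < 0" using that a(3)[of z] by linarith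
    then show ?thesis by (simp add: G_def zext_def)
  qed
  define X where "X z = (zext (Dx i J) (t - a z) (x + z) + zext (Dt J) (t - a z) (x + z) * z $ i / a z) / a z
     + zext J (t - a z) (x + z) * z $ i / a z ^ 3" for z
  show "(LINT z|lborel. G z) = 0"
  proof (rule integral_partial_zero)
    show "continuous_on UNIV X"
      unfolding X_def by (intro continuous_intros cont) (use a in auto)
    show "X z = 0" if "t < norm z" for z
    proof -
      have "t - a z < 0" using that a(3)[of z] by linarith
      then show ?thesis by (simp add: X_def zext_def)
    qed
    fix z
    let ?p = "\<lambda>e. zext (Dx i J) (t - a (z + e *\<^sub>R axis i 1)) (x + (z + e *\<^sub>R axis i 1))"
    let ?q = "\<lambda>e. zext (Dt J) (t - a (z + e *\<^sub>R axis i 1)) (x + (z + e *\<^sub>R axis i 1))"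
    let ?w = "\<lambda>e. zext J (t - a (z + e *\<^sub>R axis i 1)) (x + (z + e *\<^sub>R axis i 1))"
    let ?a = "\<lambda>e. a (z + e *\<^sub>R axis i 1)"
    have eq: "zext (Dt (Dx i J)) s y = zext (Dx i (Dt J)) s y" for s y
      using Dt_Dx_commute[OF J, of s i y] by (simp add: zext_def)
    have "((\<lambda>e. (?p e + ?q e * (z $ i + e) / ?a e) / ?a e + ?w e * (z $ i + e) / ?a e ^ 3) has_real_derivative
       (zext (Dx i (Dx i J)) (t - a z) (x + z) - zext (Dt (Dt J)) (t - a z) (x + z) * (z $ i)\<^sup>2 / (?a 0)\<^sup>2) / ?a 0
        + ?q 0 * (1 / (?a 0)\<^sup>2 - 3 * (z $ i)\<^sup>2 / ?a 0 ^ 4)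
       + ?w 0 * (1 / ?a 0 ^ 3 - 3 * (z $ i)\<^sup>2 / ?a 0 ^ 5)) (at 0)"
    proof (rule component_derivative[where pti = "zext (Dx i (Dt J)) (t - a z) (x + z)"])
      show "(?p has_real_derivative zext (Dx i (Dx i J)) (t - a z) (x + z) -
          zext (Dx i (Dt J)) (t - a z) (x + z) * z $ i / ?a 0) (at 0)"
        using zext_line[OF smooth_spacetime_Dx[OF J] Dx0(1) DtDx0(1) d, of t z i x]
        by (simp add: eq a_def)
      show "(?q has_real_derivative zext (Dx i (Dt J)) (t - a z) (x + z) -
          zext (Dt (Dt J)) (t - a z) (x + z) * z $ i / ?a 0) (at 0)"
        using zext_line[OF smooth_spacetime_Dt[OF J] 0(2) 0(3) d, of t z i x] by (simp add: a_def)
      show "(?w has_real_derivative ?p 0 - ?q 0 * z $ i / ?a 0) (at 0)"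
        using zext_line[OF J 0(1) 0(2) d, of t z i x] by (simp add: a_def)
      show "(?a has_real_derivative z $ i / ?a 0) (at 0)"
        using rnorm_line[OF d, of z i] by (simp add: a_def)
      show "0 < ?a 0" by (rule a)
    qed
    then show "((\<lambda>e. X (z + e *\<^sub>R axis i 1)) has_real_derivative G z) (at 0)"
      by (simp add: X_def G_def)
  qed (rule cG)
qed

text \<open>Summed over the three components, the squares \<open>(z $ i)\<^sup>2\<close> add up to
  \<open>(a z)\<^sup>2 - d\<^sup>2\<close>. The leading coefficients cancel as they do for the exact
  fundamental solution, and each remaining term carries a factor \<open>d\<^sup>2\<close>. In the
  limit only the last survives: it concentrates at the origin and returns the value of
  \<open>J\<close>.\<close>

lemma regularised_potential:
  assumes J: "smooth_spacetime J" and 0: "\<And>y. J 0 y = 0" "\<And>y. Dt J 0 y = 0" "\<And>y. Dt (Dt J) 0 y = 0"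
    and d: "0 < d"
  defines "a \<equiv> rnorm d"
  shows "(LINT z|lborel. zext (\<lambda>s y. Dt (Dt J) s y - Lap J s y) (t - a z) (x + z) / a z) =
    (LINT z|lborel. zext (Dt (Dt J)) (t - a z) (x + z) * (d\<^sup>2 / a z ^ 3)) +
    (LINT z|lborel. zext (Dt J) (t - a z) (x + z) * (3 * d\<^sup>2 / a z ^ 4)) +
    (LINT z|lborel. zext J (t - a z) (x + z) * (3 * d\<^sup>2 / a z ^ 5))"
proof -
  have a: "0 < a z" "a z \<noteq> 0" "norm z \<le> a z" for z using rnorm_pos[OF d, of z] norm_le_rnorm by (auto simp: a_def)
  have ca [continuous_intros]: "continuous_on UNIV a" unfolding a_def by (intro continuous_intros)
  define G where "G i z = (zext (Dx i (Dx i J)) (t - a z) (x + z) - zext (Dt (Dt J)) (t - a z) (x + z) * (z $ i)\<^sup>2 / (a z)\<^sup>2) / a z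
       + zext (Dt J) (t - a z) (x + z) * (1 / (a z)\<^sup>2 - 3 * (z $ i)\<^sup>2 / a z ^ 4)
       + zext J (t - a z) (x + z) * (1 / a z ^ 3 - 3 * (z $ i)\<^sup>2 / a z ^ 5)" for i z
  note comp = regularised_potential_component[OF J 0 d, where t = t and x = x, folded a_def, folded G_def]
  have cz: "continuous_on UNIV (\<lambda>z. zext h (t - a z) (x + z))" if "smooth_spacetime h" "\<And>y. h 0 y = 0" for h
    by (intro continuous_on_zext[OF that] continuous_intros)
  note cont = cz[OF J 0(1)] cz[OF smooth_spacetime_Dt[OF J] 0(2)]
    cz[OF smooth_spacetime_Dt[OF smooth_spacetime_Dt[OF J]] 0(3)]
  have int: "integrable lborel (\<lambda>z. zext h (t - a z) (x + z) * k z)"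
    if "continuous_on UNIV (\<lambda>z. zext h (t - a z) (x + z))" "continuous_on UNIV k" for h k
  proof (rule integral_ball_support(1)[where B = t])
    show "zext h (t - a z) (x + z) * k z = 0" if "t < norm z" for z
      using that a(3)[of z] by (simp add: zext_def)
  qed (intro continuous_intros that)
  have eq: "zext (\<lambda>s y. Dt (Dt J) s y - Lap J s y) (t - a z) (x + z) / a z =
      zext (Dt (Dt J)) (t - a z) (x + z) * (d\<^sup>2 / a z ^ 3)
      + zext (Dt J) (t - a z) (x + z) * (3 * d\<^sup>2 / a z ^ 4)
      + zext J (t - a z) (x + z) * (3 * d\<^sup>2 / a z ^ 5) - (\<Sum>i\<in>UNIV. G i z)" for z
  proof -
    have n: "(z $ 1)\<^sup>2 + (z $ 2)\<^sup>2 + (z $ 3)\<^sup>2 = (a z)\<^sup>2 - d\<^sup>2"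
      unfolding a_def rnorm_power2 by (simp add: norm_vec_def L2_set_def sum_3 sum_nonneg)
    have *: "(L1 - T * z1 / A\<^sup>2) / A + Q * (1 / A\<^sup>2 - 3 * z1 / A ^ 4) + W * (1 / A ^ 3 - 3 * z1 / A ^ 5) +
       ((L2 - T * z2 / A\<^sup>2) / A + Q * (1 / A\<^sup>2 - 3 * z2 / A ^ 4) + W * (1 / A ^ 3 - 3 * z2 / A ^ 5)) +
       ((L3 - T * z3 / A\<^sup>2) / A + Q * (1 / A\<^sup>2 - 3 * z3 / A ^ 4) + W * (1 / A ^ 3 - 3 * z3 / A ^ 5))
       = T * (d\<^sup>2 / A ^ 3) + Q * (3 * d\<^sup>2 / A ^ 4) + W * (3 * d\<^sup>2 / A ^ 5) - (T - (L1 + L2 + L3)) / A"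
      if "z1 + z2 + z3 = A\<^sup>2 - d\<^sup>2" "A \<noteq> 0" for L1 L2 L3 T Q W A z1 z2 z3 :: real
    proof -
      have z3: "z3 = A\<^sup>2 - d\<^sup>2 - z1 - z2" using that(1) by simp
      show ?thesis unfolding z3 using that(2) by (simp add: field_simps eval_nat_numeral)
    qed
    show ?thesis
      unfolding sum_3 G_def
      by (subst *[OF n a(2)]) (simp add: zext_def Lap_def sum_3)
  qed
  have intG: "integrable lborel (G i)" for i
    by (rule integral_ball_support(1)[where B = t]) (use comp(1)[where i = i] comp(2)[where i = i] in auto)
  have "(LINT z|lborel. (\<Sum>i\<in>UNIV. G i z)) = 0"
    using comp(3) by (subst Bochner_Integration.integral_sum) (auto intro: intG)
  moreover have "integrable lborel (\<lambda>z. \<Sum>i\<in>UNIV. G i z)"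
    by (intro Bochner_Integration.integrable_sum intG)
  moreover have "integrable lborel (\<lambda>z. zext (Dt (Dt J)) (t - a z) (x + z) * (d\<^sup>2 / a z ^ 3))"
    "integrable lborel (\<lambda>z. zext (Dt J) (t - a z) (x + z) * (3 * d\<^sup>2 / a z ^ 4))"
    "integrable lborel (\<lambda>z. zext J (t - a z) (x + z) * (3 * d\<^sup>2 / a z ^ 5))"
    by (intro int cont continuous_intros; use a in auto)+
  ultimately show ?thesis
    unfolding eq by (simp add: Bochner_Integration.integral_diff Bochner_Integration.integral_add)
qed

text \<open>The distribution of the norm has a density, so spheres are null sets. The sphere of
  radius \<open>t\<close> is where the zero extension of a source can jump.\<close>

lemma AE_norm_neq: "AE z in (lborel :: R3 measure). norm z \<noteq> t"
proof -
  have "AE r in distr (lborel :: R3 measure) borel norm. r \<noteq> t"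
    unfolding distr_norm_lborel by (subst AE_density) (use AE_lborel_singleton[of t] in auto)
  then show ?thesis by (subst (asm) AE_distr_iff) auto
qed

lemma zext_bounded:
  assumes "smooth_spacetime h"
  obtains M where "0 \<le> M" "\<And>s z. s \<le> t \<Longrightarrow> norm z \<le> B \<Longrightarrow> \<bar>zext h s (x + z)\<bar> \<le> M"
proof -
  have "compact ((\<lambda>(s, z). h s (x + z)) ` ({0..t} \<times> cball 0 B))"
  proof (rule compact_continuous_image)
    show "continuous_on ({0..t} \<times> cball 0 B) (\<lambda>(s, z). h s (x + z))"
      unfolding case_prod_beta' by (intro continuous_on_spacetime[OF assms] continuous_intros) auto
  qed (intro compact_Times compact_Icc compact_cball)
  from compact_imp_bounded[OF this] obtain M where M: "\<And>s z. s \<in> {0..t} \<Longrightarrow> z \<in> cball 0 B \<Longrightarrow> \<bar>h s (x + z)\<bar> \<le> M"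
    by (force simp: bounded_iff)
  show ?thesis
  proof (rule that[of "max M 0"])
    show "\<bar>zext h s (x + z)\<bar> \<le> max M 0" if "s \<le> t" "norm z \<le> B" for s z
      using M[of s z] that by (auto simp: zext_def)
  qed simp
qed

lemma measurable_zext:
  assumes h: "smooth_spacetime h" and [measurable]: "f \<in> borel_measurable M" "g \<in> borel_measurable M"
  shows "(\<lambda>a. zext h (f a) (g a)) \<in> borel_measurable M"
proof -
  have "(\<lambda>p. h (max 0 (fst p)) (snd p)) \<in> borel_measurable borel"
    by (intro borel_measurable_continuous_onI continuous_on_spacetime[OF h] continuous_intros) auto
  from measurable_compose[OF _ this, of "\<lambda>a. (f a, g a)" M]
  have [measurable]: "(\<lambda>a. h (max 0 (f a)) (g a)) \<in> borel_measurable M"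
    by (simp add: borel_prod[symmetric])
  have "(\<lambda>a. zext h (f a) (g a)) = (\<lambda>a. if 0 \<le> f a then h (max 0 (f a)) (g a) else 0)"
    by (auto simp: zext_def)
  then show ?thesis by simp
qed

text \<open>A single integrable majorant for singularities of order one and two at the origin, cut
  off at the radius where the retarded time becomes negative.\<close>

lemma integrable_weight:
  "integrable lborel (\<lambda>z::R3. C * (indicator (cball 0 t) z * (1 + 1 / (norm z)\<^sup>2)))"
proof -
  have "integrable lborel (\<lambda>z::R3. indicator (cball 0 t) z *\<^sub>R (1::real))"
    by (rule borel_integrable_compact) auto
  then have "integrable lborel (\<lambda>z::R3. indicator (cball 0 t) z + indicator (cball 0 t) z / (norm z)\<^sup>2 :: real)"
    using integrable_inverse_norm2[of t] by (intro Bochner_Integration.integrable_add) auto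
  then have "integrable lborel (\<lambda>z::R3. C * (indicator (cball 0 t) z + indicator (cball 0 t) z / (norm z)\<^sup>2))"
    by (rule integrable_mult_right)
  then show ?thesis by (simp add: algebra_simps)
qed

lemma one_over_le_weight: "0 < r \<Longrightarrow> 1 / r \<le> 1 + 1 / r\<^sup>2" for r :: real
proof -
  assume "0 < r"
  have "0 \<le> (1 / r - 1/2)\<^sup>2" by simp
  then show ?thesis by (simp add: power2_diff power_divide)
qed

lemma AE_nonzero: "AE z in (lborel :: R3 measure). z \<noteq> 0"
  by (rule AE_lborel_singleton)

lemma integrable_zext_weight:
  assumes h: "smooth_spacetime h" and [measurable]: "k \<in> borel_measurable borel"
    and k: "\<And>z. z \<noteq> 0 \<Longrightarrow> \<bar>k z\<bar> \<le> c * (1 + 1 / (norm z)\<^sup>2)"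
  shows "integrable lborel (\<lambda>z. zext h (t - norm z) (x + z) * k z)"
proof -
  obtain M where M: "0 \<le> M" "\<And>r z. r \<le> t \<Longrightarrow> norm z \<le> t \<Longrightarrow> \<bar>zext h r (x + z)\<bar> \<le> M"
    using zext_bounded[OF h, of t t x] by blast
  show ?thesis
  proof (rule Bochner_Integration.integrable_bound[OF integrable_weight[of "M * c" t]])
    have [measurable]: "(\<lambda>z. zext h (t - norm z) (x + z)) \<in> borel_measurable borel"
      by (rule measurable_zext[OF h]) auto
    show "(\<lambda>z. zext h (t - norm z) (x + z) * k z) \<in> borel_measurable lborel" by measurable
    show "AE z in lborel. norm (zext h (t - norm z) (x + z) * k z) \<le>
        norm (M * c * (indicator (cball 0 t) z * (1 + 1 / (norm z)\<^sup>2)))"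
      using AE_nonzero
    proof eventually_elim
      case (elim z)
      have "\<bar>zext h (t - norm z) (x + z)\<bar> \<le> M * indicator (cball 0 t) z"
        using M(2)[of "t - norm z" z] M(1) by (cases "norm z \<le> t") (auto simp: zext_def)
      then have "\<bar>zext h (t - norm z) (x + z)\<bar> * \<bar>k z\<bar> \<le> (M * indicator (cball 0 t) z) * (c * (1 + 1 / (norm z)\<^sup>2))"
        using M(1) by (intro mult_mono k[OF elim]) auto
      then have "norm (zext h (t - norm z) (x + z) * k z) \<le> M * c * (indicator (cball 0 t) z * (1 + 1 / (norm z)\<^sup>2))"
        by (simp add: abs_mult mult_ac)
      then show ?case by (rule order_trans) (simp only: real_norm_def abs_ge_self)
    qed
  qed
qed

text \<open>Dominated convergence as the regularisation is removed. Because \<open>norm z\<close> is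
  at most \<open>rnorm (d n) z\<close>, all retarded integrands vanish outside the same ball of
  radius \<open>t\<close>, and one majorant serves every \<open>n\<close>.\<close>

lemma zext_rnorm_limit:
  fixes k :: "nat \<Rightarrow> R3 \<Rightarrow> real"
  assumes h: "smooth_spacetime h" "\<And>y. h 0 y = 0"
    and d: "d \<longlonglongrightarrow> 0"
    and [measurable]: "\<And>n. k n \<in> borel_measurable borel" "k' \<in> borel_measurable borel"
    and k: "\<And>n z. z \<noteq> 0 \<Longrightarrow> \<bar>k n z\<bar> \<le> c * (1 + 1 / (norm z)\<^sup>2)"
    and lim: "\<And>z. z \<noteq> 0 \<Longrightarrow> (\<lambda>n. k n z) \<longlonglongrightarrow> k' z"
  shows "(\<lambda>n. LINT z|lborel. zext h (t - rnorm (d n) z) (x + z) * k n z)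
    \<longlonglongrightarrow> (LINT z|lborel. zext h (t - norm z) (x + z) * k' z)"
proof -
  obtain M where M: "0 \<le> M" "\<And>s z. s \<le> t \<Longrightarrow> norm z \<le> t \<Longrightarrow> \<bar>zext h s (x + z)\<bar> \<le> M"
    using zext_bounded[OF h(1), of t t x] by blast
  have ca: "(\<lambda>z. rnorm d z) \<in> borel_measurable borel" for d
    by (intro borel_measurable_continuous_onI continuous_intros)
  show ?thesis
  proof (rule integral_dominated_convergence)
    show "integrable lborel (\<lambda>z::R3. (M * c) * (indicator (cball 0 t) z * (1 + 1 / (norm z)\<^sup>2)))"
      by (rule integrable_weight)
    show "AE z in lborel. (\<lambda>n. zext h (t - rnorm (d n) z) (x + z) * k n z)
        \<longlonglongrightarrow> zext h (t - norm z) (x + z) * k' z"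
      using AE_nonzero
    proof eventually_elim
      case (elim z)
      have "continuous_on UNIV (\<lambda>s. zext h (t - s) (x + z))"
        by (intro continuous_on_zext[OF h] continuous_intros)
      then have "isCont (\<lambda>s. zext h (t - s) (x + z)) (norm z)"
        by (simp add: continuous_on_eq_continuous_at)
      from isCont_tendsto_compose[OF this rnorm_tendsto[OF d]] lim[OF elim]
      show ?case by (intro tendsto_mult)
    qed
    show "AE z in lborel. norm (zext h (t - rnorm (d n) z) (x + z) * k n z)
       \<le> (M * c) * (indicator (cball 0 t) z * (1 + 1 / (norm z)\<^sup>2))" for n
      using AE_nonzero
    proof eventually_elim
      case (elim z)
      show ?case
      proof (cases "norm z \<le> t")
        case True
        have "\<bar>zext h (t - rnorm (d n) z) (x + z)\<bar> * \<bar>k n z\<bar> \<le> M * (c * (1 + 1 / (norm z)\<^sup>2))"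
          using True order_trans[OF norm_ge_zero norm_le_rnorm[of z "d n"]]
          by (intro mult_mono M k elim M) auto
        then show ?thesis using True by (simp add: abs_mult mult.assoc)
      next
        case False
        then have "zext h (t - rnorm (d n) z) (x + z) = 0"
          using norm_le_rnorm[of z "d n"] by (simp add: zext_def)
        then show ?thesis using False by simp
      qed
    qed
  qed (use measurable_zext[OF h(1)] ca in measurable)
qed

text \<open>These kernels concentrate at the origin and have no common integrable majorant, so
  dominated convergence is applied after the substitution of \<open>d n *\<^sub>R z\<close> for
  \<open>z\<close>. The kernel becomes a fixed profile of mass \<open>4 * pi\<close>, while the
  retarded point tends to \<open>(t, x)\<close>.\<close>

lemma zext_delta_limit:
  assumes h: "smooth_spacetime h" "\<And>y. h 0 y = 0" and t: "0 \<le> t"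
    and d: "d \<longlonglongrightarrow> 0" "\<And>n. 0 < d n"
  shows "(\<lambda>n. LINT z|lborel. zext h (t - rnorm (d n) z) (x + z) * (3 * (d n)\<^sup>2 / rnorm (d n) z ^ 5))
    \<longlonglongrightarrow> h t x * (4 * pi)"
proof -
  obtain M where M: "0 \<le> M" "\<And>s z. s \<le> t \<Longrightarrow> norm z \<le> t \<Longrightarrow> \<bar>zext h s (x + z)\<bar> \<le> M"
    using zext_bounded[OF h(1), of t t x] by blast
  let ?q = "\<lambda>z::R3. sqrt ((norm z)\<^sup>2 + 1)"
  have q: "0 < ?q z" "?q z \<noteq> 0" for z by (simp_all add: add_nonneg_pos) (metis add_nonneg_eq_0_iff zero_le_power2 zero_le_one zero_neq_one)
  have scale: "rnorm (d n) (d n *\<^sub>R z) = d n * ?q z" for n z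
  proof -
    have "(norm (d n *\<^sub>R z))\<^sup>2 + (d n)\<^sup>2 = (d n)\<^sup>2 * ((norm z)\<^sup>2 + 1)"
      by (simp add: power_mult_distrib algebra_simps)
    then show ?thesis using d(2)[of n] by (simp add: rnorm_def real_sqrt_mult)
  qed
  have eq: "(LINT z|lborel. zext h (t - rnorm (d n) z) (x + z) * (3 * (d n)\<^sup>2 / rnorm (d n) z ^ 5)) =
     (LINT z|lborel. zext h (t - d n * ?q z) (x + d n *\<^sub>R z) * (3 / ?q z ^ 5))" for n
  proof -
    have a: "rnorm (d n) z \<noteq> 0" for z using rnorm_pos[OF d(2)[of n], of z] by simp
    have "continuous_on UNIV (\<lambda>z. zext h (t - rnorm (d n) z) (x + z) * (3 * (d n)\<^sup>2 / rnorm (d n) z ^ 5))"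
      using a by (intro continuous_intros continuous_on_zext[OF h]) auto
    then have int: "integrable lborel (\<lambda>z. zext h (t - rnorm (d n) z) (x + z) * (3 * (d n)\<^sup>2 / rnorm (d n) z ^ 5))"
    proof (rule integral_ball_support(1)[where B = t])
      show "zext h (t - rnorm (d n) z) (x + z) * (3 * (d n)\<^sup>2 / rnorm (d n) z ^ 5) = 0" if "t < norm z" for z
        using that norm_le_rnorm[of z "d n"] by (simp add: zext_def)
    qed
    have fact0: "d n ^ 3 * (3 * (d n)\<^sup>2 / (d n * ?q z) ^ 5) = 3 / ?q z ^ 5" for z
    proof -
      have "D ^ 3 * (3 * D\<^sup>2 / (D * Q) ^ 5) = 3 / Q ^ 5" if "0 < D" "0 < Q" for D Q :: real
        using that by (simp add: field_simps eval_nat_numeral)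
      then show ?thesis using d(2) q(1) by blast
    qed
    have fact: "d n ^ 3 * (zext h (t - d n * ?q z) (x + d n *\<^sub>R z) * (3 * (d n)\<^sup>2 / (d n * ?q z) ^ 5)) =
        zext h (t - d n * ?q z) (x + d n *\<^sub>R z) * (3 / ?q z ^ 5)" for z
      by (subst mult.left_commute) (simp only: fact0)
    have "(LINT z|lborel. zext h (t - rnorm (d n) z) (x + z) * (3 * (d n)\<^sup>2 / rnorm (d n) z ^ 5)) =
        d n ^ 3 * (LINT z|lborel. zext h (t - d n * ?q z) (x + d n *\<^sub>R z) * (3 * (d n)\<^sup>2 / (d n * ?q z) ^ 5))"
      by (subst integral_scale[OF d(2)[of n] int]) (simp only: scale)
    also have "\<dots> = (LINT z|lborel. d n ^ 3 * (zext h (t - d n * ?q z) (x + d n *\<^sub>R z) * (3 * (d n)\<^sup>2 / (d n * ?q z) ^ 5)))"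
      by (rule integral_mult_right_zero[symmetric])
    also have "\<dots> = (LINT z|lborel. zext h (t - d n * ?q z) (x + d n *\<^sub>R z) * (3 / ?q z ^ 5))"
      by (simp only: fact)
    finally show ?thesis .
  qed
  have cq: "continuous_on UNIV ?q" by (intro continuous_intros)
  have [measurable]: "?q \<in> borel_measurable borel"
    by (rule borel_measurable_continuous_onI[OF cq])
  have "(\<lambda>n. LINT z|lborel. zext h (t - d n * ?q z) (x + d n *\<^sub>R z) * (3 / ?q z ^ 5))
     \<longlonglongrightarrow> (LINT z|lborel. h t x * (3 / ?q z ^ 5))"
  proof (rule integral_dominated_convergence)
    show "integrable lborel (\<lambda>z. M * (3 / ?q z ^ 5))"
      using integral_delta_profile by (intro integrable_mult_right) (auto simp: has_bochner_integral_iff)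
    show "AE z in lborel. (\<lambda>n. zext h (t - d n * ?q z) (x + d n *\<^sub>R z) * (3 / ?q z ^ 5)) \<longlonglongrightarrow> h t x * (3 / ?q z ^ 5)"
    proof (rule AE_I2, rule tendsto_mult[OF _ tendsto_const])
      fix z
      have "continuous_on UNIV (\<lambda>s. zext h (t - s * ?q z) (x + s *\<^sub>R z))"
        by (intro continuous_on_zext[OF h] continuous_intros)
      then have "isCont (\<lambda>s. zext h (t - s * ?q z) (x + s *\<^sub>R z)) 0"
        by (simp add: continuous_on_eq_continuous_at)
      from isCont_tendsto_compose[OF this d(1)]
      show "(\<lambda>n. zext h (t - d n * ?q z) (x + d n *\<^sub>R z)) \<longlonglongrightarrow> h t x"
        using t by (simp add: zext_def)
    qed
    show "AE z in lborel. norm (zext h (t - d n * ?q z) (x + d n *\<^sub>R z) * (3 / ?q z ^ 5)) \<le> M * (3 / ?q z ^ 5)" for n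
    proof (rule AE_I2)
      fix z
      have "\<bar>zext h (t - d n * ?q z) (x + d n *\<^sub>R z)\<bar> \<le> M"
      proof (cases "t < d n * ?q z")
        case True then show ?thesis using M(1) by (simp add: zext_def)
      next
        case False
        have "norm (d n *\<^sub>R z) \<le> d n * ?q z"
          using norm_le_rnorm[of "d n *\<^sub>R z" "d n"] by (simp only: scale)
        moreover have "0 \<le> d n * ?q z" using d(2)[of n] q(1)[of z] by simp
        ultimately show ?thesis using False by (intro M) auto
      qed
      then show "norm (zext h (t - d n * ?q z) (x + d n *\<^sub>R z) * (3 / ?q z ^ 5)) \<le> M * (3 / ?q z ^ 5)"
        using q[of z] by (simp add: abs_mult divide_right_mono)
    qed
  qed (use measurable_zext[OF h(1)] in measurable)
  moreover have "(LINT z|lborel. h t x * (3 / ?q z ^ 5)) = h t x * (4 * pi)"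
    using integral_delta_profile by (subst integral_mult_right_zero) (simp add: has_bochner_integral_iff)
  ultimately show ?thesis unfolding eq by simp
qed

text \<open>The three vanishing data make the zero extension of \<open>J\<close> twice continuously
  differentiable, as the divergence identity demands. Of its three remainder terms the first two
  tend to 0, since their kernels do so pointwise under the weight
  \<open>1 + 1 / (norm z)\<^sup>2\<close>; the third tends to \<open>4 * pi * J t x\<close>.\<close>

lemma retarded_potential_C2:
  assumes J: "smooth_spacetime J" and 0: "\<And>y. J 0 y = 0" "\<And>y. Dt J 0 y = 0" "\<And>y. Dt (Dt J) 0 y = 0"
    and t: "0 \<le> t"
  shows "(LINT z|lborel. zext (\<lambda>s y. Dt (Dt J) s y - Lap J s y) (t - norm z) (x + z) * (1 / norm z)) = 4 * pi * J t x"
proof -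
  define d where "d n = inverse (real (Suc n))" for n
  have d: "d \<longlonglongrightarrow> 0" "0 < d n" "d n \<le> 1" for n
    unfolding d_def using LIMSEQ_inverse_real_of_nat by (auto simp: field_simps)
  have a: "0 < rnorm (d n) z" "norm z \<le> rnorm (d n) z" "d n \<le> rnorm (d n) z" for n z
    using rnorm_pos[OF d(2)] norm_le_rnorm le_rnorm by auto
  have lim_a: "(\<lambda>n. rnorm (d n) z) \<longlonglongrightarrow> norm z" for z by (rule rnorm_tendsto[OF d(1)])
  have w1: "1 / rnorm (d n) z \<le> 1 + 1 / (norm z)\<^sup>2" if "z \<noteq> 0" for n z
  proof -
    have "1 / rnorm (d n) z \<le> 1 / norm z" using that a by (intro divide_left_mono) auto
    then show ?thesis using one_over_le_weight[of "norm z"] that by simp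
  qed
  have w2: "1 / (rnorm (d n) z)\<^sup>2 \<le> 1 + 1 / (norm z)\<^sup>2" if "z \<noteq> 0" for n z
  proof -
    have "1 / (rnorm (d n) z)\<^sup>2 \<le> 1 / (norm z)\<^sup>2"
      using that a(2)[of z n] a(1)[of n z] by (intro divide_left_mono power_mono) auto
    then show ?thesis by simp
  qed
  have ratio: "(d n)\<^sup>2 / (rnorm (d n) z)\<^sup>2 \<le> 1" for n z
    using a(1)[of n z] a(3)[of n z] d(2)[of n] by (simp add: power_mono)
  have ca [measurable]: "(\<lambda>z. rnorm d z) \<in> borel_measurable borel" for d
    by (intro borel_measurable_continuous_onI continuous_intros)
  let ?F = "\<lambda>s y. Dt (Dt J) s y - Lap J s y"
  have F: "smooth_spacetime ?F" by (intro smooth_intros smooth_spacetime_Lap J)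
  have F0: "?F 0 y = 0" for y
    unfolding Lap_def by (simp add: 0 Dx_zero_at)
  have L: "(\<lambda>n. LINT z|lborel. zext ?F (t - rnorm (d n) z) (x + z) * (1 / rnorm (d n) z))
      \<longlonglongrightarrow> (LINT z|lborel. zext ?F (t - norm z) (x + z) * (1 / norm z))"
  proof (rule zext_rnorm_limit[OF F F0 d(1), where c = 1])
    show "\<bar>1 / rnorm (d n) z\<bar> \<le> 1 * (1 + 1 / (norm z)\<^sup>2)" if "z \<noteq> 0" for n z
      using w1[OF that, of n] a(1)[of n z] by simp
    show "(\<lambda>n. 1 / rnorm (d n) z) \<longlonglongrightarrow> 1 / norm z" if "z \<noteq> 0" for z
      by (intro tendsto_intros lim_a) (use that in simp)
  qed measurable
  have R1: "(\<lambda>n. LINT z|lborel. zext (Dt (Dt J)) (t - rnorm (d n) z) (x + z) * ((d n)\<^sup>2 / rnorm (d n) z ^ 3))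
      \<longlonglongrightarrow> (LINT z|lborel. zext (Dt (Dt J)) (t - norm z) (x + z) * 0)"
  proof (rule zext_rnorm_limit[OF smooth_spacetime_Dt[OF smooth_spacetime_Dt[OF J]] 0(3) d(1), where c = 1])
    show "\<bar>(d n)\<^sup>2 / rnorm (d n) z ^ 3\<bar> \<le> 1 * (1 + 1 / (norm z)\<^sup>2)" if "z \<noteq> 0" for n z
    proof -
      have "(d n)\<^sup>2 / rnorm (d n) z ^ 3 = ((d n)\<^sup>2 / (rnorm (d n) z)\<^sup>2) * (1 / rnorm (d n) z)"
        by (simp add: power2_eq_square power3_eq_cube)
      also have "\<dots> \<le> 1 * (1 / rnorm (d n) z)"
        using a(1)[of n z] by (intro mult_right_mono ratio) auto
      finally show ?thesis using w1[OF that, of n] a(1)[of n z] by simp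
    qed
    show "(\<lambda>n. (d n)\<^sup>2 / rnorm (d n) z ^ 3) \<longlonglongrightarrow> 0" if "z \<noteq> 0" for z
    proof -
      have "(\<lambda>n. (d n)\<^sup>2 / rnorm (d n) z ^ 3) \<longlonglongrightarrow> 0\<^sup>2 / norm z ^ 3"
        by (intro tendsto_intros lim_a d(1)) (use that in simp)
      then show ?thesis by simp
    qed
  qed measurable
  have R2: "(\<lambda>n. LINT z|lborel. zext (Dt J) (t - rnorm (d n) z) (x + z) * (3 * (d n)\<^sup>2 / rnorm (d n) z ^ 4))
      \<longlonglongrightarrow> (LINT z|lborel. zext (Dt J) (t - norm z) (x + z) * 0)"
  proof (rule zext_rnorm_limit[OF smooth_spacetime_Dt[OF J] 0(2) d(1), where c = 3])
    show "\<bar>3 * (d n)\<^sup>2 / rnorm (d n) z ^ 4\<bar> \<le> 3 * (1 + 1 / (norm z)\<^sup>2)" if "z \<noteq> 0" for n z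
    proof -
      have "3 * (d n)\<^sup>2 / rnorm (d n) z ^ 4 = 3 * (((d n)\<^sup>2 / (rnorm (d n) z)\<^sup>2) * (1 / (rnorm (d n) z)\<^sup>2))"
        by (simp add: power2_eq_square eval_nat_numeral)
      also have "\<dots> \<le> 3 * (1 * (1 / (rnorm (d n) z)\<^sup>2))"
        using a(1)[of n z] by (intro mult_left_mono mult_right_mono ratio) auto
      finally show ?thesis using w2[OF that, of n] a(1)[of n z] by simp
    qed
    show "(\<lambda>n. 3 * (d n)\<^sup>2 / rnorm (d n) z ^ 4) \<longlonglongrightarrow> 0" if "z \<noteq> 0" for z
    proof -
      have "(\<lambda>n. 3 * (d n)\<^sup>2 / rnorm (d n) z ^ 4) \<longlonglongrightarrow> 3 * 0\<^sup>2 / norm z ^ 4"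
        by (intro tendsto_intros lim_a d(1)) (use that in simp)
      then show ?thesis by simp
    qed
  qed measurable
  have R3: "(\<lambda>n. LINT z|lborel. zext J (t - rnorm (d n) z) (x + z) * (3 * (d n)\<^sup>2 / rnorm (d n) z ^ 5))
      \<longlonglongrightarrow> J t x * (4 * pi)"
    by (rule zext_delta_limit[OF J 0(1) t d(1,2)])
  from tendsto_add[OF tendsto_add[OF R1 R2] R3]
  have "(\<lambda>n. LINT z|lborel. zext ?F (t - rnorm (d n) z) (x + z) * (1 / rnorm (d n) z)) \<longlonglongrightarrow> J t x * (4 * pi)"
    using regularised_potential[OF J 0 d(2), where t = t and x = x] by simp
  from LIMSEQ_unique[OF L this] show ?thesis by simp
qed

lemma integrable_on_spacetime:
  assumes "smooth_spacetime u" "0 \<le> a"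
  shows "(\<lambda>s. u s x) integrable_on {a..b}"
proof (cases "a \<le> b")
  case True
  then show ?thesis using assms
    by (intro integrable_continuous_real continuous_on_spacetime[OF assms(1)] continuous_intros) auto
qed auto

lemma time_primitive_diff:
  "smooth_spacetime u \<Longrightarrow> smooth_spacetime v \<Longrightarrow>
    time_primitive (\<lambda>t x. u t x - v t x) t x = time_primitive u t x - time_primitive v t x"
  unfolding time_primitive_def by (intro Henstock_Kurzweil_Integration.integral_diff integrable_on_spacetime) auto

lemma Dx_primitive': "smooth_spacetime u \<Longrightarrow> 0 \<le> t \<Longrightarrow>
    Dx i (Dx j (time_primitive u)) t x = time_primitive (Dx i (Dx j u)) t x"
  by (subst Dx_cong[of _ _ "time_primitive (Dx j u)"]) (simp_all add: Dx_primitive smooth_intros)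

lemma Lap_primitive:
  assumes "smooth_spacetime u" "0 \<le> t"
  shows "Lap (time_primitive u) t x = time_primitive (Lap u) t x"
proof -
  have "time_primitive (Lap u) t x = (\<Sum>i\<in>UNIV. time_primitive (Dx i (Dx i u)) t x)"
    unfolding time_primitive_def Lap_def
    by (intro Henstock_Kurzweil_Integration.integral_sum integrable_on_spacetime smooth_intros assms) auto
  then show ?thesis by (simp add: Lap_def Dx_primitive' assms)
qed

text \<open>The potential formula for \<open>\<integral>\<^sub>0\<^sup>t U\<close> is differentiated in \<open>t\<close>, since the zero extension of
  \<open>U\<close> itself need not be \<open>C\<^sup>2\<close>.\<close>

theorem retarded_potential:
  assumes U: "smooth_spacetime U" and 0: "\<And>y. U 0 y = 0" "\<And>y. Dt U 0 y = 0" and t: "0 \<le> t"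
    and F: "smooth_spacetime F" "\<And>s y. 0 \<le> s \<Longrightarrow> Dt (Dt U) s y - Lap U s y = F s y"
  shows "has_bochner_integral lborel (\<lambda>z. zext F (t - norm z) (x + z) * (1 / norm z)) (4 * pi * U t x)"
proof -
  define J where "J = time_primitive U"
  have J: "smooth_spacetime J" unfolding J_def by (rule smooth_spacetime_primitive[OF U])
  have DtJ: "Dt J s y = U s y" if "0 \<le> s" for s y unfolding J_def by (rule Dt_primitive[OF U that])
  have DtDtJ: "Dt (Dt J) s y = Dt U s y" if "0 \<le> s" for s y
    by (rule Dt_cong) (use that DtJ in auto)
  have J0: "J 0 y = 0" "Dt J 0 y = 0" "Dt (Dt J) 0 y = 0" for y
    by (simp_all add: DtJ DtDtJ 0) (simp add: J_def)
  have FJ: "Dt (Dt J) s y - Lap J s y = time_primitive F s y" if "0 \<le> s" for s y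
  proof -
    have "time_primitive F s y = time_primitive (\<lambda>s y. Dt (Dt U) s y - Lap U s y) s y"
      unfolding time_primitive_def by (rule Henstock_Kurzweil_Integration.integral_cong) (use F(2) in auto)
    also have "\<dots> = time_primitive (Dt (Dt U)) s y - time_primitive (Lap U) s y"
      by (intro time_primitive_diff smooth_intros smooth_spacetime_Lap U)
    also have "\<dots> = Dt (Dt J) s y - Lap J s y"
      using that by (simp add: primitive_Dt smooth_intros U 0 DtDtJ[unfolded J_def] J_def Lap_primitive)
    finally show ?thesis ..
  qed
  have pot: "(LINT z|lborel. zext (time_primitive F) (s - norm z) (x + z) * (1 / norm z)) = 4 * pi * J s x"
    if "0 \<le> s" for s
  proof -
    have "zext (time_primitive F) r y = zext (\<lambda>s y. Dt (Dt J) s y - Lap J s y) r y" for r y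
      by (simp add: zext_def FJ)
    then show ?thesis using retarded_potential_C2[OF J J0 that, of x] by simp
  qed
  define h where "h n = inverse (real (Suc n))" for n
  have h: "h \<longlonglongrightarrow> 0" "0 < h n" "h n \<le> 1" for n
    unfolding h_def using LIMSEQ_inverse_real_of_nat by (auto simp: field_simps)
  obtain M where M: "0 \<le> M" "\<And>s z. s \<le> t + 1 \<Longrightarrow> norm z \<le> t + 1 \<Longrightarrow> \<bar>zext F s (x + z)\<bar> \<le> M"
    using zext_bounded[OF F(1), of "t + 1" "t + 1" x] by blast
  let ?Q = "\<lambda>s z. zext (time_primitive F) (s - norm z) (x + z)"
  have PF: "smooth_spacetime (time_primitive F)" by (rule smooth_spacetime_primitive[OF F(1)])
  have Qb: "\<bar>(?Q (t + h n) z - ?Q t z) / h n\<bar> \<le> M * indicator (cball 0 (t + 1)) z" for n z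
  proof (cases "norm z \<le> t + h n")
    case False
    then show ?thesis using h(2)[of n] M(1) by (simp add: zext_def)
  next
    case True
    \<comment> \<open>Clipping the lower limit at 0 treats the shell between the radii
      \<open>t\<close> and \<open>t + h n\<close>, where the earlier value is already zero, together
      with the ball inside it. In both cases the difference is an integral of \<open>F\<close> over
      a time interval of length at most \<open>h n\<close>.\<close>
    define a b where "a = max 0 (t - norm z)" and "b = t + h n - norm z"
    have ab: "0 \<le> a" "a \<le> b" "b \<le> t + 1" "b - a \<le> h n" "norm z \<le> t + 1"
    proof -
      have "a = 0 \<and> t - norm z \<le> 0 \<or> a = t - norm z \<and> 0 \<le> t - norm z" by (auto simp: a_def)
      then show "0 \<le> a" "a \<le> b" "b \<le> t + 1" "b - a \<le> h n" "norm z \<le> t + 1"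
        using True h(2,3)[of n] t norm_ge_zero[of z] unfolding b_def by linarith+
    qed
    have "?Q (t + h n) z - ?Q t z = time_primitive F b (x + z) - time_primitive F a (x + z)"
      using True t by (auto simp: zext_def a_def b_def max_def)
    also have "\<dots> = integral {a..b} (\<lambda>s. F s (x + z))"
      unfolding time_primitive_def
      using Henstock_Kurzweil_Integration.integral_combine[OF ab(1,2) integrable_on_spacetime[OF F(1), of 0 "x + z" b]] by simp
    also have "\<bar>\<dots>\<bar> \<le> M * (b - a)"
      unfolding real_norm_def[symmetric]
    proof (rule integral_bound[OF ab(2)])
      show "continuous_on {a..b} (\<lambda>s. F s (x + z))"
        using ab(1) by (intro continuous_on_spacetime[OF F(1)] continuous_intros) auto
      show "norm (F s (x + z)) \<le> M" if "s \<in> {a..b}" for s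
        using M(2)[of s z] that ab by (auto simp: zext_def)
    qed
    also have "\<dots> \<le> M * h n" using ab M(1) by (intro mult_left_mono) auto
    finally have "\<bar>?Q (t + h n) z - ?Q t z\<bar> \<le> M * h n" .
    then show ?thesis using ab(5) h(2)[of n] by (simp add: abs_divide pos_divide_le_eq)
  qed
  \<comment> \<open>At radius \<open>t\<close> the quotients may converge to another value than the
    zero extension of \<open>F\<close>, because \<open>F\<close> need not vanish at time 0; at the
    origin the kernel is singular.\<close>
  have ne: "AE z in (lborel :: R3 measure). norm z \<noteq> t \<and> norm z \<noteq> 0"
    using AE_norm_neq[of t] AE_norm_neq[of 0] by eventually_elim auto
  have meas: "(\<lambda>z. zext G (s - norm z) (x + z)) \<in> borel_measurable borel" if "smooth_spacetime G" for G s
    by (rule measurable_zext[OF that]) auto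
  have "integrable lborel (\<lambda>z. zext F (t - norm z) (x + z) * (1 / norm z)) \<and>
    (\<lambda>n. LINT z|lborel. (?Q (t + h n) z - ?Q t z) / h n * (1 / norm z)) \<longlonglongrightarrow>
      (LINT z|lborel. zext F (t - norm z) (x + z) * (1 / norm z))"
  proof (rule conjI)
    let ?w = "\<lambda>z::R3. M * (indicator (cball 0 (t + 1)) z * (1 + 1 / (norm z)\<^sup>2))"
    have m1: "(\<lambda>z. zext F (t - norm z) (x + z) * (1 / norm z)) \<in> borel_measurable lborel"
      using meas[OF F(1), of t] by measurable
    have m2: "(\<lambda>z. (?Q (t + h n) z - ?Q t z) / h n * (1 / norm z)) \<in> borel_measurable lborel" for n
      using meas[OF PF, of t] meas[OF PF, of "t + h n"] by measurable
    have w: "integrable lborel ?w" by (rule integrable_weight)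
    have lim: "AE z in lborel. (\<lambda>n. (?Q (t + h n) z - ?Q t z) / h n * (1 / norm z)) \<longlonglongrightarrow>
        zext F (t - norm z) (x + z) * (1 / norm z)"
      using ne
    proof eventually_elim
      case (elim z)
      have "(\<lambda>n. (?Q (t + h n) z - ?Q t z) / h n) \<longlonglongrightarrow> zext F (t - norm z) (x + z)"
      proof (cases "norm z < t")
        case True
        define s where "s = t - norm z"
        have s: "0 \<le> s" using True by (simp add: s_def)
        have "((\<lambda>y. (time_primitive F y (x + z) - time_primitive F s (x + z)) / (y - s)) \<longlongrightarrow> F s (x + z)) (at s within {0..})"
          using time_primitive_has_derivative[OF F(1) s, of "x + z"] by (simp add: has_field_derivative_iff)
        moreover have "filterlim (\<lambda>n. s + h n) (at s within {0..}) sequentially"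
          unfolding filterlim_at using tendsto_add[OF tendsto_const h(1), of s] s h(2)
          by (auto intro!: always_eventually add_nonneg_nonneg simp: less_imp_le less_imp_neq[symmetric] less_imp_neq[THEN not_sym])
        ultimately have "(\<lambda>n. (time_primitive F (s + h n) (x + z) - time_primitive F s (x + z)) / (s + h n - s)) \<longlonglongrightarrow> F s (x + z)"
          by (rule filterlim_compose)
        moreover have "?Q (t + h n) z = time_primitive F (s + h n) (x + z)" "?Q t z = time_primitive F s (x + z)" for n
          using True h(2)[of n] by (auto simp: zext_def s_def algebra_simps)
        ultimately show ?thesis using s by (simp add: zext_def s_def)
      next
        case False
        then have "norm z - t > 0" using elim by simp
        from order_tendstoD(2)[OF h(1) this]
        have "\<forall>\<^sub>F n in sequentially. 0 = (?Q (t + h n) z - ?Q t z) / h n"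
          using elim False by (auto elim!: eventually_mono simp: zext_def)
        from Lim_transform_eventually[OF tendsto_const this] show ?thesis
          using elim False by (simp add: zext_def)
      qed
      then show ?case by (intro tendsto_mult tendsto_const)
    qed
    have bd: "AE z in lborel. norm ((?Q (t + h n) z - ?Q t z) / h n * (1 / norm z)) \<le> ?w z" for n
      using ne
    proof eventually_elim
      case (elim z)
      have "\<bar>(?Q (t + h n) z - ?Q t z) / h n\<bar> * (1 / norm z) \<le> (M * indicator (cball 0 (t + 1)) z) * (1 + 1 / (norm z)\<^sup>2)"
        using elim one_over_le_weight[of "norm z"] M(1) by (intro mult_mono Qb) auto
      then show ?case by (simp add: abs_mult mult.assoc)
    qed
    show "integrable lborel (\<lambda>z. zext F (t - norm z) (x + z) * (1 / norm z))"
      by (rule integrable_dominated_convergence[OF m1 m2 w lim bd])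
    show "(\<lambda>n. LINT z|lborel. (?Q (t + h n) z - ?Q t z) / h n * (1 / norm z)) \<longlonglongrightarrow>
      (LINT z|lborel. zext F (t - norm z) (x + z) * (1 / norm z))"
      by (rule integral_dominated_convergence[OF m1 m2 w lim bd])
  qed
  moreover have "(LINT z|lborel. (?Q (t + h n) z - ?Q t z) / h n * (1 / norm z)) = 4 * pi * ((J (t + h n) x - J t x) / h n)" for n
  proof -
    have int: "integrable lborel (\<lambda>z. ?Q s z * (1 / norm z))" for s
    proof (rule integrable_zext_weight[OF PF, where c = 1])
      show "\<bar>1 / norm z\<bar> \<le> 1 * (1 + 1 / (norm z)\<^sup>2)" if "z \<noteq> 0" for z :: R3
        using one_over_le_weight[of "norm z"] that by simp
    qed simp
    have "(LINT z|lborel. (?Q (t + h n) z - ?Q t z) / h n * (1 / norm z)) =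
       (LINT z|lborel. (?Q (t + h n) z * (1 / norm z) - ?Q t z * (1 / norm z)) / h n)"
      by (intro Bochner_Integration.integral_cong refl) (simp add: field_simps diff_divide_distrib)
    also have "\<dots> = ((4 * pi * J (t + h n) x) - (4 * pi * J t x)) / h n"
      using pot[OF t] pot[of "t + h n"] t h(2)[of n]
      by (subst integral_divide_zero, subst Bochner_Integration.integral_diff[OF int int]) simp
    finally show ?thesis by (simp add: right_diff_distrib)
  qed
  moreover have "(\<lambda>n. 4 * pi * ((J (t + h n) x - J t x) / h n)) \<longlonglongrightarrow> 4 * pi * U t x"
  proof (rule tendsto_mult[OF tendsto_const])
    have "((\<lambda>y. (J y x - J t x) / (y - t)) \<longlongrightarrow> U t x) (at t within {0..})"
      using time_primitive_has_derivative[OF U t, of x] by (simp add: has_field_derivative_iff J_def)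
    moreover have "filterlim (\<lambda>n. t + h n) (at t within {0..}) sequentially"
      unfolding filterlim_at using tendsto_add[OF tendsto_const h(1), of t] t h(2)
      by (auto intro!: always_eventually add_nonneg_nonneg simp: less_imp_le less_imp_neq[symmetric] less_imp_neq[THEN not_sym])
    ultimately have "(\<lambda>n. (J (t + h n) x - J t x) / (t + h n - t)) \<longlonglongrightarrow> U t x"
      by (rule filterlim_compose)
    then show "(\<lambda>n. (J (t + h n) x - J t x) / h n) \<longlonglongrightarrow> U t x" by simp
  qed
  ultimately show ?thesis
    using LIMSEQ_unique by (auto simp: has_bochner_integral_iff)
qed

lemma component_weights:
  fixes z :: R3
  assumes "z \<noteq> 0" "norm z \<le> a"
  shows "\<bar>z $ i / a\<^sup>2\<bar> \<le> 1 * (1 + 1 / (norm z)\<^sup>2)" and "\<bar>z $ i / a ^ 3\<bar> \<le> 1 * (1 + 1 / (norm z)\<^sup>2)"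
proof -
  have "0 < norm z" using assms(1) by simp
  then have a: "0 < a" "0 < norm z" using assms(2) by linarith+
  have zi: "\<bar>z $ i\<bar> \<le> a" using component_le_norm_cart[of z i] assms(2) by simp
  have "\<bar>z $ i / a\<^sup>2\<bar> \<le> a / a\<^sup>2" using zi by (simp add: divide_right_mono)
  also have "\<dots> = 1 / a" using a by (simp add: power2_eq_square)
  also have "\<dots> \<le> 1 / norm z" using le_imp_inverse_le[OF assms(2) a(2)] by (simp add: inverse_eq_divide)
  finally show "\<bar>z $ i / a\<^sup>2\<bar> \<le> 1 * (1 + 1 / (norm z)\<^sup>2)" using one_over_le_weight[OF a(2)] by simp
  have "\<bar>z $ i / a ^ 3\<bar> \<le> a / a ^ 3" using zi a by (simp add: divide_right_mono)
  also have "\<dots> = 1 / a\<^sup>2" using a by (simp add: power2_eq_square power3_eq_cube)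
  also have "\<dots> \<le> 1 / (norm z)\<^sup>2"
    using le_imp_inverse_le[OF power_mono[OF assms(2)] zero_less_power[OF a(2)], of 2] by (simp add: inverse_eq_divide)
  finally show "\<bar>z $ i / a ^ 3\<bar> \<le> 1 * (1 + 1 / (norm z)\<^sup>2)" by simp
qed

text \<open>The function \<open>h (t - norm z) (x + z) / norm z\<close> has a spatial derivative
  consisting of the three integrands, and the integral of that derivative is 0. The singularity at
  the origin is avoided by the regularised distance. The result serves to move a derivative off the
  initial pressure.\<close>

lemma potential_by_parts:
  assumes h: "smooth_spacetime h" and 0: "\<And>y. h 0 y = 0" "\<And>y. Dt h 0 y = 0"
  shows "(LINT z|lborel. zext (Dx i h) (t - norm z) (x + z) * (1 / norm z)) =
    (LINT z|lborel. zext (Dt h) (t - norm z) (x + z) * (z $ i / (norm z)\<^sup>2)) +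
    (LINT z|lborel. zext h (t - norm z) (x + z) * (z $ i / norm z ^ 3))"
proof -
  define d where "d n = inverse (real (Suc n))" for n
  have d: "d \<longlonglongrightarrow> 0" "0 < d n" for n
    unfolding d_def using LIMSEQ_inverse_real_of_nat by auto
  have a: "0 < rnorm (d n) z" "rnorm (d n) z \<noteq> 0" "norm z \<le> rnorm (d n) z" for n z
    using rnorm_pos[OF d(2), of n z] norm_le_rnorm by auto
  have lim_a: "(\<lambda>n. rnorm (d n) z) \<longlonglongrightarrow> norm z" for z by (rule rnorm_tendsto[OF d(1)])
  have [measurable]: "(\<lambda>z. rnorm d z) \<in> borel_measurable borel" for d
    by (intro borel_measurable_continuous_onI continuous_intros)
  have [measurable]: "(\<lambda>z::R3. z $ i) \<in> borel_measurable borel"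
    by (intro borel_measurable_continuous_onI continuous_intros)
  have Dx0: "Dx i h 0 y = 0" for y by (rule Dx_zero_at) (rule 0)
  have L: "(\<lambda>n. LINT z|lborel. zext (Dx i h) (t - rnorm (d n) z) (x + z) * (1 / rnorm (d n) z))
    \<longlonglongrightarrow> (LINT z|lborel. zext (Dx i h) (t - norm z) (x + z) * (1 / norm z))"
  proof (rule zext_rnorm_limit[OF smooth_spacetime_Dx[OF h] Dx0 d(1), where c = 1])
    show "\<bar>1 / rnorm (d n) z\<bar> \<le> 1 * (1 + 1 / (norm z)\<^sup>2)" if "z \<noteq> 0" for n z
    proof -
      have "1 / rnorm (d n) z \<le> 1 / norm z" using that a(1)[of n z] a(3)[of z n] by (intro divide_left_mono) auto
      then show ?thesis using one_over_le_weight[of "norm z"] that a(1)[of n z] by simp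
    qed
    show "(\<lambda>n. 1 / rnorm (d n) z) \<longlonglongrightarrow> 1 / norm z" if "z \<noteq> 0" for z
      by (intro tendsto_intros lim_a) (use that in simp)
  qed measurable
  have R1: "(\<lambda>n. LINT z|lborel. zext (Dt h) (t - rnorm (d n) z) (x + z) * (z $ i / (rnorm (d n) z)\<^sup>2))
    \<longlonglongrightarrow> (LINT z|lborel. zext (Dt h) (t - norm z) (x + z) * (z $ i / (norm z)\<^sup>2))"
  proof (rule zext_rnorm_limit[OF smooth_spacetime_Dt[OF h] 0(2) d(1), where c = 1])
    show "(\<lambda>n. z $ i / (rnorm (d n) z)\<^sup>2) \<longlonglongrightarrow> z $ i / (norm z)\<^sup>2" if "z \<noteq> 0" for z
      by (intro tendsto_intros lim_a) (use that in simp)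
  qed (measurable, rule component_weights, auto intro: a)
  have R2: "(\<lambda>n. LINT z|lborel. zext h (t - rnorm (d n) z) (x + z) * (z $ i / rnorm (d n) z ^ 3))
    \<longlonglongrightarrow> (LINT z|lborel. zext h (t - norm z) (x + z) * (z $ i / norm z ^ 3))"
  proof (rule zext_rnorm_limit[OF h 0(1) d(1), where c = 1])
    show "(\<lambda>n. z $ i / rnorm (d n) z ^ 3) \<longlonglongrightarrow> z $ i / norm z ^ 3" if "z \<noteq> 0" for z
      by (intro tendsto_intros lim_a) (use that in simp)
  qed (measurable, rule component_weights, auto intro: a)
  have eq: "(LINT z|lborel. zext (Dx i h) (t - rnorm (d n) z) (x + z) * (1 / rnorm (d n) z)) =
    (LINT z|lborel. zext (Dt h) (t - rnorm (d n) z) (x + z) * (z $ i / (rnorm (d n) z)\<^sup>2)) +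
    (LINT z|lborel. zext h (t - rnorm (d n) z) (x + z) * (z $ i / rnorm (d n) z ^ 3))" for n
  proof -
    let ?a = "rnorm (d n)"
    have cz: "continuous_on UNIV (\<lambda>z. zext g (t - ?a z) (x + z))" if "smooth_spacetime g" "\<And>y. g 0 y = 0" for g
      by (intro continuous_on_zext[OF that] continuous_intros)
    note cont = cz[OF h 0(1)] cz[OF smooth_spacetime_Dt[OF h] 0(2)] cz[OF smooth_spacetime_Dx[OF h] Dx0]
    have van: "zext g (t - ?a z) (x + z) = 0" if "t < norm z" for g z
      using that a(3)[of z n] by (simp add: zext_def)
    let ?g1 = "\<lambda>z. zext (Dx i h) (t - ?a z) (x + z) * (1 / ?a z)"
    let ?g2 = "\<lambda>z. zext (Dt h) (t - ?a z) (x + z) * (z $ i / (?a z)\<^sup>2)"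
    let ?g3 = "\<lambda>z. zext h (t - ?a z) (x + z) * (z $ i / ?a z ^ 3)"
    have c: "continuous_on UNIV ?g1" "continuous_on UNIV ?g2" "continuous_on UNIV ?g3"
      using a by (intro continuous_intros cont; simp)+
    have int: "integrable lborel ?g1" "integrable lborel ?g2" "integrable lborel ?g3"
      by (rule integral_ball_support(1)[where B = t], rule c, simp add: van)+
    have "(LINT z|lborel. ?g1 z - ?g2 z - ?g3 z) = 0"
    proof (rule integral_partial_zero[where B = t and v = "axis i 1"])
      show "continuous_on UNIV (\<lambda>z. zext h (t - ?a z) (x + z) / ?a z)"
        using a by (intro continuous_intros cont) simp
      show "continuous_on UNIV (\<lambda>z. ?g1 z - ?g2 z - ?g3 z)" by (intro continuous_on_diff c)
      fix z
      have "?a (z + 0 *\<^sub>R axis i 1) \<noteq> 0" using a by simp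
      from DERIV_divide[OF zext_line[OF h 0 d(2), of t n z i x] rnorm_line[OF d(2), of n z i] this]
      show "((\<lambda>e. zext h (t - ?a (z + e *\<^sub>R axis i 1)) (x + (z + e *\<^sub>R axis i 1)) / ?a (z + e *\<^sub>R axis i 1))
          has_real_derivative (?g1 z - ?g2 z - ?g3 z)) (at 0)"
        by (rule DERIV_cong) (use a(2)[of n z] in \<open>simp add: field_simps eval_nat_numeral\<close>)
    qed (simp add: van)
    moreover have "(LINT z|lborel. ?g1 z - ?g2 z - ?g3 z) = (LINT z|lborel. ?g1 z) - (LINT z|lborel. ?g2 z) - (LINT z|lborel. ?g3 z)"
      by (simp only: Bochner_Integration.integral_diff Bochner_Integration.integrable_diff int)
    ultimately show ?thesis by linarith
  qed
  from tendsto_add[OF R1 R2]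
  have "(\<lambda>n. LINT z|lborel. zext (Dx i h) (t - rnorm (d n) z) (x + z) * (1 / rnorm (d n) z)) \<longlonglongrightarrow>
    (LINT z|lborel. zext (Dt h) (t - norm z) (x + z) * (z $ i / (norm z)\<^sup>2)) +
    (LINT z|lborel. zext h (t - norm z) (x + z) * (z $ i / norm z ^ 3))"
    unfolding eq .
  from LIMSEQ_unique[OF L this] show ?thesis .
qed

section \<open>An integrable weight and Fubini's theorem for kernels with two poles\<close>

definition wgt :: "real \<Rightarrow> R3 \<Rightarrow> real" where
  "wgt t u = indicator (cball 0 t) u * (1 + 1 / (norm u)\<^sup>2)"

lemma wgt_nonneg: "0 \<le> wgt t u"
  by (simp add: wgt_def)

lemma integrable_wgt: "integrable lborel (wgt t)"
  using integrable_weight[of 1 t] by (simp add: wgt_def[abs_def])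

lemma wgt_minus_commute: "wgt t (u - v) = wgt t (v - u)"
  by (auto simp: wgt_def norm_minus_commute indicator_def)

lemma integrable_wgt_diff: "integrable lborel (\<lambda>u. wgt t (u - v))"
  using integrable_translate[OF integrable_wgt[of t], of "- v"] by simp

text \<open>Integrated over \<open>y\<close>, the second weight gives a constant independent of
  \<open>z\<close> by translation invariance; the first weight is then integrable in
  \<open>z\<close>. The product is therefore integrable on the product space, and the interchange
  follows by domination.\<close>

lemma fubini_wgt:
  fixes H :: "R3 \<Rightarrow> R3 \<Rightarrow> real"
  assumes [measurable]: "(\<lambda>(z, y). H z y) \<in> borel_measurable (lborel \<Otimes>\<^sub>M lborel)"
    and H: "\<And>z y. \<bar>H z y\<bar> \<le> C * (wgt t (z - x) * wgt t (z - y))"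
  shows "(LINT y|lborel. (LINT z|lborel. H z y)) = (LINT z|lborel. (LINT y|lborel. H z y))"
    and "integrable lborel (\<lambda>y. LINT z|lborel. H z y)"
    and "integrable lborel (\<lambda>z. LINT y|lborel. H z y)"
proof -
  have [measurable]: "wgt t \<in> borel_measurable borel"
    using borel_measurable_integrable[OF integrable_wgt] by simp
  have C: "0 \<le> C * (wgt t (z - x) * wgt t (z - y))" for z y
    using H[of z y] by linarith
  have W: "(LINT y|lborel. wgt t (z - y)) = (LINT y|lborel. wgt t y)" for z
    using integral_translate[of "wgt t" "- z"] by (simp add: wgt_minus_commute[of t z])
  have int_y: "integrable lborel (\<lambda>y. C * (wgt t (z - x) * wgt t (z - y)))" for z
    using integrable_wgt_diff[of t z] by (simp add: wgt_minus_commute[of t z])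
  have "integrable (lborel \<Otimes>\<^sub>M lborel) (\<lambda>(z, y). C * (wgt t (z - x) * wgt t (z - y)))"
  proof (rule lborel_pair.Fubini_integrable)
    have "(LINT y|lborel. norm (C * (wgt t (z - x) * wgt t (z - y)))) = C * wgt t (z - x) * (LINT y|lborel. wgt t y)" for z
    proof -
      have "norm (C * (wgt t (z - x) * wgt t (z - y))) = (C * wgt t (z - x)) * wgt t (z - y)" for y
        using C[of z y] by (simp only: real_norm_def abs_of_nonneg mult.assoc)
      then show ?thesis by (simp only: integral_mult_right_zero W)
    qed
    then show "integrable lborel (\<lambda>z. LINT y|lborel. norm (case (z, y) of (z, y) \<Rightarrow> C * (wgt t (z - x) * wgt t (z - y))))"
      by (simp add: integrable_wgt_diff)
    show "AE z in lborel. integrable lborel (\<lambda>y. case (z, y) of (z, y) \<Rightarrow> C * (wgt t (z - x) * wgt t (z - y)))"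
      using int_y by simp
  qed measurable
  then have int: "integrable (lborel \<Otimes>\<^sub>M lborel) (\<lambda>(z, y). H z y)"
    by (rule Bochner_Integration.integrable_bound) (use H C in \<open>auto simp: abs_of_nonneg\<close>)
  show "(LINT y|lborel. (LINT z|lborel. H z y)) = (LINT z|lborel. (LINT y|lborel. H z y))"
    by (rule lborel_pair.Fubini_integral[OF int])
  show "integrable lborel (\<lambda>y. LINT z|lborel. H z y)"
    by (rule lborel_pair.integrable_snd[OF int])
  show "integrable lborel (\<lambda>z. LINT y|lborel. H z y)"
    by (rule lborel_pair.integrable_fst[OF int])
qed

lemma time_primitive_cong:
  "(\<And>s. 0 \<le> s \<Longrightarrow> s \<le> t \<Longrightarrow> u s x = v s x) \<Longrightarrow> time_primitive u t x = time_primitive v t x"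
  unfolding time_primitive_def by (rule Henstock_Kurzweil_Integration.integral_cong) auto

lemma time_primitive_space_mult:
  "time_primitive (\<lambda>s y. f y * u s y) t x = f x * time_primitive u t x"
  by (simp add: time_primitive_def)

lemma time_primitive_sum:
  assumes "finite I" "\<And>i. i \<in> I \<Longrightarrow> smooth_spacetime (u i)"
  shows "time_primitive (\<lambda>s y. \<Sum>i\<in>I. u i s y) t x = (\<Sum>i\<in>I. time_primitive (u i) t x)"
  unfolding time_primitive_def
  by (intro Henstock_Kurzweil_Integration.integral_sum integrable_on_spacetime assms) auto

lemma time_primitive_space: "0 \<le> t \<Longrightarrow> time_primitive (\<lambda>s. p) t x = t * p x"
  by (simp add: time_primitive_def)

lemma time_primitive_linear: "0 \<le> t \<Longrightarrow> time_primitive (\<lambda>s y. s * p y) t x = t\<^sup>2 / 2 * p x"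
proof -
  assume "0 \<le> t"
  then have "((\<lambda>s. s * p x) has_integral t\<^sup>2 / 2 * p x - 0\<^sup>2 / 2 * p x) {0..t}"
    by (rule fundamental_theorem_of_calculus)
      (auto intro!: derivative_eq_intros simp: has_real_derivative_iff_has_vector_derivative[symmetric])
  then have "((\<lambda>s. s * p x) has_integral t\<^sup>2 / 2 * p x) {0..t}" by simp
  then show ?thesis unfolding time_primitive_def by (rule integral_unique)
qed
    
lemma Dt_Dt_primitive:
  assumes "smooth_spacetime u" "0 \<le> t"
  shows "Dt (Dt (time_primitive u)) t x = Dt u t x"
  by (rule Dt_cong) (use assms Dt_primitive in auto)

text \<open>The time primitive commutes with the Laplacian but changes the second time derivative by
  the initial velocity \<open>Dt u 0\<close>. Applied to the first antiderivative of
  \<open>P0\<close>, whose initial velocity is \<open>p\<close>, this turns the initial pressure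
  into a source.\<close>

lemma wave_primitive:
  assumes "smooth_spacetime u" "0 \<le> t"
  shows "Dt (Dt (time_primitive u)) t x - Lap (time_primitive u) t x =
    time_primitive (\<lambda>t x. Dt (Dt u) t x - Lap u t x) t x + Dt u 0 x"
  using assms by (simp add: Dt_Dt_primitive Lap_primitive time_primitive_diff primitive_Dt
      smooth_intros smooth_spacetime_Lap)

lemma wave_primitive_eq:
  assumes "smooth_spacetime u" "0 \<le> t" "\<And>t x. 0 \<le> t \<Longrightarrow> Dt (Dt u) t x - Lap u t x = G t x"
  shows "Dt (Dt (time_primitive u)) t x - Lap (time_primitive u) t x = time_primitive G t x + Dt u 0 x"
  unfolding wave_primitive[OF assms(1,2)] by (simp add: time_primitive_cong[OF assms(3)])

lemma wave_Dx:
  assumes "smooth_spacetime u" "smooth_spacetime G" "0 \<le> t" "\<And>t x. 0 \<le> t \<Longrightarrow> Dt (Dt u) t x - Lap u t x = G t x"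
  shows "Dt (Dt (Dx i u)) t x - Lap (Dx i u) t x = Dx i G t x"
proof -
  have 1: "Dt (Dt (Dx i u)) t x = Dx i (Dt (Dt u)) t x"
  proof -
    have "Dt (Dt (Dx i u)) t x = Dt (Dx i (Dt u)) t x"
      by (rule Dt_cong) (simp_all add: Dt_Dx_commute assms)
    then show ?thesis by (simp add: Dt_Dx_commute smooth_intros assms)
  qed
  have 2: "Lap (Dx i u) t x = Dx i (Lap u) t x"
  proof -
    have "Dx j (Dx j (Dx i u)) t x = Dx i (Dx j (Dx j u)) t x" for j
    proof -
      have "Dx j (Dx j (Dx i u)) t x = Dx j (Dx i (Dx j u)) t x"
        by (rule Dx_cong) (simp add: Dx_commute[of _ _ j i] assms)
      then show ?thesis by (simp add: Dx_commute[of _ _ j i] smooth_intros assms)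
    qed
    moreover have "Dx i (Lap u) t x = (\<Sum>j\<in>UNIV. Dx i (Dx j (Dx j u)) t x)"
    proof -
      have "Dx i (Lap u) t x = partial i (\<lambda>y. \<Sum>j\<in>UNIV. Dx j (Dx j u) t y) x"
        by (subst Dx_def, subst Lap_def[abs_def]) (rule refl)
      also have "\<dots> = (\<Sum>j\<in>UNIV. partial i (Dx j (Dx j u) t) x)"
        by (intro partial_sum spacetime_differentiable smooth_intros assms) auto
      also have "\<dots> = (\<Sum>j\<in>UNIV. Dx i (Dx j (Dx j u)) t x)"
        by (intro sum.cong refl Dx_def[symmetric])
      finally show ?thesis .
    qed
    ultimately show ?thesis by (simp add: Lap_def)
  qed
  have "Dx i G t x = Dx i (\<lambda>t x. Dt (Dt u) t x - Lap u t x) t x"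
    by (rule Dx_cong) (use assms in simp)
  also have "\<dots> = Dx i (Dt (Dt u)) t x - Dx i (Lap u) t x"
    by (intro Dx_diff smooth_intros smooth_spacetime_Lap assms)
  finally show ?thesis using 1 2 by simp
qed

lemma AE_norm_diff_neq: "AE y in lborel. norm (y - x :: R3) \<noteq> t"
proof -
  have "AE y in distr lborel borel ((+) x). norm (y - x) \<noteq> t"
    by (subst AE_distr_iff) (use AE_norm_neq[of t] in auto)
  then show ?thesis unfolding lborel_distr_plus .
qed

lemma continuous_bounded_cball:
  fixes f :: "R3 \<Rightarrow> 'b::real_normed_vector"
  assumes "continuous_on UNIV f"
  obtains M where "1 \<le> M" "\<And>z. norm (z - x) \<le> t \<Longrightarrow> norm (f z) \<le> M"
proof -
  have "compact (f ` cball x t)"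
    by (intro compact_continuous_image compact_cball continuous_on_subset[OF assms]) simp
  from compact_imp_bounded[OF this] obtain M where "\<And>z. z \<in> cball x t \<Longrightarrow> norm (f z) \<le> M"
    by (force simp: bounded_iff)
  then show ?thesis by (intro that[of "max 1 M"]) (auto simp: dist_norm norm_minus_commute max.coboundedI2)
qed

lemma grad_inner: "grad f x \<bullet> v = (\<Sum>i\<in>UNIV. partial i f x * v $ i)"
  by (simp add: grad_def inner_vec_def)

lemma continuous_grad: "smooth_on UNIV f \<Longrightarrow> continuous_on UNIV (grad f)"
  unfolding grad_def[abs_def]
  by (intro continuous_on_vec_lambda smooth_on_imp_continuous_on smooth_on_partial)

lemma weight_bounds:
  fixes u :: R3
  assumes "norm u \<le> t"
  shows "1 / norm u \<le> wgt t u" "1 / (norm u)\<^sup>2 \<le> wgt t u"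
  using assms one_over_le_weight[of "norm u"] by (cases "u = 0"; simp add: wgt_def)+

section \<open>The kernel formula for fixed coefficients, data and expansion terms\<close>

context
  fixes A R p :: "R3 \<Rightarrow> real" and P0 P1 :: "real \<Rightarrow> R3 \<Rightarrow> real"
  assumes A: "smooth_on UNIV A" and R: "smooth_on UNIV R" and p: "smooth_on UNIV p"
    and P0: "smooth_spacetime P0" "\<And>t x. 0 \<le> t \<Longrightarrow> Dt (Dt P0) t x - Lap P0 t x = 0"
      "\<And>x. Dt P0 0 x = 0" "\<And>x. P0 0 x = p x"
    and P1: "smooth_spacetime P1" "\<And>t x. 0 \<le> t \<Longrightarrow> Dt (Dt P1) t x - Lap P1 t x =
        A x * Lap P0 t x - (\<Sum>i\<in>UNIV. partial i R x * Dx i P0 t x)"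
      "\<And>x. Dt P1 0 x = 0" "\<And>x. P1 0 x = 0"
begin

private abbreviation (input) "T \<equiv> time_primitive"
private abbreviation (input) "W0 \<equiv> T (T P0)"
private abbreviation (input) "U0 \<equiv> T (T (T (T P0)))"
private abbreviation (input) "U1 \<equiv> T (T (T (T P1)))"
private abbreviation (input) "F1 \<equiv> \<lambda>s z. A z * Lap U0 s z - (\<Sum>i\<in>UNIV. partial i R z * Dx i U0 s z)"

private lemma sm: "smooth_spacetime (T P0)" "smooth_spacetime W0" "smooth_spacetime (T W0)" "smooth_spacetime U0"
  "smooth_spacetime (T P1)" "smooth_spacetime (T (T P1))" "smooth_spacetime (T (T (T P1)))" "smooth_spacetime U1"
  by (intro smooth_spacetime_primitive P0 P1)+

text \<open>The first antiderivative of \<open>P0\<close> still solves the homogeneous equation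
  because \<open>P0\<close> starts with velocity 0. Its own initial velocity is \<open>p\<close>,
  which the second antiderivative picks up as a source.\<close>

private lemma W0_wave: "0 \<le> t \<Longrightarrow> Dt (Dt W0) t x - Lap W0 t x = p x"
proof -
  have "Dt (Dt (T P0)) t x - Lap (T P0) t x = 0" if "0 \<le> t" for t x
    using wave_primitive_eq[OF P0(1) that P0(2), of x] P0(3) by (simp add: time_primitive_def)
  then show "0 \<le> t \<Longrightarrow> Dt (Dt W0) t x - Lap W0 t x = p x"
    using wave_primitive_eq[OF sm(1), of t "\<lambda>t x. 0" x] by (simp add: Dt_primitive P0 time_primitive_def)
qed

private lemma U0_wave:
  assumes "0 \<le> t"
  shows "Dt (Dt U0) t x - Lap U0 t x = t\<^sup>2 / 2 * p x"
proof -
  have 1: "Dt (Dt (T W0)) t x - Lap (T W0) t x = t * p x" if "0 \<le> t" for t x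
    using wave_primitive_eq[OF sm(2) that, of "\<lambda>t. p"] W0_wave that
    by (simp add: Dt_primitive sm time_primitive_space)
  show ?thesis
    using wave_primitive_eq[OF sm(3) assms, of "\<lambda>t x. t * p x"] 1 assms
    by (simp add: Dt_primitive sm time_primitive_linear)
qed

text \<open>The operator producing the source of \<open>P1\<close> has coefficients independent of
  time and so commutes with time primitives. The initial velocities of \<open>P1\<close> and of its
  first three antiderivatives vanish, so no initial term is created along the way.\<close>

private lemma U1_wave:
  assumes "0 \<le> t"
  shows "Dt (Dt U1) t x - Lap U1 t x = F1 t x"
proof -
  let ?G = "\<lambda>P t x. A x * Lap P t x - (\<Sum>i\<in>UNIV. partial i R x * Dx i P t x)"
  have G: "T (?G P) t x = ?G (T P) t x" if "smooth_spacetime P" "0 \<le> t" for P t x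
  proof -
    have "T (?G P) t x = T (\<lambda>t x. A x * Lap P t x) t x - T (\<lambda>t x. \<Sum>i\<in>UNIV. partial i R x * Dx i P t x) t x"
      by (intro time_primitive_diff smooth_intros smooth_spacetime_Lap smooth_on_partial A R that)
    also have "T (\<lambda>t x. \<Sum>i\<in>UNIV. partial i R x * Dx i P t x) t x = (\<Sum>i\<in>UNIV. T (\<lambda>t x. partial i R x * Dx i P t x) t x)"
      by (intro time_primitive_sum smooth_intros smooth_on_partial R that) auto
    finally show ?thesis
      using that by (simp add: time_primitive_space_mult Lap_primitive Dx_primitive)
  qed
  have step: "Dt (Dt (T Q)) t x - Lap (T Q) t x = ?G (T P) t x"
    if "smooth_spacetime Q" "smooth_spacetime P" "\<And>t x. 0 \<le> t \<Longrightarrow> Dt (Dt Q) t x - Lap Q t x = ?G P t x"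
      "\<And>x. Dt Q 0 x = 0" "0 \<le> t" for P Q t x
    using wave_primitive_eq[OF that(1,5,3), of x] G[OF that(2,5)] that(4) by simp
  have D0: "Dt (T P1) 0 x = 0" "Dt (T (T P1)) 0 x = 0" "Dt (T (T (T P1))) 0 x = 0" for x
    by (simp_all add: Dt_primitive sm P1)
  show ?thesis
    by (rule step[OF sm(7) sm(3) step[OF sm(6) sm(2) step[OF sm(5) sm(1) step[OF P1(1) P0(1) P1(2) P1(3)] D0(1)] D0(2)] D0(3) assms])
qed

private lemma sm_src: "smooth_spacetime (\<lambda>s y. s\<^sup>2 / 2 * p y)" "smooth_spacetime (\<lambda>s y. s * p y)" "smooth_spacetime (\<lambda>s. p)"
    "smooth_spacetime F1" "smooth_spacetime (\<lambda>s y. s\<^sup>2 / 2 * (A y * p y))"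
proof -
  show "smooth_spacetime (\<lambda>s. p)" "smooth_spacetime (\<lambda>s y. s * p y)" by (intro smooth_intros p)+
  have 1: "smooth_spacetime (\<lambda>s y. s * (s * ((1/2) * q y)))" if "smooth_on UNIV q" for q
    by (intro smooth_intros that)
  show "smooth_spacetime (\<lambda>s y. s\<^sup>2 / 2 * p y)" "smooth_spacetime (\<lambda>s y. s\<^sup>2 / 2 * (A y * p y))"
    using 1[OF p] 1[OF smooth_on_mult[OF _ A p]] by (simp_all add: power2_eq_square mult.assoc)
  show "smooth_spacetime F1"
    by (intro smooth_intros smooth_spacetime_Lap smooth_on_partial A R sm)
qed

private lemma potential_W0: "0 \<le> t \<Longrightarrow>
    has_bochner_integral lborel (\<lambda>z. zext (\<lambda>s. p) (t - norm z) (x + z) * (1 / norm z)) (4 * pi * W0 t x)"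
  by (rule retarded_potential[OF sm(2) _ _ _ sm_src(3) W0_wave]) (auto simp: Dt_primitive sm)

private lemma potential_U0: "0 \<le> t \<Longrightarrow>
    has_bochner_integral lborel (\<lambda>z. zext (\<lambda>s y. s\<^sup>2 / 2 * p y) (t - norm z) (x + z) * (1 / norm z)) (4 * pi * U0 t x)"
  by (rule retarded_potential[OF sm(4) _ _ _ sm_src(1) U0_wave]) (auto simp: Dt_primitive sm)

private lemma potential_U1: "0 \<le> t \<Longrightarrow>
    has_bochner_integral lborel (\<lambda>z. zext F1 (t - norm z) (x + z) * (1 / norm z)) (4 * pi * U1 t x)"
  by (rule retarded_potential[OF sm(8) _ _ _ sm_src(4) U1_wave]) (auto simp: Dt_primitive sm)

text \<open>The derivative \<open>Dx i U0\<close> starts from zero data and has the source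
  \<open>Dx i\<close> of \<open>s\<^sup>2 / 2 * p\<close>. Integration by parts in its potential
  leaves \<open>p\<close> undifferentiated, with the weights \<open>s\<close> and
  \<open>s\<^sup>2 / 2\<close> that distinguish the two \<rho>1 integrals of the kernel.\<close>

private lemma potential_Dx_U0:
  assumes "0 \<le> t"
  shows "(LINT z|lborel. zext (\<lambda>s y. s * p y) (t - norm z) (x + z) * (z $ i / (norm z)\<^sup>2)) +
    (LINT z|lborel. zext (\<lambda>s y. s\<^sup>2 / 2 * p y) (t - norm z) (x + z) * (z $ i / norm z ^ 3)) = 4 * pi * Dx i U0 t x"
proof -
  let ?h = "\<lambda>s y. s\<^sup>2 / 2 * p y"
  have Dth: "Dt ?h s y = s * p y" if "0 \<le> s" for s y
    unfolding Dt_def by (rule time_deriv_eqI[OF _ that]) (auto intro!: derivative_eq_intros)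
  then have zD: "zext (Dt ?h) s y = zext (\<lambda>s y. s * p y) s y" for s y by (simp add: zext_def)
  have 0: "Dx i U0 0 y = 0" "Dt (Dx i U0) 0 y = 0" for y
  proof -
    show "Dx i U0 0 y = 0" by (rule Dx_zero_at) simp
    have "Dx i (Dt U0) 0 y = 0" by (rule Dx_zero_at) (simp add: Dt_primitive sm)
    then show "Dt (Dx i U0) 0 y = 0" by (simp add: Dt_Dx_commute sm)
  qed
  have "has_bochner_integral lborel (\<lambda>z. zext (Dx i ?h) (t - norm z) (x + z) * (1 / norm z)) (4 * pi * Dx i U0 t x)"
    by (rule retarded_potential[OF smooth_spacetime_Dx[OF sm(4)] 0 assms smooth_spacetime_Dx[OF sm_src(1)]
        wave_Dx[OF sm(4) sm_src(1) _ U0_wave]])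
  then show ?thesis
    using potential_by_parts[OF sm_src(1), where t = t and x = x and i = i, unfolded zD] Dth[of 0]
    by (simp only: has_bochner_integral_iff) simp
qed

text \<open>The integrands of the three ellipsoid integrals, freed of \<epsilon>, multiplied by
  \<open>p y\<close> and with an indicator for the domain. In this form they are functions on the
  product space whose order of integration can be exchanged.\<close>

private definition "H1 t x z y = indicator (ellipsoid t x y) z * (1 / (16 * pi\<^sup>2 * norm (z - x) * norm (z - y)) * A z) * p y"
private definition "H2 t x z y = indicator (ellipsoid t x y) z *
   ((t - norm (z - x) - norm (z - y)) / (16 * pi\<^sup>2 * norm (z - x) * norm (z - y)) * (grad R z \<bullet> ((1 / norm (z - y)) *\<^sub>R (z - y)))) * p y"
private definition "H3 t x z y = indicator (ellipsoid t x y) z *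
   ((t - norm (z - x) - norm (z - y))\<^sup>2 / (32 * pi\<^sup>2 * norm (z - x) * (norm (z - y))\<^sup>2) * (grad R z \<bullet> ((1 / norm (z - y)) *\<^sub>R (z - y)))) * p y"

private lemma H_measurable:
  "(\<lambda>(z, y). H1 t x z y) \<in> borel_measurable (lborel \<Otimes>\<^sub>M lborel)"
  "(\<lambda>(z, y). H2 t x z y) \<in> borel_measurable (lborel \<Otimes>\<^sub>M lborel)"
  "(\<lambda>(z, y). H3 t x z y) \<in> borel_measurable (lborel \<Otimes>\<^sub>M lborel)"
proof -
  have [measurable]: "A \<in> borel_measurable borel" "p \<in> borel_measurable borel" "grad R \<in> borel_measurable borel"
    by (intro borel_measurable_continuous_onI smooth_on_imp_continuous_on continuous_grad A p R)+
  have ind: "indicator (ellipsoid t x y) z = (if norm (z - x) + norm (z - y) \<le> t then 1 else 0 :: real)" for z y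
    by (simp add: ellipsoid_def indicator_def)
  show "(\<lambda>(z, y). H1 t x z y) \<in> borel_measurable (lborel \<Otimes>\<^sub>M lborel)"
    "(\<lambda>(z, y). H2 t x z y) \<in> borel_measurable (lborel \<Otimes>\<^sub>M lborel)"
    "(\<lambda>(z, y). H3 t x z y) \<in> borel_measurable (lborel \<Otimes>\<^sub>M lborel)"
    unfolding H1_def H2_def H3_def ind by measurable
qed

text \<open>If \<open>z\<close> lies in the ellipsoid, then \<open>z\<close> and \<open>y\<close>
  both lie within distance \<open>t\<close> of \<open>x\<close>, where \<open>A\<close>,
  \<open>p\<close> and \<open>grad R\<close> are bounded. Each pole contributes a singularity of
  order one, or of order two at \<open>y\<close> in \<open>H3\<close>, and both orders lie below
  \<open>wgt\<close>.\<close>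

private lemma H_bounded:
  assumes t: "0 \<le> t"
  shows "\<exists>C. \<forall>z y. \<bar>H1 t x z y\<bar> \<le> C * (wgt t (z - x) * wgt t (z - y))"
  "\<exists>C. \<forall>z y. \<bar>H2 t x z y\<bar> \<le> C * (wgt t (z - x) * wgt t (z - y))"
  "\<exists>C. \<forall>z y. \<bar>H3 t x z y\<bar> \<le> C * (wgt t (z - x) * wgt t (z - y))"
proof -
  obtain M1 where M1: "1 \<le> M1" "\<And>z. norm (z - x) \<le> t \<Longrightarrow> norm (A z) \<le> M1"
    using continuous_bounded_cball[OF smooth_on_imp_continuous_on[OF A], of x t] by blast
  obtain M2 where M2: "1 \<le> M2" "\<And>z. norm (z - x) \<le> t \<Longrightarrow> norm (p z) \<le> M2"
    using continuous_bounded_cball[OF smooth_on_imp_continuous_on[OF p], of x t] by blast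
  obtain M3 where M3: "1 \<le> M3" "\<And>z. norm (z - x) \<le> t \<Longrightarrow> norm (grad R z) \<le> M3"
    using continuous_bounded_cball[OF continuous_grad[OF R], of x t] by blast
  have E: "norm (z - x) \<le> t" "norm (z - y) \<le> t" "norm (y - x) \<le> t" "norm (z - x) + norm (z - y) \<le> t"
    if "z \<in> ellipsoid t x y" for z y
  proof -
    show "norm (z - x) + norm (z - y) \<le> t" using that by (simp add: ellipsoid_def)
    moreover have d: "(z - x) - (z - y) = y - x" by simp
    ultimately show "norm (z - x) \<le> t" "norm (z - y) \<le> t" "norm (y - x) \<le> t"
      using norm_ge_zero[of "z - x"] norm_ge_zero[of "z - y"] norm_triangle_ineq4[of "z - x" "z - y", unfolded d] by linarith+
  qed
  have pi1: "1 \<le> pi\<^sup>2" using pi_gt3 by (simp add: power2_eq_square mult_ge1_I)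
  have dir: "\<bar>grad R z \<bullet> ((1 / norm (z - y)) *\<^sub>R (z - y))\<bar> \<le> M3" if "norm (z - x) \<le> t" for z y
  proof -
    have "\<bar>grad R z \<bullet> ((1 / norm (z - y)) *\<^sub>R (z - y))\<bar> \<le> norm (grad R z) * norm ((1 / norm (z - y)) *\<^sub>R (z - y))"
      by (rule Cauchy_Schwarz_ineq2)
    also have "\<dots> \<le> norm (grad R z) * 1" by (intro mult_left_mono) auto
    finally show ?thesis using M3(2)[OF that] by simp
  qed
  have frac: "\<bar>a / (c * pi\<^sup>2 * d * e)\<bar> \<le> b * ((1 / d) * (1 / e))" if "\<bar>a\<bar> \<le> b" "1 \<le> c" "0 \<le> d" "0 \<le> e" for a b c d e :: real
  proof -
    have "1 * 1 \<le> c * pi\<^sup>2" by (intro mult_mono pi1 that) (use that in auto)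
    then have "\<bar>a\<bar> / (c * pi\<^sup>2) \<le> b / 1" by (intro frac_le that order_trans[OF abs_ge_zero that(1)]) auto
    then have "\<bar>a\<bar> / (c * pi\<^sup>2) * ((1 / d) * (1 / e)) \<le> b * ((1 / d) * (1 / e))"
      using that by (intro mult_right_mono) auto
    then show ?thesis using that by (simp add: abs_mult)
  qed
  show "\<exists>C. \<forall>z y. \<bar>H1 t x z y\<bar> \<le> C * (wgt t (z - x) * wgt t (z - y))"
  proof (intro exI allI)
    fix z y
    show "\<bar>H1 t x z y\<bar> \<le> M1 * M2 * (wgt t (z - x) * wgt t (z - y))"
    proof (cases "z \<in> ellipsoid t x y")
      case True
      have b: "\<bar>1::real\<bar> \<le> 1" by simp
      have "\<bar>H1 t x z y\<bar> = \<bar>1 / (16 * pi\<^sup>2 * norm (z - x) * norm (z - y))\<bar> * (\<bar>A z\<bar> * \<bar>p y\<bar>)"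
        using True by (simp add: H1_def abs_mult)
      also have "\<dots> \<le> (1 * (wgt t (z - x) * wgt t (z - y))) * (M1 * M2)"
        using M1(2)[OF E(1)[OF True]] M2(2)[OF E(3)[OF True]] M1(1)
        by (intro mult_mono order_trans[OF frac[OF b]] mult_left_mono mult_nonneg_nonneg weight_bounds E(1)[OF True] E(2)[OF True] wgt_nonneg) auto
      finally show ?thesis by (simp add: mult_ac)
    next
      case False
      then show ?thesis using M1(1) M2(1) by (simp add: H1_def wgt_nonneg)
    qed
  qed
  show "\<exists>C. \<forall>z y. \<bar>H2 t x z y\<bar> \<le> C * (wgt t (z - x) * wgt t (z - y))"
  proof (intro exI allI)
    fix z y
    show "\<bar>H2 t x z y\<bar> \<le> t * (M3 * M2) * (wgt t (z - x) * wgt t (z - y))"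
    proof (cases "z \<in> ellipsoid t x y")
      case True
      have b: "\<bar>t - norm (z - x) - norm (z - y)\<bar> \<le> t"
        using E(4)[OF True] norm_ge_zero[of "z - x"] norm_ge_zero[of "z - y"] t by linarith
      have "\<bar>H2 t x z y\<bar> = \<bar>(t - norm (z - x) - norm (z - y)) / (16 * pi\<^sup>2 * norm (z - x) * norm (z - y))\<bar> *
          (\<bar>grad R z \<bullet> ((1 / norm (z - y)) *\<^sub>R (z - y))\<bar> * \<bar>p y\<bar>)"
        unfolding H2_def abs_mult using True by simp
      also have "\<dots> \<le> (t * (wgt t (z - x) * wgt t (z - y))) * (M3 * M2)"
        using M2(2)[OF E(3)[OF True]] M3(1) t
        by (intro mult_mono order_trans[OF frac[OF b]] mult_left_mono mult_nonneg_nonneg weight_bounds dir E(1)[OF True] E(2)[OF True] wgt_nonneg) auto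
      finally show ?thesis by (simp add: mult_ac)
    next
      case False
      then show ?thesis using M3(1) M2(1) t by (simp add: H2_def wgt_nonneg)
    qed
  qed
  show "\<exists>C. \<forall>z y. \<bar>H3 t x z y\<bar> \<le> C * (wgt t (z - x) * wgt t (z - y))"
  proof (intro exI allI)
    fix z y
    show "\<bar>H3 t x z y\<bar> \<le> t\<^sup>2 * (M3 * M2) * (wgt t (z - x) * wgt t (z - y))"
    proof (cases "z \<in> ellipsoid t x y")
      case True
      have "\<bar>t - norm (z - x) - norm (z - y)\<bar> \<le> t"
        using E(4)[OF True] norm_ge_zero[of "z - x"] norm_ge_zero[of "z - y"] t by linarith
      then have b: "\<bar>(t - norm (z - x) - norm (z - y))\<^sup>2\<bar> \<le> t\<^sup>2"
        using t by (simp add: abs_le_square_iff[symmetric])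
      have "\<bar>H3 t x z y\<bar> = \<bar>(t - norm (z - x) - norm (z - y))\<^sup>2 / (32 * pi\<^sup>2 * norm (z - x) * (norm (z - y))\<^sup>2)\<bar> *
          (\<bar>grad R z \<bullet> ((1 / norm (z - y)) *\<^sub>R (z - y))\<bar> * \<bar>p y\<bar>)"
        unfolding H3_def abs_mult using True by simp
      also have "\<dots> \<le> (t\<^sup>2 * (wgt t (z - x) * wgt t (z - y))) * (M3 * M2)"
        using M2(2)[OF E(3)[OF True]] M3(1) t
        by (intro mult_mono order_trans[OF frac[OF b]] mult_left_mono mult_nonneg_nonneg weight_bounds dir E(1)[OF True] E(2)[OF True] wgt_nonneg) auto
      finally show ?thesis by (simp add: mult_ac)
    next
      case False
      then show ?thesis using M3(1) M2(1) t by (simp add: H3_def wgt_nonneg)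
    qed
  qed
qed

text \<open>For fixed \<open>z\<close>, membership in the ellipsoid says that \<open>y\<close> is
  within distance \<open>s = t - norm (z - x)\<close> of \<open>z\<close>. The inner integrals are
  thus retarded potentials at the point \<open>z\<close> and time \<open>s\<close>:
  \<open>H1\<close> yields \<open>A z * W0 s z\<close>, while \<open>H2\<close> and
  \<open>H3\<close> together yield the product of the gradients of \<open>R\<close> and
  \<open>U0\<close>, with a minus sign because \<open>z - y\<close> points opposite to the
  integration variable.\<close>

private lemma H_inner:
  "(LINT y|lborel. H1 t x z y) + ((LINT y|lborel. H2 t x z y) + (LINT y|lborel. H3 t x z y)) =
    (zext F1 (t - norm (z - x)) z + zext (\<lambda>s y. s\<^sup>2 / 2 * (A y * p y)) (t - norm (z - x)) z) * (1 / norm (z - x)) / (4 * pi)"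
proof (cases "norm (z - x) \<le> t")
  case False
  have "z \<notin> ellipsoid t x y" for y
    using False norm_ge_zero[of "z - y"] unfolding ellipsoid_def mem_Collect_eq by linarith
  then show ?thesis using False by (simp add: H1_def H2_def H3_def zext_def)
next
  case True
  define s where "s = t - norm (z - x)"
  have s: "0 \<le> s" using True by (simp add: s_def)
  define c where "c = 1 / (16 * pi\<^sup>2 * norm (z - x))"
  have E: "z \<in> ellipsoid t x (z + w) \<longleftrightarrow> 0 \<le> s - norm w" for w
    by (auto simp: ellipsoid_def s_def)
  have e1: "H1 t x z (z + w) = c * A z * (zext (\<lambda>s. p) (s - norm w) (z + w) * (1 / norm w))" for w
    by (simp add: H1_def E zext_def c_def indicator_def)
  have g: "grad R z \<bullet> ((1 / norm (z - (z + w))) *\<^sub>R (z - (z + w))) = - (\<Sum>i\<in>UNIV. partial i R z * w $ i) / norm w" for w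
    by (simp add: grad_inner)
  have e2: "H2 t x z (z + w) = - c * (\<Sum>i\<in>UNIV. partial i R z * (zext (\<lambda>s y. s * p y) (s - norm w) (z + w) * (w $ i / (norm w)\<^sup>2)))" for w
    unfolding H2_def g
    by (simp add: E zext_def c_def indicator_def s_def sum_distrib_left sum_divide_distrib sum_distrib_right sum_negf power2_eq_square divide_simps mult_ac)
  have e3: "H3 t x z (z + w) = - c * (\<Sum>i\<in>UNIV. partial i R z * (zext (\<lambda>s y. s\<^sup>2 / 2 * p y) (s - norm w) (z + w) * (w $ i / norm w ^ 3)))" for w
    unfolding H3_def g
    by (simp add: E zext_def c_def indicator_def s_def sum_distrib_left sum_divide_distrib sum_distrib_right sum_negf power3_eq_cube power2_eq_square divide_simps mult_ac)
  have [measurable]: "(\<lambda>z::R3. z $ i) \<in> borel_measurable borel" for i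
    by (intro borel_measurable_continuous_onI continuous_intros)
  have int2: "integrable lborel (\<lambda>w. zext (\<lambda>s y. s * p y) (s - norm w) (z + w) * (w $ i / (norm w)\<^sup>2))" for i
    by (rule integrable_zext_weight[OF sm_src(2) _ component_weights(1)]) (auto, measurable)
  have int3: "integrable lborel (\<lambda>w. zext (\<lambda>s y. s\<^sup>2 / 2 * p y) (s - norm w) (z + w) * (w $ i / norm w ^ 3))" for i
    by (rule integrable_zext_weight[OF sm_src(1) _ component_weights(2)]) (auto, measurable)
  have 1: "(LINT y|lborel. H1 t x z y) = c * A z * (4 * pi * W0 s z)"
    using potential_W0[OF s, of z] unfolding integral_translate(1)[of "H1 t x z" z, symmetric] e1
    by (simp only: integral_mult_right_zero has_bochner_integral_iff)
  have 2: "(LINT y|lborel. H2 t x z y) = - c * (\<Sum>i\<in>UNIV. partial i R z *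
      (LINT w|lborel. zext (\<lambda>s y. s * p y) (s - norm w) (z + w) * (w $ i / (norm w)\<^sup>2)))"
    unfolding integral_translate(1)[of "H2 t x z" z, symmetric] e2 integral_mult_right_zero
    by (subst Bochner_Integration.integral_sum) (intro integrable_mult_right int2, simp only: integral_mult_right_zero)
  have 3: "(LINT y|lborel. H3 t x z y) = - c * (\<Sum>i\<in>UNIV. partial i R z *
      (LINT w|lborel. zext (\<lambda>s y. s\<^sup>2 / 2 * p y) (s - norm w) (z + w) * (w $ i / norm w ^ 3)))"
    unfolding integral_translate(1)[of "H3 t x z" z, symmetric] e3 integral_mult_right_zero
    by (subst Bochner_Integration.integral_sum) (intro integrable_mult_right int3, simp only: integral_mult_right_zero)
  have 4: "(LINT y|lborel. H2 t x z y) + (LINT y|lborel. H3 t x z y) = - c * (4 * pi) * (\<Sum>i\<in>UNIV. partial i R z * Dx i U0 s z)"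
    unfolding 2 3 distrib_left[symmetric] sum.distrib[symmetric] potential_Dx_U0[OF s]
    by (simp add: sum_distrib_left mult_ac)
  \<comment> \<open>The wave equation of \<open>U0\<close>, whose second time derivative is
    \<open>W0\<close>, introduces the Laplacian that the source \<open>F1\<close> contains, at the
    price of the extra term \<open>s\<^sup>2 / 2 * p z\<close>.\<close>
  have W: "W0 s z = Lap U0 s z + s\<^sup>2 / 2 * p z"
    using U0_wave[OF s, of z] s by (simp add: Dt_Dt_primitive sm Dt_primitive)
  have c: "c * (4 * pi) = 1 / norm (z - x) / (4 * pi)"
    by (simp add: c_def power2_eq_square)
  have "(LINT y|lborel. H1 t x z y) + ((LINT y|lborel. H2 t x z y) + (LINT y|lborel. H3 t x z y)) =
     (c * (4 * pi)) * (A z * W0 s z - (\<Sum>i\<in>UNIV. partial i R z * Dx i U0 s z))"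
    unfolding 1 4 by (simp add: algebra_simps)
  also have "A z * W0 s z - (\<Sum>i\<in>UNIV. partial i R z * Dx i U0 s z) = F1 s z + s\<^sup>2 / 2 * (A z * p z)"
    unfolding W by (simp add: algebra_simps)
  finally show ?thesis
    unfolding c s_def[symmetric] using s by (simp add: zext_def)
qed

text \<open>Let \<open>V\<close> be the unnormalised potential of
  \<open>s\<^sup>2 / 2 * (A y * p y)\<close>. After Fubini the ellipsoid integrals give
  \<open>U1\<close> plus \<open>V / (4 * pi)\<close>, and the factor \<open>1 - e * A y\<close> in
  front gives \<open>U0\<close> minus \<open>e * V / (4 * pi)\<close>. The two contributions of
  \<open>V\<close> cancel.\<close>

theorem kernel_formula:
  assumes t: "0 \<le> t"
  shows "(LINT y:ball x t|lborel. green_kernel A R e t x y * p y) = U0 t x + e * U1 t x"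
proof -
  let ?h = "\<lambda>s y. s\<^sup>2 / 2 * p y" and ?k = "\<lambda>s y. s\<^sup>2 / 2 * (A y * p y)"
  let ?B = "\<lambda>y. indicator (ball x t) y :: real"
  define I1 where "I1 y = (LINT z|lborel. H1 t x z y)" for y
  define I2 where "I2 y = (LINT z|lborel. H2 t x z y)" for y
  define I3 where "I3 y = (LINT z|lborel. H3 t x z y)" for y
  define V where "V = (LINT y|lborel. zext ?k (t - norm (y - x)) y * (1 / norm (y - x)))"
  have shift: "(LINT y|lborel. zext h (t - norm (y - x)) y * (1 / norm (y - x))) =
      (LINT w|lborel. zext h (t - norm w) (x + w) * (1 / norm w))" for h
    using integral_translate(1)[of "\<lambda>y. zext h (t - norm (y - x)) y * (1 / norm (y - x))" x] by simp
  have shift_int: "integrable lborel (\<lambda>y. zext h (t - norm (y - x)) y * (1 / norm (y - x)))" if "smooth_spacetime h" for h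
  proof -
    have "integrable lborel (\<lambda>w. zext h (t - norm w) (x + w) * (1 / norm w))"
      by (rule integrable_zext_weight[OF that, of _ 1]) (use one_over_le_weight[of "norm _"] in \<open>auto, measurable\<close>)
    from integrable_translate[OF this, of "- x"] show ?thesis by simp
  qed
  obtain C1 where C1: "\<And>z y. \<bar>H1 t x z y\<bar> \<le> C1 * (wgt t (z - x) * wgt t (z - y))" using H_bounded(1)[OF t] by blast
  obtain C2 where C2: "\<And>z y. \<bar>H2 t x z y\<bar> \<le> C2 * (wgt t (z - x) * wgt t (z - y))" using H_bounded(2)[OF t] by blast
  obtain C3 where C3: "\<And>z y. \<bar>H3 t x z y\<bar> \<le> C3 * (wgt t (z - x) * wgt t (z - y))" using H_bounded(3)[OF t] by blast
  note f1 = fubini_wgt[OF H_measurable(1) C1, folded I1_def]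
    and f2 = fubini_wgt[OF H_measurable(2) C2, folded I2_def]
    and f3 = fubini_wgt[OF H_measurable(3) C3, folded I3_def]
  have "(LINT y|lborel. I1 y + (I2 y + I3 y)) =
     (LINT z|lborel. (LINT y|lborel. H1 t x z y) + ((LINT y|lborel. H2 t x z y) + (LINT y|lborel. H3 t x z y)))"
    using f1 f2 f3 by (simp add: I1_def I2_def I3_def)
  also have "\<dots> = (LINT z|lborel. (zext F1 (t - norm (z - x)) z * (1 / norm (z - x)) + zext ?k (t - norm (z - x)) z * (1 / norm (z - x))) / (4 * pi))"
    by (simp only: H_inner distrib_right)
  also have "\<dots> = (4 * pi * U1 t x + V) / (4 * pi)"
    unfolding integral_divide_zero Bochner_Integration.integral_add[OF shift_int[OF sm_src(4)] shift_int[OF sm_src(5)]] V_def[symmetric]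
    unfolding shift using potential_U1[OF t, of x] by (simp add: has_bochner_integral_iff)
  finally have I: "(LINT y|lborel. I1 y + (I2 y + I3 y)) = U1 t x + V / (4 * pi)" by (simp add: add_divide_distrib)
  have intI: "integrable lborel (\<lambda>y. I1 y + (I2 y + I3 y))"
    using f1 f2 f3 by simp
  let ?K0 = "\<lambda>y. (zext ?h (t - norm (y - x)) y * (1 / norm (y - x)) - e * (zext ?k (t - norm (y - x)) y * (1 / norm (y - x)))) / (4 * pi)"
  have K0: "has_bochner_integral lborel ?K0 (U0 t x - e * V / (4 * pi))"
  proof -
    have "(LINT y|lborel. ?K0 y) = (4 * pi * U0 t x - e * V) / (4 * pi)"
      unfolding integral_divide_zero Bochner_Integration.integral_diff[OF shift_int[OF sm_src(1)] integrable_mult_right[OF shift_int[OF sm_src(5)]]]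
        integral_mult_right_zero V_def[symmetric]
      unfolding shift using potential_U0[OF t, of x] by (simp add: has_bochner_integral_iff)
    moreover have "integrable lborel ?K0"
      by (intro integrable_divide Bochner_Integration.integrable_diff integrable_mult_right shift_int sm_src)
    ultimately show ?thesis by (simp add: has_bochner_integral_iff diff_divide_distrib)
  qed
  have gk: "green_kernel A R e t x y * p y = (t - norm (y - x))\<^sup>2 / (8 * pi * norm (y - x)) * (1 - e * A y) * p y + e * (I1 y + (I2 y + I3 y))" for y
  proof -
    have i: "(LINT z:ellipsoid t x y|lborel. k z * (e * a z)) * p y = e * (LINT z|lborel. indicator (ellipsoid t x y) z * (k z * a z) * p y)" for k a
    proof -
      have "(LINT z:ellipsoid t x y|lborel. k z * (e * a z)) = (LINT z|lborel. e * (indicator (ellipsoid t x y) z * (k z * a z)))"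
        unfolding set_lebesgue_integral_def by (intro Bochner_Integration.integral_cong) (auto simp: mult_ac)
      then show ?thesis unfolding integral_mult_right_zero integral_mult_left_zero by (simp only: mult.assoc)
    qed
    show ?thesis
      unfolding green_kernel_def distrib_right i I1_def I2_def I3_def H1_def H2_def H3_def by (simp only: distrib_left add.assoc)
  qed
  have "(LINT y:ball x t|lborel. green_kernel A R e t x y * p y) = (LINT y|lborel. ?K0 y + e * (I1 y + (I2 y + I3 y)))"
    unfolding set_lebesgue_integral_def
  proof (rule integral_cong_AE)
    have meas: "(\<lambda>y. ?K0 y + e * (I1 y + (I2 y + I3 y))) \<in> borel_measurable lborel"
      using K0 intI by (intro borel_measurable_add borel_measurable_times borel_measurable_const borel_measurable_integrable)
        (auto simp: has_bochner_integral_iff)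
    then show "(\<lambda>y. ?K0 y + e * (I1 y + (I2 y + I3 y))) \<in> borel_measurable lborel" .
    have in_ball: "?K0 y + e * (I1 y + (I2 y + I3 y)) = green_kernel A R e t x y * p y" if "norm (y - x) < t" for y
    proof -
      have "T / (8 * pi * N) * (1 - e * a) * q = (T / 2 * q * (1 / N) - e * (T / 2 * (a * q) * (1 / N))) / (4 * pi)"
        for T N a q :: real
        by (cases "N = 0") (auto simp: field_simps)
      then show ?thesis unfolding gk using that by (simp only: zext_def) simp
    qed
    have "indicator (ball x t) y *\<^sub>R (green_kernel A R e t x y * p y) = ?B y * (?K0 y + e * (I1 y + (I2 y + I3 y)))" for y
      using in_ball[of y] by (auto simp: indicator_def dist_norm norm_minus_commute)
    moreover have "(\<lambda>y. ?B y * (?K0 y + e * (I1 y + (I2 y + I3 y)))) \<in> borel_measurable lborel"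
      by (intro borel_measurable_times meas borel_measurable_indicator) auto
    ultimately show "(\<lambda>y. indicator (ball x t) y *\<^sub>R (green_kernel A R e t x y * p y)) \<in> borel_measurable lborel" by (simp only:)
    \<comment> \<open>Inside the ball the integrands agree. Beyond radius \<open>t\<close> the
      ellipsoid is empty by the triangle inequality and the retarded time is negative, so both
      vanish; the sphere itself is null.\<close>
    show "AE y in lborel. indicator (ball x t) y *\<^sub>R (green_kernel A R e t x y * p y) = ?K0 y + e * (I1 y + (I2 y + I3 y))"
      using AE_norm_diff_neq[of x t]
    proof eventually_elim
      case (elim y)
      show ?case
      proof (cases "norm (y - x) < t")
        case True
        then show ?thesis using in_ball[OF True] by (simp add: dist_norm norm_minus_commute)
      next
        case False
        then have "t < norm (y - x)" using elim by simp
        then have "z \<notin> ellipsoid t x y" for z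
          using norm_triangle_ineq4[of "z - x" "z - y"] by (auto simp: ellipsoid_def algebra_simps)
        then show ?thesis using \<open>t < norm (y - x)\<close>
          by (simp add: I1_def I2_def I3_def H1_def H2_def H3_def zext_def dist_norm norm_minus_commute)
      qed
    qed
  qed
  also have "\<dots> = U0 t x - e * V / (4 * pi) + e * (U1 t x + V / (4 * pi))"
    using K0 intI by (subst Bochner_Integration.integral_add) (auto simp: has_bochner_integral_iff I)
  finally show ?thesis by (simp add: algebra_simps)
qed

end

section \<open>Iterated partial derivatives and families of coefficients\<close>

text \<open>Iterated derivatives are indexed by words instead of multiindices: prepending a letter
  is one more derivative, which suits inductions on the order. Different words may denote the same
  derivative, which costs only a factor in the norms.\<close>

definition Dw :: "3 list \<Rightarrow> (R3 \<Rightarrow> real) \<Rightarrow> R3 \<Rightarrow> real" where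
  "Dw w f = foldr partial w f"

lemma Dw_simps [simp]: "Dw [] f = f" "Dw (i # w) f = partial i (Dw w f)"
  by (simp_all add: Dw_def)

lemma Dw_snoc: "Dw (w @ [i]) f = Dw w (partial i f)"
  by (simp add: Dw_def)

lemma smooth_on_Dw: "smooth_on UNIV f \<Longrightarrow> smooth_on UNIV (Dw w f)"
  by (induction w) (auto intro: smooth_on_partial)

lemma differentiable_Dw: "smooth_on UNIV f \<Longrightarrow> Dw w f differentiable (at x)"
  by (intro smooth_on_differentiable smooth_on_Dw)

lemma partial_commute_fun: "smooth_on UNIV f \<Longrightarrow> partial i (partial j f) = partial j (partial i f)"
  using partial_commute by blast

lemma Dw_partial: "smooth_on UNIV f \<Longrightarrow> Dw w (partial i f) = partial i (Dw w f)"
  by (induction w) (auto simp: partial_commute_fun[OF smooth_on_Dw, of f i])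

lemma Dw_add:
  "smooth_on UNIV f \<Longrightarrow> smooth_on UNIV g \<Longrightarrow> Dw w (\<lambda>x. f x + g x) = (\<lambda>x. Dw w f x + Dw w g x)"
  by (induction w) (auto simp: partial_add differentiable_Dw)

text \<open>The index \<open>e\<close> will range over values of \<epsilon>, and each bound
  \<open>M\<close> serves the whole set \<open>S\<close>. The energy constants depend on the
  coefficients through such bounds, and on a positive lower bound; uniformity over small \<epsilon>
  is the source of the O(1) claim.\<close>

definition bndk :: "nat \<Rightarrow> 'e set \<Rightarrow> ('e \<Rightarrow> R3 \<Rightarrow> real) \<Rightarrow> bool" where
  "bndk k S c \<longleftrightarrow> (\<forall>e\<in>S. smooth_on UNIV (c e)) \<and>
     (\<forall>w. length w \<le> k \<longrightarrow> (\<exists>M. \<forall>e\<in>S. \<forall>x. \<bar>Dw w (c e) x\<bar> \<le> M))"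

lemma bndk_0: "bndk 0 S c \<longleftrightarrow> (\<forall>e\<in>S. smooth_on UNIV (c e)) \<and> (\<exists>M. \<forall>e\<in>S. \<forall>x. \<bar>c e x\<bar> \<le> M)"
  by (simp add: bndk_def)

text \<open>Splitting off the last letter of a word, that is the innermost derivative, gives a
  recursion on the order in which the product rule and the rule for inverses can be applied.\<close>

lemma bndk_Suc: "bndk (Suc k) S c \<longleftrightarrow> bndk 0 S c \<and> (\<forall>i. bndk k S (\<lambda>e. partial i (c e)))"
proof
  assume *: "bndk (Suc k) S c"
  then have "bndk 0 S c"
    using *[unfolded bndk_def, THEN conjunct2, rule_format, of "[]"] unfolding bndk_0 by (simp add: bndk_def)
  moreover have "bndk k S (\<lambda>e. partial i (c e))" for i
    unfolding bndk_def
  proof (intro conjI ballI allI impI)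
    show "smooth_on UNIV (partial i (c e))" if "e \<in> S" for e
      using * that by (auto simp: bndk_def intro: smooth_on_partial)
    show "\<exists>M. \<forall>e\<in>S. \<forall>x. \<bar>Dw w (partial i (c e)) x\<bar> \<le> M" if "length w \<le> k" for w
      using *[unfolded bndk_def, THEN conjunct2, rule_format, of "w @ [i]"] that by (simp add: Dw_snoc)
  qed
  ultimately show "bndk 0 S c \<and> (\<forall>i. bndk k S (\<lambda>e. partial i (c e)))" by simp
next
  assume *: "bndk 0 S c \<and> (\<forall>i. bndk k S (\<lambda>e. partial i (c e)))"
  show "bndk (Suc k) S c"
    unfolding bndk_def
  proof (intro conjI ballI allI impI)
    show "smooth_on UNIV (c e)" if "e \<in> S" for e
      using * that by (auto simp: bndk_def)
    fix w :: "3 list" assume w: "length w \<le> Suc k"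
    show "\<exists>M. \<forall>e\<in>S. \<forall>x. \<bar>Dw w (c e) x\<bar> \<le> M"
    proof (cases w rule: rev_cases)
      case Nil
      then show ?thesis using * by (simp add: bndk_0)
    next
      case (snoc v i)
      have "bndk k S (\<lambda>e. partial i (c e))" using * by blast
      then show ?thesis using w unfolding snoc Dw_snoc by (auto simp: bndk_def)
    qed
  qed
qed

lemma bndk_Suc_imp: "bndk (Suc k) S c \<Longrightarrow> bndk k S c"
  by (auto simp: bndk_def)

lemma bndk_smooth: "bndk k S c \<Longrightarrow> e \<in> S \<Longrightarrow> smooth_on UNIV (c e)"
  by (simp add: bndk_def)

lemma bndk_cong:
  assumes "bndk k S c" "\<And>e. e \<in> S \<Longrightarrow> c e = d e"
  shows "bndk k S d"
  using assms unfolding bndk_def by (metis (no_types, lifting))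

lemma bndk_0_add: "bndk 0 S c \<Longrightarrow> bndk 0 S d \<Longrightarrow> bndk 0 S (\<lambda>e x. c e x + d e x)"
proof -
  assume *: "bndk 0 S c" "bndk 0 S d"
  then obtain M N where "\<forall>e\<in>S. \<forall>x. \<bar>c e x\<bar> \<le> M" "\<forall>e\<in>S. \<forall>x. \<bar>d e x\<bar> \<le> N" by (auto simp: bndk_0)
  then have "\<forall>e\<in>S. \<forall>x. \<bar>c e x + d e x\<bar> \<le> M + N" by (meson abs_triangle_ineq add_mono order_trans)
  then show ?thesis using * by (auto simp: bndk_0 intro: smooth_on_add)
qed

lemma bndk_0_mult: "bndk 0 S c \<Longrightarrow> bndk 0 S d \<Longrightarrow> bndk 0 S (\<lambda>e x. c e x * d e x)"
proof -
  assume *: "bndk 0 S c" "bndk 0 S d"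
  then obtain M N where "\<forall>e\<in>S. \<forall>x. \<bar>c e x\<bar> \<le> M" "\<forall>e\<in>S. \<forall>x. \<bar>d e x\<bar> \<le> N" by (auto simp: bndk_0)
  then have "\<forall>e\<in>S. \<forall>x. \<bar>c e x * d e x\<bar> \<le> \<bar>M\<bar> * \<bar>N\<bar>"
    unfolding abs_mult by (intro ballI allI mult_mono) (auto intro: order_trans[OF _ abs_ge_self])
  then show ?thesis using * by (auto simp: bndk_0 intro: smooth_on_mult)
qed

lemma bndk_add: "bndk k S c \<Longrightarrow> bndk k S d \<Longrightarrow> bndk k S (\<lambda>e x. c e x + d e x)"
proof (induction k arbitrary: c d)
  case (Suc k)
  have "bndk k S (\<lambda>e. partial i (\<lambda>x. c e x + d e x))" for i
  proof (rule bndk_cong)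
    show "bndk k S (\<lambda>e x. partial i (c e) x + partial i (d e) x)"
      using Suc by (auto simp: bndk_Suc)
  qed (use Suc.prems in \<open>auto simp: partial_add smooth_on_differentiable bndk_smooth fun_eq_iff\<close>)
  then show ?case using Suc.prems by (simp add: bndk_Suc bndk_0_add)
qed (rule bndk_0_add)

lemma bndk_mult: "bndk k S c \<Longrightarrow> bndk k S d \<Longrightarrow> bndk k S (\<lambda>e x. c e x * d e x)"
proof (induction k arbitrary: c d)
  case (Suc k)
  have "bndk k S (\<lambda>e. partial i (\<lambda>x. c e x * d e x))" for i
  proof (rule bndk_cong)
    show "bndk k S (\<lambda>e x. partial i (c e) x * d e x + c e x * partial i (d e) x)"
      using Suc.prems bndk_Suc_imp[OF Suc.prems(1)] bndk_Suc_imp[OF Suc.prems(2)]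
      by (intro bndk_add Suc.IH) (auto simp: bndk_Suc)
  qed (use Suc.prems in \<open>auto simp: partial_mult smooth_on_differentiable bndk_smooth fun_eq_iff\<close>)
  then show ?case using Suc.prems by (simp add: bndk_Suc bndk_0_mult)
qed (rule bndk_0_mult)

lemma Dw_const: "Dw w (\<lambda>x. a) = (\<lambda>x. if w = [] then a else 0)"
  by (induction w) auto

lemma bndk_const:
  assumes "bounded (f ` S)"
  shows "bndk k S (\<lambda>e x. f e)"
proof -
  obtain M where M: "\<And>e. e \<in> S \<Longrightarrow> \<bar>f e\<bar> \<le> M" using assms by (auto simp: bounded_iff)
  show ?thesis
    unfolding bndk_def
  proof (intro allI conjI impI ballI)
    show "\<exists>M. \<forall>e\<in>S. \<forall>x. \<bar>Dw w (\<lambda>x. f e) x\<bar> \<le> M" for w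
      by (rule exI[of _ M]) (use M in \<open>auto simp: Dw_const intro: order_trans[OF abs_ge_zero]\<close>)
  qed (simp add: smooth_on_const)
qed

lemma bndk_inverse:
  assumes m: "0 < m" "\<And>e x. e \<in> S \<Longrightarrow> m \<le> c e x"
  shows "bndk k S c \<Longrightarrow> bndk k S (\<lambda>e x. inverse (c e x))"
proof (induction k)
  case 0
  have ne: "c e x \<noteq> 0" if "e \<in> S" for e x using m(2)[OF that, of x] m(1) by linarith
  have "\<forall>e\<in>S. \<forall>x. \<bar>inverse (c e x)\<bar> \<le> inverse m"
    using m by (auto simp: abs_of_nonneg order_trans[OF less_imp_le[OF m(1)]] intro!: le_imp_inverse_le)
  then show ?case using 0 ne by (auto simp: bndk_0 intro!: smooth_on_inverse)
next
  case (Suc k)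
  have ne: "c e x \<noteq> 0" if "e \<in> S" for e x using m(2)[OF that, of x] m(1) by linarith
  have IH: "bndk k S (\<lambda>e x. inverse (c e x))" using Suc bndk_Suc_imp by blast
  have "\<forall>e\<in>S. \<forall>x. \<bar>inverse (c e x)\<bar> \<le> inverse m"
    using m by (auto simp: abs_of_nonneg order_trans[OF less_imp_le[OF m(1)]] intro!: le_imp_inverse_le)
  then have "bndk 0 S (\<lambda>e x. inverse (c e x))"
    using Suc.prems ne by (auto simp: bndk_0 bndk_smooth intro!: smooth_on_inverse)
  moreover have "bndk k S (\<lambda>e. partial i (\<lambda>x. inverse (c e x)))" for i
  proof (rule bndk_cong)
    have "bndk k S (\<lambda>e x. -1 :: real)" by (rule bndk_const[of "\<lambda>e. -1"]) (simp add: bounded_iff exI[of _ 1])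
    then show "bndk k S (\<lambda>e x. (-1) * (inverse (c e x) * partial i (c e) x * inverse (c e x)))"
      using Suc.prems by (intro bndk_mult IH) (auto simp: bndk_Suc)
  qed (use Suc.prems ne in \<open>auto simp: partial_inverse smooth_on_differentiable bndk_smooth fun_eq_iff\<close>)
  ultimately show ?case by (simp add: bndk_Suc)
qed

definition bnd :: "'e set \<Rightarrow> ('e \<Rightarrow> R3 \<Rightarrow> real) \<Rightarrow> bool" where
  "bnd S c \<longleftrightarrow> (\<forall>k. bndk k S c)"

lemma bnd_add: "bnd S c \<Longrightarrow> bnd S d \<Longrightarrow> bnd S (\<lambda>e x. c e x + d e x)"
  and bnd_mult: "bnd S c \<Longrightarrow> bnd S d \<Longrightarrow> bnd S (\<lambda>e x. c e x * d e x)"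
  by (simp_all add: bnd_def bndk_add bndk_mult)

lemma bnd_inverse: "0 < m \<Longrightarrow> (\<And>e x. e \<in> S \<Longrightarrow> m \<le> c e x) \<Longrightarrow> bnd S c \<Longrightarrow> bnd S (\<lambda>e x. inverse (c e x))"
  unfolding bnd_def using bndk_inverse by blast

lemma bnd_partial: "bnd S c \<Longrightarrow> bnd S (\<lambda>e. partial i (c e))"
  unfolding bnd_def by (intro allI) (metis bndk_Suc)

lemma bnd_smooth: "bnd S c \<Longrightarrow> e \<in> S \<Longrightarrow> smooth_on UNIV (c e)"
  unfolding bnd_def by (erule allE[of _ 0]) (rule bndk_smooth)

lemma bnd_bounded: "bnd S c \<Longrightarrow> \<exists>M. \<forall>e\<in>S. \<forall>x. \<bar>c e x\<bar> \<le> M"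
  unfolding bnd_def by (erule allE[of _ 0]) (simp add: bndk_0)

lemma bnd_const: "bounded (f ` S) \<Longrightarrow> bnd S (\<lambda>e x. f e)"
  by (simp add: bnd_def bndk_const)

lemma Dw_zero_outside:
  assumes "closed K" "\<And>x. x \<notin> K \<Longrightarrow> f x = 0" "x \<notin> K"
  shows "Dw w f x = 0"
  using assms(3)
proof (induction w arbitrary: x)
  case (Cons i w)
  then show ?case
    using partial_zero_on_open[of "- K" x "Dw w f" i] assms(1) by (auto simp: open_Compl)
qed (use assms(2) in simp)

lemma bnd_compact_support:
  assumes f: "smooth_on UNIV f" and K: "compact K" "\<And>x. x \<notin> K \<Longrightarrow> f x = 0"
  shows "bnd S (\<lambda>e. f)"
  unfolding bnd_def bndk_def
proof (intro allI conjI impI ballI)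
  fix w
  have "compact (Dw w f ` K)"
    by (intro compact_continuous_image K continuous_on_subset[OF smooth_on_imp_continuous_on[OF smooth_on_Dw[OF f]]]) simp
  from compact_imp_bounded[OF this] obtain M where M: "\<And>x. x \<in> K \<Longrightarrow> \<bar>Dw w f x\<bar> \<le> M"
    by (force simp: bounded_iff)
  have "\<bar>Dw w f x\<bar> \<le> max M 0" for x
    using M[of x] Dw_zero_outside[OF compact_imp_closed[OF K(1)] K(2), where x = x and w = w] by (cases "x \<in> K") auto
  then show "\<exists>M. \<forall>e\<in>S. \<forall>x. \<bar>Dw w f x\<bar> \<le> M" by blast
qed (rule f)

section \<open>Differential operators and commutators\<close>

text \<open>A linear differential operator is a list of coefficient families paired with words. As
  lists, operators can be differentiated by the product rule and appended while their order and the
  uniform bounds on their coefficients remain visible.\<close>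

definition dop :: "(('e \<Rightarrow> R3 \<Rightarrow> real) \<times> 3 list) list \<Rightarrow> 'e \<Rightarrow> (R3 \<Rightarrow> real) \<Rightarrow> R3 \<Rightarrow> real" where
  "dop qs e f x = (\<Sum>(c, w)\<leftarrow>qs. c e x * Dw w f x)"

definition dop_ok :: "'e set \<Rightarrow> nat \<Rightarrow> (('e \<Rightarrow> R3 \<Rightarrow> real) \<times> 3 list) list \<Rightarrow> bool" where
  "dop_ok S m qs \<longleftrightarrow> (\<forall>(c, w)\<in>set qs. bnd S c \<and> length w \<le> m)"

definition words :: "nat \<Rightarrow> 3 list set" where
  "words m = {w. length w \<le> m}"

lemma finite_words [simp]: "finite (words m)"
  using finite_lists_length_le[of "UNIV :: 3 set" m] by (simp add: words_def)

lemma dop_simps: "dop [] e f x = 0" "dop ((c, w) # qs) e f x = c e x * Dw w f x + dop qs e f x"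
  by (simp_all add: dop_def)

lemma smooth_on_dop:
  assumes "dop_ok S m qs" "e \<in> S" "smooth_on UNIV f"
  shows "smooth_on UNIV (dop qs e f)"
  using assms(1)
proof (induction qs)
  case Nil
  then show ?case by (simp add: dop_simps[abs_def] smooth_on_const)
next
  case (Cons q qs)
  obtain c w where q: "q = (c, w)" by (cases q)
  show ?case
    using Cons assms(2,3) unfolding q dop_simps[abs_def] dop_ok_def
    by (intro smooth_on_add smooth_on_mult smooth_on_Dw) (auto intro: bnd_smooth)
qed

lemma dop_bound:
  assumes "dop_ok S m qs"
  shows "\<exists>K\<ge>0. \<forall>e\<in>S. \<forall>f x. \<bar>dop qs e f x\<bar> \<le> K * sqrt (\<Sum>w\<in>words m. (Dw w f x)\<^sup>2)"
  using assms
proof (induction qs)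
  case Nil
  then show ?case by (auto simp: dop_simps intro: exI[of _ 0])
next
  case (Cons q qs)
  obtain c w where q: "q = (c, w)" by (cases q)
  have "dop_ok S m qs" and c: "bnd S c" and w: "w \<in> words m" using Cons.prems by (auto simp: dop_ok_def q words_def)
  with Cons.IH obtain K where K: "K \<ge> 0" "\<forall>e\<in>S. \<forall>f x. \<bar>dop qs e f x\<bar> \<le> K * sqrt (\<Sum>w\<in>words m. (Dw w f x)\<^sup>2)" by blast
  obtain M where M: "\<forall>e\<in>S. \<forall>x. \<bar>c e x\<bar> \<le> M" using bnd_bounded[OF c] by blast
  show ?case
  proof (intro exI conjI ballI allI)
    show "0 \<le> \<bar>M\<bar> + K" using K(1) by simp
    fix e f x assume e: "e \<in> S"
    have "\<bar>Dw w f x\<bar> \<le> sqrt (\<Sum>w\<in>words m. (Dw w f x)\<^sup>2)"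
      using member_le_sum[OF w, of "\<lambda>w. (Dw w f x)\<^sup>2"] by (intro real_le_rsqrt) auto
    moreover have "\<bar>c e x\<bar> \<le> \<bar>M\<bar>" using M e by (force intro: order_trans[OF _ abs_ge_self])
    ultimately have "\<bar>c e x * Dw w f x\<bar> \<le> \<bar>M\<bar> * sqrt (\<Sum>w\<in>words m. (Dw w f x)\<^sup>2)"
      unfolding abs_mult by (intro mult_mono) auto
    moreover have "\<bar>dop qs e f x\<bar> \<le> K * sqrt (\<Sum>w\<in>words m. (Dw w f x)\<^sup>2)" using K(2) e by blast
    ultimately show "\<bar>dop (q # qs) e f x\<bar> \<le> (\<bar>M\<bar> + K) * sqrt (\<Sum>w\<in>words m. (Dw w f x)\<^sup>2)"
      unfolding q dop_simps distrib_right by linarith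
  qed
qed

lemma dop_append: "dop (qs @ rs) e f x = dop qs e f x + dop rs e f x"
  by (simp add: dop_def)

definition dop_partial :: "3 \<Rightarrow> (('e \<Rightarrow> R3 \<Rightarrow> real) \<times> 3 list) list \<Rightarrow> (('e \<Rightarrow> R3 \<Rightarrow> real) \<times> 3 list) list" where
  "dop_partial i qs = concat (map (\<lambda>(c, w). [(\<lambda>e. partial i (c e), w), (c, i # w)]) qs)"

lemma dop_ok_partial: "dop_ok S m qs \<Longrightarrow> dop_ok S (Suc m) (dop_partial i qs)"
  by (force simp: dop_ok_def dop_partial_def intro: bnd_partial)

lemma partial_dop:
  assumes "dop_ok S m qs" "e \<in> S" "smooth_on UNIV f"
  shows "partial i (dop qs e f) x = dop (dop_partial i qs) e f x"
  using assms(1)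
proof (induction qs)
  case Nil
  then show ?case by (simp add: dop_simps[abs_def] dop_partial_def)
next
  case (Cons q qs)
  obtain c w where q: "q = (c, w)" by (cases q)
  have ok: "dop_ok S m qs" "bnd S c" using Cons.prems by (auto simp: dop_ok_def q)
  have d: "c e differentiable (at x)" "Dw w f differentiable (at x)" "dop qs e f differentiable (at x)"
    using assms(2,3) ok by (auto intro!: smooth_on_differentiable smooth_on_dop smooth_on_Dw bnd_smooth[of S c])
  have "partial i (dop (q # qs) e f) x = partial i (\<lambda>x. c e x * Dw w f x + dop qs e f x) x"
    unfolding q dop_simps[abs_def] by simp
  also have "\<dots> = partial i (c e) x * Dw w f x + c e x * partial i (Dw w f) x + partial i (dop qs e f) x"
    using d by (simp add: partial_add partial_mult)
  also have "\<dots> = dop (dop_partial i (q # qs)) e f x"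
    unfolding Cons.IH[OF ok(1)] by (simp add: q dop_partial_def dop_simps)
  finally show ?case .
qed

definition lap :: "(R3 \<Rightarrow> real) \<Rightarrow> R3 \<Rightarrow> real" where
  "lap f x = (\<Sum>i\<in>UNIV. partial i (partial i f) x)"

lemma smooth_on_lap: "smooth_on UNIV f \<Longrightarrow> smooth_on UNIV (lap f)"
  unfolding lap_def[abs_def] by (intro smooth_on_sum smooth_on_partial) auto

lemma partial_lap:
  assumes "smooth_on UNIV f"
  shows "partial i (lap f) x = lap (partial i f) x"
proof -
  have "partial i (lap f) x = (\<Sum>j\<in>UNIV. partial i (partial j (partial j f)) x)"
    unfolding lap_def[abs_def] by (intro partial_sum smooth_on_differentiable smooth_on_partial assms) auto
  also have "\<dots> = lap (partial i f) x"
    unfolding lap_def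
    by (intro sum.cong refl) (simp add: partial_commute_fun[OF smooth_on_partial[OF assms], of i] partial_commute_fun[OF assms, of i])
  finally show ?thesis .
qed

text \<open>Differentiating the principal part \<open>a e x * lap (Dw l f) x\<close> in direction
  \<open>i\<close> reproduces the principal part for the word \<open>i # l\<close> and leaves
  \<open>partial i (a e) x * lap (Dw l f) x\<close>. That remainder has order
  \<open>length l + 2\<close>, one above the length of the new word and one below the principal
  part, so the order bound persists.\<close>

lemma commutator:
  fixes a :: "'e \<Rightarrow> R3 \<Rightarrow> real" and b :: "3 \<Rightarrow> 'e \<Rightarrow> R3 \<Rightarrow> real"
  assumes a: "bnd S a" and b: "\<And>i. bnd S (b i)"
  shows "\<exists>qs. dop_ok S (Suc (length l)) qs \<and> (\<forall>e\<in>S. \<forall>f. smooth_on UNIV f \<longrightarrow>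
    Dw l (\<lambda>x. a e x * lap f x + (\<Sum>i\<in>UNIV. b i e x * partial i f x)) =
      (\<lambda>x. a e x * lap (Dw l f) x + dop qs e f x))"
proof (induction l)
  case Nil
  show ?case
    by (rule exI[of _ "[(b 1, [1]), (b 2, [2]), (b 3, [3])]"])
      (auto simp: dop_ok_def dop_simps sum_3 b)
next
  case (Cons i l)
  then obtain qs where ok: "dop_ok S (Suc (length l)) qs"
    and eq: "\<And>e (f :: R3 \<Rightarrow> real). e \<in> S \<Longrightarrow> smooth_on UNIV f \<Longrightarrow>
      Dw l (\<lambda>x. a e x * lap f x + (\<Sum>i\<in>UNIV. b i e x * partial i f x)) = (\<lambda>x. a e x * lap (Dw l f) x + dop qs e f x)"
    by blast
  let ?a = "\<lambda>e. partial i (a e)"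
  let ?qs = "[(?a, 1 # 1 # l), (?a, 2 # 2 # l), (?a, 3 # 3 # l)] @ dop_partial i qs"
  show ?case
  proof (intro exI[of _ ?qs] conjI ballI allI impI ext)
    show "dop_ok S (Suc (length (i # l))) ?qs"
      using dop_ok_partial[OF ok, of i] bnd_partial[OF a, of i] by (auto simp: dop_ok_def)
    fix e and f :: "R3 \<Rightarrow> real" and x assume e: "e \<in> S" and f: "smooth_on UNIV f"
    have "Dw (i # l) (\<lambda>x. a e x * lap f x + (\<Sum>i\<in>UNIV. b i e x * partial i f x)) x =
        partial i (\<lambda>x. a e x * lap (Dw l f) x + dop qs e f x) x"
      by (simp add: eq[OF e f])
    also have "\<dots> = partial i (a e) x * lap (Dw l f) x + a e x * partial i (lap (Dw l f)) x + partial i (dop qs e f) x"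
      using e f ok a
      by (subst partial_add, simp_all add: partial_mult smooth_on_differentiable smooth_on_mult smooth_on_lap smooth_on_Dw
          bnd_smooth[OF a e] smooth_on_dop[OF ok e f])
    also have "\<dots> = a e x * lap (Dw (i # l) f) x + dop ?qs e f x"
      unfolding partial_lap[OF smooth_on_Dw[OF f]] partial_dop[OF ok e f] dop_append
      by (simp add: dop_simps lap_def sum_3 algebra_simps)
    finally show "Dw (i # l) (\<lambda>x. a e x * lap f x + (\<Sum>i\<in>UNIV. b i e x * partial i f x)) x =
      a e x * lap (Dw (i # l) f) x + dop ?qs e f x" .
  qed
qed

section \<open>The energy estimate\<close>

text \<open>Support growing with unit speed from a ball. The speed is that of the
  constant-coefficient wave operator, against which finite propagation will be established with all
  coefficient perturbations counted as source.\<close>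

definition cone :: "real \<Rightarrow> (real \<Rightarrow> R3 \<Rightarrow> real) \<Rightarrow> bool" where
  "cone B h \<longleftrightarrow> (\<forall>t\<ge>0. \<forall>x. B + t < norm x \<longrightarrow> h t x = 0)"

lemma coneD: "cone B h \<Longrightarrow> 0 \<le> t \<Longrightarrow> B + t < norm x \<Longrightarrow> h t x = 0"
  by (simp add: cone_def)

lemma cone_add: "cone B h \<Longrightarrow> cone B g \<Longrightarrow> cone B (\<lambda>t x. h t x + g t x)"
  and cone_mult: "cone B h \<Longrightarrow> cone B (\<lambda>t x. f t x * h t x)"
  and cone_sum: "(\<And>i. i \<in> I \<Longrightarrow> cone B (H i)) \<Longrightarrow> cone B (\<lambda>t x. \<Sum>i\<in>I. H i t x)"
  by (auto simp: cone_def)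

lemma cone_Dx: "cone B h \<Longrightarrow> cone B (Dx i h)"
  unfolding cone_def Dx_def by (blast intro: partial_zero_outside_cball)

lemma cone_Dt: "cone B h \<Longrightarrow> cone B (Dt h)"
  unfolding cone_def
proof (intro allI impI)
  fix t and x :: R3 assume *: "\<forall>t\<ge>0. \<forall>x. B + t < norm x \<longrightarrow> h t x = 0" "0 \<le> t" "B + t < norm x"
  have "((\<lambda>s. h s x) has_real_derivative 0) (at t within {0..})"
    by (rule has_field_derivative_transform_within[OF DERIV_const[of 0], where d = "norm x - (B + t)"])
      (use * in \<open>auto simp: dist_real_def\<close>)
  then show "Dt h t x = 0" unfolding Dt_def using *(2) by (rule time_deriv_eqI)
qed

lemma cone_integrable:
  assumes "smooth_spacetime h" "cone B h" "0 \<le> t"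
  shows "integrable lborel (h t)"
  by (rule integral_ball_support(1)[where B = "B + t"])
    (use assms in \<open>auto intro: smooth_on_imp_continuous_on smooth_spacetime_slice coneD\<close>)

lemma cone_integral_eq:
  assumes "smooth_spacetime h" "cone B h" "0 \<le> t" "t \<le> T"
  shows "(LINT x|lborel. h t x) = integral (cbox (- (B + T) *\<^sub>R One) ((B + T) *\<^sub>R One)) (h t)"
proof (rule integral_ball_support(2))
  fix x :: R3 assume "B + T < norm x"
  then show "h t x = 0" using coneD[OF assms(2,3), of x] assms(4) by simp
qed (intro smooth_on_imp_continuous_on smooth_spacetime_slice assms)

lemma integral_time_derivative:
  assumes h: "smooth_spacetime h" "cone B h" and t: "t \<in> {0..T}"
  shows "((\<lambda>t. LINT x|lborel. h t x) has_real_derivative (LINT x|lborel. Dt h t x)) (at t within {0..T})"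
proof -
  let ?c = "cbox (- (B + T) *\<^sub>R One) ((B + T) *\<^sub>R One) :: R3 set"
  have D: "((\<lambda>t. integral ?c (h t)) has_real_derivative integral ?c (Dt h t)) (at t within {0..T})"
  proof (rule leibniz_rule_field_derivative[OF _ _ _ t])
    show "((\<lambda>t. h t x) has_real_derivative Dt h t x) (at t within {0..T})" if "t \<in> {0..T}" for t x
      by (rule has_field_derivative_subset[OF Dt_has_derivative[OF h(1)]]) (use that in auto)
    show "h t integrable_on ?c" if "t \<in> {0..T}" for t
      by (intro integrable_continuous continuous_on_subset[OF smooth_on_imp_continuous_on[OF smooth_spacetime_slice[OF h(1)]]])
        (use that in auto)
    show "continuous_on ({0..T} \<times> ?c) (\<lambda>(t, x). Dt h t x)"
      unfolding case_prod_beta'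
      by (intro continuous_on_spacetime[OF smooth_spacetime_Dt[OF h(1)]] continuous_intros) auto
  qed auto
  have "(LINT x|lborel. Dt h t x) = integral ?c (Dt h t)"
    by (rule cone_integral_eq) (use t h in \<open>auto intro: smooth_intros cone_Dt\<close>)
  moreover have "((\<lambda>t. LINT x|lborel. h t x) has_real_derivative integral ?c (Dt h t)) (at t within {0..T})"
  proof (rule has_field_derivative_transform_within[OF D zero_less_one t])
    show "integral ?c (h s) = (LINT x|lborel. h s x)" if "s \<in> {0..T}" for s
      using that by (intro cone_integral_eq[OF h, symmetric]) auto
  qed
  ultimately show ?thesis by simp
qed

lemma integral_partial_smooth:
  assumes g: "smooth_on UNIV g" and 0: "\<And>x. B < norm x \<Longrightarrow> g x = 0"
  shows "(LINT x|lborel. partial i g x) = 0"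
proof (rule integral_partial_zero[where v = "axis i 1", OF _ _ _ 0])
  show "((\<lambda>h. g (z + h *\<^sub>R axis i 1)) has_real_derivative partial i g z) (at 0)" for z
    by (rule partial_line[OF smooth_on_differentiable[OF g]])
qed (intro smooth_on_imp_continuous_on smooth_on_partial g)+

lemma smooth_spacetime_Dw: "smooth_spacetime u \<Longrightarrow> smooth_spacetime (\<lambda>t. Dw w (u t))"
proof (induction w)
  case (Cons i w)
  have "smooth_spacetime (Dx i (\<lambda>t. Dw w (u t)))" by (intro smooth_intros Cons)
  then show ?case by (simp add: Dx_def[abs_def])
qed simp

lemma cone_Dw: "cone B u \<Longrightarrow> cone B (\<lambda>t. Dw w (u t))"
proof (induction w)
  case (Cons i w)
  then show ?case using cone_Dx[of B "\<lambda>t. Dw w (u t)" i] by (simp add: Dx_def[abs_def])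
qed simp

lemma Dt_Dw: "smooth_spacetime u \<Longrightarrow> 0 \<le> t \<Longrightarrow> Dt (\<lambda>t. Dw w (u t)) t x = Dw w (Dt u t) x"
proof (induction w arbitrary: x)
  case (Cons i w)
  have "Dt (\<lambda>t. Dw (i # w) (u t)) t x = Dt (Dx i (\<lambda>t. Dw w (u t))) t x"
    by (simp add: Dx_def[abs_def])
  also have "\<dots> = Dx i (Dt (\<lambda>t. Dw w (u t))) t x"
    by (rule Dt_Dx_commute[OF smooth_spacetime_Dw]) (use Cons in auto)
  also have "\<dots> = Dx i (\<lambda>t. Dw w (Dt u t)) t x"
    by (rule Dx_cong) (use Cons in auto)
  finally show ?case by (simp add: Dx_def)
qed simp

lemma Dw_has_derivative:
  "smooth_spacetime u \<Longrightarrow> 0 \<le> t \<Longrightarrow>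
    ((\<lambda>t. Dw w (u t) x) has_real_derivative Dw w (Dt u t) x) (at t within {0..})"
  using Dt_has_derivative[OF smooth_spacetime_Dw] Dt_Dw by metis

text \<open>The choice \<open>l = s / y\<close> balances the two terms that depend on
  \<open>l\<close>. Where \<open>s = 0\<close> there is no best \<open>l\<close>, and the bound is
  reached as \<open>l\<close> tends to 0.\<close>

lemma optimise_parameter:
  fixes X c y s :: real
  assumes "\<And>l. 0 < l \<Longrightarrow> X \<le> (c + l) * y\<^sup>2 + s\<^sup>2 / l" "0 < y" "0 \<le> s"
  shows "X \<le> c * y\<^sup>2 + 2 * s * y"
proof (cases "s = 0")
  case True
  have "X \<le> c * y\<^sup>2 + e" if "0 < e" for e
    using assms(1)[of "e / y\<^sup>2"] that assms(2) True by (simp add: distrib_right)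
  then show ?thesis using True by (simp add: field_le_epsilon)
next
  case False
  then have "0 < s" using assms(3) by simp
  then have "X \<le> (c + s / y) * y\<^sup>2 + s\<^sup>2 / (s / y)" using assms(1)[of "s / y"] assms(2) by simp
  also have "\<dots> = c * y\<^sup>2 + 2 * s * y"
    using \<open>0 < s\<close> assms(2) by (simp add: distrib_right power2_eq_square)
  finally show ?thesis .
qed

text \<open>The premise for all \<open>l\<close> encodes the inequality
  \<open>E' t \<le> c * E t + 2 * r * \<Phi> t * sqrt (E t)\<close>, which is linear in the square
  root of the energy and thus leads to the time integral of \<open>\<Phi>\<close> itself, not of its
  square. The square root need not be differentiable where \<open>E\<close> vanishes, so
  \<open>E + d\<close> with \<open>d > 0\<close> is used. With \<open>y\<close> its root,
  \<open>exp (- c * t) * y t\<close> minus \<open>r\<close> times the integral of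
  \<open>\<Phi>\<close> is nonincreasing.\<close>

lemma gronwall_sqrt:
  fixes E E' \<Phi> :: "real \<Rightarrow> real"
  assumes T: "0 \<le> T" and E: "\<And>t. t \<in> {0..T} \<Longrightarrow> (E has_real_derivative E' t) (at t within {0..T})"
    and E0: "E 0 = 0" and Epos: "\<And>t. t \<in> {0..T} \<Longrightarrow> 0 \<le> E t"
    and \<Phi>: "continuous_on {0..T} \<Phi>" "\<And>t. t \<in> {0..T} \<Longrightarrow> 0 \<le> \<Phi> t"
    and c: "0 \<le> c" "0 \<le> r"
    and le: "\<And>t l. t \<in> {0..T} \<Longrightarrow> 0 < l \<Longrightarrow> E' t \<le> (c + l) * E t + r\<^sup>2 / l * (\<Phi> t)\<^sup>2"
  shows "sqrt (E T) \<le> exp (c * T) * (r * integral {0..T} \<Phi>)"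
proof (cases "T = 0")
  case True
  then show ?thesis using E0 by simp
next
  case False
  then have T: "0 < T" using T by simp
  have est: "sqrt (E T + d) \<le> exp (c * T) * (r * integral {0..T} \<Phi>) + exp (c * T) * sqrt d" if d: "0 < d" for d
  proof -
    define y where "y t = sqrt (E t + d)" for t
    have y: "0 < y t" "(y t)\<^sup>2 = E t + d" "sqrt d \<le> y t" if "t \<in> {0..T}" for t
      using Epos[OF that] d by (auto simp: y_def add_nonneg_pos)
    have yd: "(y has_real_derivative E' t / (2 * y t)) (at t within {0..T})" if "t \<in> {0..T}" for t
    proof -
      have "(y has_real_derivative inverse (sqrt (E t + d)) / 2 * E' t) (at t within {0..T})"
        unfolding y_def
        by (rule DERIV_chain2[OF DERIV_real_sqrt]) (use Epos[OF that] d E[OF that] in \<open>auto intro!: derivative_eq_intros\<close>)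
      then show ?thesis by (simp add: y_def field_simps)
    qed
    have yle: "E' t / (2 * y t) \<le> c * y t + r * \<Phi> t" if t: "t \<in> {0..T}" for t
    proof -
      have "E' t \<le> c * (y t)\<^sup>2 + 2 * (r * \<Phi> t) * y t"
      proof (rule optimise_parameter)
        fix l :: real assume l: "0 < l"
        have "(c + l) * E t \<le> (c + l) * (y t)\<^sup>2" using l c d y(2)[OF t] by (intro mult_left_mono) auto
        then show "E' t \<le> (c + l) * (y t)\<^sup>2 + (r * \<Phi> t)\<^sup>2 / l"
          using le[OF t l] by (simp add: power_mult_distrib)
      qed (use y(1)[OF t] c \<Phi>(2)[OF t] in auto)
      also have "c * (y t)\<^sup>2 + 2 * (r * \<Phi> t) * y t \<le> (c * y t + r * \<Phi> t) * (2 * y t)"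
        using y(1)[OF t] c by (simp add: power2_eq_square algebra_simps)
      finally show ?thesis using y(1)[OF t] by (simp add: divide_le_eq)
    qed
    define z where "z t = exp (- c * t) * y t - r * integral {0..t} \<Phi>" for t
    define z' where "z' t = exp (- c * t) * (E' t / (2 * y t)) + - c * exp (- c * t) * y t - r * \<Phi> t" for t
    have zd: "(z has_real_derivative z' t) (at t within {0..T})" if t: "t \<in> {0..T}" for t
    proof -
      have e: "((\<lambda>t. exp (- c * t)) has_real_derivative - c * exp (- c * t)) (at t within {0..T})"
        by (auto intro!: derivative_eq_intros)
      show ?thesis
        unfolding z_def z'_def
        using DERIV_diff[OF DERIV_mult[OF e yd[OF t]] DERIV_cmult[OF integral_has_real_derivative[OF \<Phi>(1) t], of r]]
        by (simp add: algebra_simps)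
    qed
    have z'le: "z' t \<le> 0" if t: "t \<in> {0..T}" for t
    proof -
      have "exp (- c * t) * (E' t / (2 * y t)) \<le> exp (- c * t) * (c * y t + r * \<Phi> t)"
        by (intro mult_left_mono yle t) auto
      moreover have "exp (- c * t) * (r * \<Phi> t) \<le> 1 * (r * \<Phi> t)"
        using c t \<Phi>(2)[OF t] by (intro mult_right_mono) auto
      ultimately show ?thesis by (simp add: z'_def algebra_simps)
    qed
    have "\<exists>x\<in>{0<..<T}. z T - z 0 = z' x * (T - 0)"
      using mvt_simple[OF T, of z "\<lambda>t h. z' t * h"] zd by (auto simp: has_field_derivative_def)
    then obtain x where "x \<in> {0<..<T}" "z T - z 0 = z' x * T" by auto
    then have "z T \<le> z 0" using z'le[of x] T mult_nonpos_nonneg[of "z' x" T] by simp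
    then have "exp (- c * T) * y T \<le> r * integral {0..T} \<Phi> + sqrt d"
      by (simp add: z_def y_def E0)
    then have "exp (c * T) * (exp (- c * T) * y T) \<le> exp (c * T) * (r * integral {0..T} \<Phi> + sqrt d)"
      by (intro mult_left_mono) auto
    moreover have "exp (c * T) * (exp (- c * T) * y T) = y T"
      by (simp add: exp_minus)
    ultimately have "y T \<le> exp (c * T) * (r * integral {0..T} \<Phi> + sqrt d)" by (simp only:)
    then show ?thesis by (simp only: y_def distrib_left)
  qed
  have *: "sqrt (E T) \<le> exp (c * T) * (r * integral {0..T} \<Phi>) + exp (c * T) * sqrt d" if "0 < d" for d
    by (rule order_trans[OF real_sqrt_le_mono est[OF that]]) (use that in simp)
  show ?thesis
  proof (rule field_le_epsilon)
    fix e :: real assume "0 < e"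
    then show "sqrt (E T) \<le> exp (c * T) * (r * integral {0..T} \<Phi>) + e"
      \<comment> \<open>The value of \<open>d\<close> for which the error
        \<open>exp (c * T) * sqrt d\<close> is exactly \<open>e\<close>.\<close>
      using *[of "(e / exp (c * T))\<^sup>2"] by simp
  qed
qed

lemma words_Suc: "words (Suc k) = insert [] (\<Union>l\<in>words k. (\<lambda>i. i # l) ` UNIV)"
proof -
  have "w \<in> insert [] (\<Union>l\<in>words k. (\<lambda>i. i # l) ` UNIV)" if "w \<in> words (Suc k)" for w
    using that by (cases w) (auto simp: words_def)
  then show ?thesis by (auto simp: words_def)
qed

lemma sum_words_Suc:
  fixes f :: "3 list \<Rightarrow> real"
  shows "(\<Sum>w\<in>words (Suc k). f w) = f [] + (\<Sum>l\<in>words k. \<Sum>i\<in>UNIV. f (i # l))"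
proof -
  have "(\<Sum>w\<in>(\<Union>l\<in>words k. (\<lambda>i. i # l) ` (UNIV :: 3 set)). f w) = (\<Sum>l\<in>words k. \<Sum>w\<in>(\<lambda>i. i # l) ` UNIV. f w)"
    by (rule sum.UNION_disjoint) auto
  also have "\<dots> = (\<Sum>l\<in>words k. \<Sum>i\<in>UNIV. f (i # l))"
    by (intro sum.cong refl sum.reindex[unfolded o_def]) (auto simp: inj_on_def)
  finally show ?thesis unfolding words_Suc by (subst sum.insert) auto
qed

text \<open>The weight \<open>inverse (a x)\<close> makes the principal terms of the time derivative
  a divergence. The undifferentiated square \<open>(Dw l (u t) x)\<^sup>2\<close> is added so that
  the energy controls the function as well as its gradient, hence all words of length up to
  \<open>k + 1\<close>.\<close>

definition energy_density :: "nat \<Rightarrow> (R3 \<Rightarrow> real) \<Rightarrow> (real \<Rightarrow> R3 \<Rightarrow> real) \<Rightarrow> real \<Rightarrow> R3 \<Rightarrow> real" where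
  "energy_density k a u t x = (\<Sum>l\<in>words k. inverse (a x) * (Dw l (Dt u t) x)\<^sup>2 +
     ((\<Sum>i\<in>UNIV. (Dw (i # l) (u t) x)\<^sup>2) + (Dw l (u t) x)\<^sup>2))"

definition source_density :: "nat \<Rightarrow> (real \<Rightarrow> R3 \<Rightarrow> real) \<Rightarrow> real \<Rightarrow> R3 \<Rightarrow> real" where
  "source_density k F t x = (\<Sum>l\<in>words k. (Dw l (F t) x)\<^sup>2)"

lemma smooth_energy_density:
  assumes "smooth_spacetime u" "smooth_on UNIV a" "\<And>x. a x \<noteq> 0"
  shows "smooth_spacetime (energy_density k a u)"
  unfolding energy_density_def[abs_def] power2_eq_square
  by (intro smooth_intros smooth_spacetime_Dw smooth_on_inverse assms rich_UNIV)

lemma smooth_source_density: "smooth_spacetime F \<Longrightarrow> smooth_spacetime (source_density k F)"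
  unfolding source_density_def[abs_def] power2_eq_square by (intro smooth_intros smooth_spacetime_Dw)

lemma cone_energy_density: "cone B u \<Longrightarrow> cone B (energy_density k a u)"
  unfolding energy_density_def[abs_def] power2_eq_square by (intro cone_sum cone_add cone_mult cone_Dw cone_Dt)

lemma cone_source_density: "cone B F \<Longrightarrow> cone B (source_density k F)"
  unfolding source_density_def[abs_def] power2_eq_square by (intro cone_sum cone_mult cone_Dw)

lemma source_density_nonneg: "0 \<le> source_density k F t x"
  by (simp add: source_density_def sum_nonneg)

lemma energy_density_nonneg: "(\<And>x. 0 < a x) \<Longrightarrow> 0 \<le> energy_density k a u t x"
  unfolding energy_density_def by (intro sum_nonneg add_nonneg_nonneg mult_nonneg_nonneg) (auto intro: less_imp_le)

lemma sum_words_le_energy: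
  assumes "\<And>x. 0 < a x"
  shows "(\<Sum>w\<in>words (Suc k). (Dw w (u t) x)\<^sup>2) \<le> energy_density k a u t x"
proof -
  have "[] \<in> words k" by (simp add: words_def)
  then have 1: "(Dw [] (u t) x)\<^sup>2 \<le> (\<Sum>l\<in>words k. (Dw l (u t) x)\<^sup>2)"
    by (rule member_le_sum) auto
  have "0 \<le> (\<Sum>l\<in>words k. inverse (a x) * (Dw l (Dt u t) x)\<^sup>2)"
    using assms[of x] by (intro sum_nonneg mult_nonneg_nonneg) auto
  then show ?thesis
    using 1 unfolding energy_density_def sum_words_Suc sum.distrib by linarith
qed

lemma Dt_energy_density:
  assumes u: "smooth_spacetime u" and t: "0 \<le> t"
  shows "Dt (energy_density k a u) t x = (\<Sum>l\<in>words k. 2 * (inverse (a x) * (Dw l (Dt u t) x * Dw l (Dt (Dt u) t) x)) +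
     ((\<Sum>i\<in>UNIV. 2 * (Dw (i # l) (u t) x * Dw (i # l) (Dt u t) x)) + 2 * (Dw l (u t) x * Dw l (Dt u t) x)))"
  unfolding Dt_def[of "energy_density k a u"]
proof (rule time_deriv_eqI[OF _ t])
  have sq: "((\<lambda>t. (f t)\<^sup>2) has_real_derivative 2 * (f t * f')) (at t within {0..})"
    if "(f has_real_derivative f') (at t within {0..})" for f f'
    by (rule derivative_eq_intros that)+ simp
  show "((\<lambda>t. energy_density k a u t x) has_real_derivative (\<Sum>l\<in>words k. 2 * (inverse (a x) * (Dw l (Dt u t) x * Dw l (Dt (Dt u) t) x)) +
     ((\<Sum>i\<in>UNIV. 2 * (Dw (i # l) (u t) x * Dw (i # l) (Dt u t) x)) + 2 * (Dw l (u t) x * Dw l (Dt u t) x)))) (at t within {0..})"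
    unfolding energy_density_def
  proof (intro DERIV_sum DERIV_add sq Dw_has_derivative u t)
    show "((\<lambda>t. inverse (a x) * (Dw l (Dt u t) x)\<^sup>2) has_real_derivative
        2 * (inverse (a x) * (Dw l (Dt u t) x * Dw l (Dt (Dt u) t) x))) (at t within {0..})" for l
      using DERIV_cmult[OF sq[OF Dw_has_derivative[OF smooth_spacetime_Dt[OF u] t]], of "inverse (a x)" l x]
      by (simp add: mult_ac)
  qed
qed

text \<open>Up to a divergence, which integrates to 0, the time derivative of the density contains
  only velocities times commutators, sources and lower-order terms. Young's inequality bounds it
  pointwise: in \<open>c\<close>, the summand with \<open>K\<close> collects the commutators over
  all words of \<open>words k\<close>, and \<open>a2\<close> converts a squared velocity into its
  weighted form. The free parameter \<open>r\<close> belongs to the source term and stays open for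
  the Gronwall argument.\<close>

lemma energy_derivative_bound:
  assumes u: "smooth_spacetime u" "cone B u" and F: "smooth_spacetime F" "cone B F" and t: "0 \<le> t"
    and a: "smooth_on UNIV a" "\<And>x. 0 < a x" "\<And>x. inverse (a x) \<le> a1" "\<And>x. a x \<le> a2" and K: "0 \<le> K"
    and eqn: "\<And>l x. l \<in> words k \<Longrightarrow> \<bar>Dw l (Dt (Dt u) t) x - a x * lap (Dw l (u t)) x - Dw l (F t) x\<bar> \<le>
        K * sqrt (\<Sum>w\<in>words (Suc k). (Dw w (u t) x)\<^sup>2)"
    and r: "0 < r"
  defines "c \<equiv> 2 + real (card (words k)) * (a1 * K\<^sup>2) + a2"
  shows "(LINT x|lborel. Dt (energy_density k a u) t x) \<le>
    (c + r) * (LINT x|lborel. energy_density k a u t x) + a1 / r * (LINT x|lborel. source_density k F t x)"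
proof -
  have an: "a x \<noteq> 0" for x using a(2)[of x] by simp
  let ?v = "\<lambda>l. Dw l (u t)" and ?vt = "\<lambda>l. Dw l (Dt u t)" and ?vtt = "\<lambda>l. Dw l (Dt (Dt u) t)"
  let ?N = "energy_density k a u" and ?D = "\<lambda>x. (\<Sum>l\<in>words k. \<Sum>i\<in>UNIV. 2 * partial i (\<lambda>x. partial i (?v l) x * ?vt l x) x)"
  have sm: "smooth_on UNIV (?v l)" "smooth_on UNIV (?vt l)" for l
    by (intro smooth_on_Dw smooth_spacetime_slice smooth_intros u t)+
  have smp: "smooth_on UNIV (\<lambda>x. partial i (?v l) x * ?vt l x)" for i l
    by (intro smooth_on_mult smooth_on_partial sm) simp
  have van: "partial i (?v l) x * ?vt l x = 0" if "B + t < norm x" for i l x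
    using coneD[OF cone_Dw[OF cone_Dt[OF u(2)]] t that, of l] by simp
  have intp: "integrable lborel (\<lambda>x. partial i (\<lambda>x. partial i (?v l) x * ?vt l x) x)" for i l
  proof (rule integral_ball_support(1)[where B = "B + t"])
    show "continuous_on UNIV (\<lambda>x. partial i (\<lambda>x. partial i (?v l) x * ?vt l x) x)"
      by (intro smooth_on_imp_continuous_on smooth_on_partial smp)
    show "partial i (\<lambda>x. partial i (?v l) x * ?vt l x) x = 0" if "B + t < norm x" for x
      by (rule partial_zero_outside_cball[OF van that])
  qed
  have D0: "(LINT x|lborel. ?D x) = 0"
    by (subst Bochner_Integration.integral_sum, intro Bochner_Integration.integrable_sum integrable_mult_right intp,
        subst Bochner_Integration.integral_sum, intro integrable_mult_right intp)
      (simp add: integral_partial_smooth[OF smp van])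
  have intD: "integrable lborel ?D"
    by (intro Bochner_Integration.integrable_sum integrable_mult_right intp)
  have intN: "integrable lborel (?N t)" "integrable lborel (Dt ?N t)"
    by (rule cone_integrable[where B = B]; intro smooth_energy_density smooth_intros u a an cone_energy_density cone_Dt t)+
  have intS: "integrable lborel (source_density k F t)"
    by (rule cone_integrable[OF smooth_source_density[OF F(1)] cone_source_density[OF F(2)] t])
  have pt: "Dt ?N t x - ?D x \<le> (c + r) * ?N t x + a1 / r * source_density k F t x" for x
  proof -
    let ?q = "\<lambda>l. ?vtt l x - a x * lap (?v l) x - Dw l (F t) x"
    let ?M = "\<Sum>w\<in>words (Suc k). (Dw w (u t) x)\<^sup>2"
    have M: "0 \<le> ?M" "?M \<le> ?N t x" using sum_words_le_energy[OF a(2)] by (auto intro: sum_nonneg)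
    \<comment> \<open>Subtracting this divergence removes the products of gradients from the time
      derivative of the density and leaves \<open>- 2 * (lap (?v l) x * ?vt l x)\<close> in their
      place.\<close>
    have D: "(\<Sum>i\<in>UNIV. 2 * partial i (\<lambda>x. partial i (?v l) x * ?vt l x) x) =
        2 * (lap (?v l) x * ?vt l x) + (\<Sum>i\<in>UNIV. 2 * (Dw (i # l) (u t) x * Dw (i # l) (Dt u t) x))" for l
      by (subst partial_mult) (auto intro!: smooth_on_differentiable smooth_on_partial sm
          simp: lap_def sum_distrib_right sum_distrib_left sum.distrib algebra_simps)
    have "Dt ?N t x - ?D x = (\<Sum>l\<in>words k. 2 * (inverse (a x) * (?vt l x * ?vtt l x)) + 2 * (?v l x * ?vt l x) - 2 * (lap (?v l) x * ?vt l x))"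
      unfolding Dt_energy_density[OF u(1) t] D by (simp add: sum_subtractf[symmetric] algebra_simps)
    also have "\<dots> \<le> (\<Sum>l\<in>words k. (2 + a2 + r) * (inverse (a x) * (?vt l x)\<^sup>2) + (?v l x)\<^sup>2 + a1 * K\<^sup>2 * ?M + a1 / r * (Dw l (F t) x)\<^sup>2)"
    proof (rule sum_mono)
      fix l assume l: "l \<in> words k"
      let ?i = "inverse (a x)"
      have i: "0 < ?i" "?i \<le> a1" "?i * a x = 1" using a(2)[of x] a(3)[of x] by auto
      \<comment> \<open>Here the weight acts: \<open>inverse (a x)\<close> times the principal part
        \<open>a x * lap (?v l) x\<close> of the equation cancels the Laplacian term, leaving the
        commutator and the source.\<close>
      have split: "2 * (?i * (?vt l x * ?vtt l x)) - 2 * (lap (?v l) x * ?vt l x) = ?i * (2 * ?vt l x * ?q l) + ?i * (2 * ?vt l x * Dw l (F t) x)"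
        using an[of x] by (simp add: field_simps)
      have sq: "2 * p * q \<le> p\<^sup>2 + q\<^sup>2" for p q :: real
        using zero_le_power2[of "p - q"] by (simp add: power2_diff)
      have sqr: "2 * p * q \<le> r * p\<^sup>2 + q\<^sup>2 / r" for p q :: real
      proof -
        have "0 \<le> (r * p - q)\<^sup>2 / r" using r by simp
        then show ?thesis using r by (simp add: power2_diff field_simps power2_eq_square)
      qed
      have "(?q l)\<^sup>2 \<le> (K * sqrt ?M)\<^sup>2"
        using eqn[OF l, of x] by (metis abs_ge_zero power2_abs power_mono)
      then have q2: "(?q l)\<^sup>2 \<le> K\<^sup>2 * ?M" using M(1) by (simp add: power_mult_distrib)
      have "?i * (2 * ?vt l x * ?q l) \<le> ?i * ((?vt l x)\<^sup>2 + K\<^sup>2 * ?M)"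
        using sq[of "?vt l x" "?q l"] q2 i(1) by (intro mult_left_mono) auto
      also have "\<dots> \<le> ?i * (?vt l x)\<^sup>2 + a1 * (K\<^sup>2 * ?M)"
        using mult_right_mono[OF i(2), of "K\<^sup>2 * ?M"] M(1) by (simp add: distrib_left)
      finally have 1: "?i * (2 * ?vt l x * ?q l) \<le> ?i * (?vt l x)\<^sup>2 + a1 * (K\<^sup>2 * ?M)" .
      have "?i * (2 * ?vt l x * Dw l (F t) x) \<le> ?i * (r * (?vt l x)\<^sup>2 + (Dw l (F t) x)\<^sup>2 / r)"
        using sqr i(1) by (intro mult_left_mono) auto
      also have "\<dots> \<le> r * (?i * (?vt l x)\<^sup>2) + a1 * ((Dw l (F t) x)\<^sup>2 / r)"
        using mult_right_mono[OF i(2), of "(Dw l (F t) x)\<^sup>2 / r"] r by (simp add: distrib_left mult_ac)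
      finally have 2: "?i * (2 * ?vt l x * Dw l (F t) x) \<le> r * (?i * (?vt l x)\<^sup>2) + a1 / r * (Dw l (F t) x)\<^sup>2" by simp
      have "(?vt l x)\<^sup>2 = a x * (?i * (?vt l x)\<^sup>2)" using an[of x] by simp
      also have "\<dots> \<le> a2 * (?i * (?vt l x)\<^sup>2)" using a(4)[of x] i(1) by (intro mult_right_mono) auto
      finally have 3: "2 * (?v l x * ?vt l x) \<le> (?v l x)\<^sup>2 + a2 * (?i * (?vt l x)\<^sup>2)"
        using sq[of "?v l x" "?vt l x"] by simp
      have 4: "0 \<le> ?i * (?vt l x)\<^sup>2" using i(1) by simp
      show "2 * (?i * (?vt l x * ?vtt l x)) + 2 * (?v l x * ?vt l x) - 2 * (lap (?v l) x * ?vt l x) \<le>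
        (2 + a2 + r) * (?i * (?vt l x)\<^sup>2) + (?v l x)\<^sup>2 + a1 * K\<^sup>2 * ?M + a1 / r * (Dw l (F t) x)\<^sup>2"
        using 1 2 3 4 split unfolding distrib_right by (simp add: mult.assoc)
    qed
    also have "\<dots> \<le> (2 + a2 + r) * ?N t x + real (card (words k)) * (a1 * K\<^sup>2 * ?M) + a1 / r * source_density k F t x"
    proof -
      have r2: "1 \<le> 2 + a2 + r" using a(2)[of x] a(4)[of x] r by linarith
      have "(\<Sum>l\<in>words k. (2 + a2 + r) * (inverse (a x) * (?vt l x)\<^sup>2) + (?v l x)\<^sup>2) \<le> (2 + a2 + r) * ?N t x"
        unfolding energy_density_def sum_distrib_left
      proof (rule sum_mono)
        fix l
        have "1 * (?v l x)\<^sup>2 \<le> (2 + a2 + r) * ((\<Sum>i\<in>UNIV. (Dw (i # l) (u t) x)\<^sup>2) + (?v l x)\<^sup>2)"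
          using r2 by (intro mult_mono) (auto intro: sum_nonneg)
        then show "(2 + a2 + r) * (inverse (a x) * (?vt l x)\<^sup>2) + (?v l x)\<^sup>2
          \<le> (2 + a2 + r) * (inverse (a x) * (?vt l x)\<^sup>2 + ((\<Sum>i\<in>UNIV. (Dw (i # l) (u t) x)\<^sup>2) + (?v l x)\<^sup>2))"
          by (simp add: distrib_left)
      qed
      then show ?thesis
        by (simp add: sum.distrib source_density_def sum_distrib_left)
    qed
    also have "\<dots> \<le> (c + r) * ?N t x + a1 / r * source_density k F t x"
    proof -
      have "0 \<le> a1" using a(2,3)[of x] by (meson inverse_positive_iff_positive less_imp_le order_trans)
      then have "real (card (words k)) * (a1 * K\<^sup>2 * ?M) \<le> real (card (words k)) * (a1 * K\<^sup>2 * ?N t x)"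
        using M by (intro mult_left_mono) auto
      then show ?thesis by (simp add: c_def algebra_simps)
    qed
    finally show ?thesis .
  qed
  have "(LINT x|lborel. Dt ?N t x) = (LINT x|lborel. Dt ?N t x - ?D x)"
    using D0 intD intN by simp
  also have "\<dots> \<le> (LINT x|lborel. (c + r) * ?N t x + a1 / r * source_density k F t x)"
    by (rule integral_mono) (use pt intD intN intS in auto)
  also have "\<dots> = (c + r) * (LINT x|lborel. ?N t x) + a1 / r * (LINT x|lborel. source_density k F t x)"
    using intN intS by simp
  finally show ?thesis .
qed

lemma energy_estimate:
  assumes u: "smooth_spacetime u" "cone B u" and F: "smooth_spacetime F" "cone B F"
    and 0: "\<And>x. u 0 x = 0" "\<And>x. Dt u 0 x = 0"
    and a: "smooth_on UNIV a" "\<And>x. 0 < a x" "\<And>x. inverse (a x) \<le> a1" "\<And>x. a x \<le> a2" and K: "0 \<le> K"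
    and eqn: "\<And>l t x. l \<in> words k \<Longrightarrow> 0 \<le> t \<Longrightarrow> \<bar>Dw l (Dt (Dt u) t) x - a x * lap (Dw l (u t)) x - Dw l (F t) x\<bar> \<le>
        K * sqrt (\<Sum>w\<in>words (Suc k). (Dw w (u t) x)\<^sup>2)"
    and T: "0 \<le> T"
  defines "c \<equiv> 2 + real (card (words k)) * (a1 * K\<^sup>2) + a2"
  shows "sqrt (LINT x|lborel. energy_density k a u T x) \<le>
    exp (c * T) * (sqrt a1 * integral {0..T} (\<lambda>t. sqrt (LINT x|lborel. source_density k F t x)))"
proof (rule gronwall_sqrt[OF T])
  have an: "a x \<noteq> 0" for x using a(2)[of x] by simp
  have a12: "0 \<le> a1" "0 \<le> a2" using a(2,3,4)[of 0] by (auto intro: order_trans[OF less_imp_le])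
    (meson inverse_positive_iff_positive less_imp_le order_trans)
  show "((\<lambda>t. LINT x|lborel. energy_density k a u t x) has_real_derivative
      (LINT x|lborel. Dt (energy_density k a u) t x)) (at t within {0..T})" if "t \<in> {0..T}" for t
    by (rule integral_time_derivative[OF smooth_energy_density[OF u(1) a(1) an] cone_energy_density[OF u(2)] that])
  have "u 0 = (\<lambda>x. 0)" "Dt u 0 = (\<lambda>x. 0)" using 0 by auto
  then have "energy_density k a u 0 x = 0" for x
    unfolding energy_density_def by (simp add: Dw_const del: Dw_simps(2))
  then show "(LINT x|lborel. energy_density k a u 0 x) = 0" by simp
  show "0 \<le> (LINT x|lborel. energy_density k a u t x)" for t
    by (rule Bochner_Integration.integral_nonneg) (rule energy_density_nonneg[OF a(2)])
  have "continuous_on {0..T} (\<lambda>t. LINT x|lborel. source_density k F t x)"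
    by (rule DERIV_continuous_on) (rule integral_time_derivative[OF smooth_source_density[OF F(1)] cone_source_density[OF F(2)]])
  then show "continuous_on {0..T} (\<lambda>t. sqrt (LINT x|lborel. source_density k F t x))"
    by (rule continuous_on_real_sqrt)
  have S: "0 \<le> (LINT x|lborel. source_density k F t x)" for t
    by (rule Bochner_Integration.integral_nonneg) (rule source_density_nonneg)
  then show "0 \<le> sqrt (LINT x|lborel. source_density k F t x)" for t by simp
  show "0 \<le> c" unfolding c_def using a12 by simp
  show "0 \<le> sqrt a1" using a12 by simp
  show "(LINT x|lborel. Dt (energy_density k a u) t x) \<le>
     (c + r) * (LINT x|lborel. energy_density k a u t x) + (sqrt a1)\<^sup>2 / r * (sqrt (LINT x|lborel. source_density k F t x))\<^sup>2"
    if "t \<in> {0..T}" "0 < r" for t r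
    using energy_derivative_bound[OF u F _ a K eqn that(2), of t] that(1) a12 S[of t] by (simp add: c_def)
qed

section \<open>Sobolev norms of smooth compactly supported functions\<close>

text \<open>The sorted word of a multiindex, in the order in which \<open>partials\<close> applies
  its derivatives.\<close>

definition word :: "nat ^ 3 \<Rightarrow> 3 list" where
  "word \<beta> = replicate (\<beta> $ 1) 1 @ replicate (\<beta> $ 2) 2 @ replicate (\<beta> $ 3) 3"

lemma Dw_append: "Dw (u @ v) f = Dw u (Dw v f)"
  by (simp add: Dw_def)

lemma Dw_replicate: "Dw (replicate n i) f = (partial i ^^ n) f"
  by (induction n) auto

lemma partials_eq_Dw: "partials \<beta> f = Dw (word \<beta>) f"
  by (simp add: partials_def word_def Dw_append Dw_replicate)

lemma length_word: "length (word \<beta>) = order_of \<beta>"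
  by (simp add: word_def order_of_def sum_3)

lemma count_word: "count (mset (word \<beta>)) i = \<beta> $ i"
  using exhaust_3[of i] by (auto simp: word_def)

lemma inj_word: "inj_on word X"
proof (rule inj_onI)
  fix a b assume "word a = word b"
  then have "a $ i = b $ i" for i using count_word by metis
  then show "a = b" by (simp add: vec_eq_iff)
qed

lemma finite_multiindices: "finite {\<beta>. order_of \<beta> \<le> k}"
proof (rule finite_imageD[OF finite_subset inj_word])
  show "word ` {\<beta>. order_of \<beta> \<le> k} \<subseteq> words k" by (auto simp: words_def length_word)
qed simp

lemma Dw_middle: "smooth_on UNIV f \<Longrightarrow> Dw (u @ i # v) f = Dw (i # u @ v) f"
  by (simp add: Dw_append Dw_partial smooth_on_Dw)

text \<open>Partial derivatives commute, so a letter can be moved to the front of a word and only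
  the multiset of letters matters. Every word is thereby equivalent to the sorted word of a
  multiindex.\<close>

lemma Dw_mset: "smooth_on UNIV f \<Longrightarrow> mset l = mset l' \<Longrightarrow> Dw l f = Dw l' f"
proof (induction l arbitrary: l')
  case (Cons i l)
  then have "i \<in> set l'" by (metis list.set_intros(1) set_mset_mset)
  then obtain u v where l': "l' = u @ i # v" by (meson split_list)
  then have "Dw l f = Dw (u @ v) f" using Cons by (intro Cons.IH) auto
  then show ?case unfolding l' Dw_middle[OF Cons.prems(1)] by simp
qed simp

lemma word_representation:
  obtains \<beta> where "order_of \<beta> = length l" "\<And>f. smooth_on UNIV f \<Longrightarrow> partials \<beta> f = Dw l f"
proof
  define \<beta> :: "nat ^ 3" where "\<beta> = (\<chi> i. count (mset l) i)"
  have m: "mset (word \<beta>) = mset l" by (rule multiset_eqI) (simp only: count_word, simp add: \<beta>_def)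
  show "order_of \<beta> = length l" using arg_cong[OF m, of size] by (simp add: length_word)
  show "partials \<beta> f = Dw l f" if "smooth_on UNIV f" for f
    unfolding partials_eq_Dw by (rule Dw_mset[OF that m])
qed

lemma integral_by_parts:
  assumes f: "smooth_on UNIV f" "\<And>x. B < norm x \<Longrightarrow> f x = 0" and g: "smooth_on UNIV g"
  shows "(LINT x|lborel. f x * partial i g x) = - (LINT x|lborel. partial i f x * g x)"
proof -
  have d: "f differentiable (at x)" "g differentiable (at x)" for x
    by (intro smooth_on_differentiable f g)+
  have f0: "partial i f x = 0" if "B < norm x" for x
    by (rule partial_zero_outside_cball[OF f(2) that])
  have c: "continuous_on UNIV f" "continuous_on UNIV g" "continuous_on UNIV (partial i f)" "continuous_on UNIV (partial i g)"
    by (intro smooth_on_imp_continuous_on smooth_on_partial f g)+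
  have int: "integrable lborel (\<lambda>x. partial i f x * g x)" "integrable lborel (\<lambda>x. f x * partial i g x)"
    by (rule integral_ball_support(1)[where B = B]; use f f0 c in \<open>auto intro!: continuous_on_mult\<close>)+
  have "0 = (LINT x|lborel. partial i (\<lambda>x. f x * g x) x)"
    by (rule integral_partial_smooth[symmetric, where B = B]) (use f in \<open>auto intro: smooth_on_mult f g\<close>)
  also have "\<dots> = (LINT x|lborel. partial i f x * g x + f x * partial i g x)"
    by (simp add: partial_mult d)
  finally show ?thesis using int by simp
qed

lemma integral_Dw_by_parts:
  assumes "smooth_on UNIV f" "\<And>x. B < norm x \<Longrightarrow> f x = 0" and g: "smooth_on UNIV g"
  shows "(LINT x|lborel. f x * Dw w g x) = (-1) ^ length w * (LINT x|lborel. Dw w f x * g x)"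
  using assms(1,2)
proof (induction w arbitrary: f)
  case (Cons i w)
  have f0: "partial i f x = 0" if "B < norm x" for x
    by (rule partial_zero_outside_cball[OF Cons.prems(2) that])
  have "(LINT x|lborel. f x * Dw (i # w) g x) = - (LINT x|lborel. partial i f x * Dw w g x)"
    using integral_by_parts[OF Cons.prems smooth_on_Dw[OF g]] by simp
  also have "\<dots> = - ((-1) ^ length w * (LINT x|lborel. Dw w (partial i f) x * g x))"
    by (subst Cons.IH[OF smooth_on_partial[OF Cons.prems(1)] f0]) auto
  finally show ?case by (simp add: Dw_partial[OF Cons.prems(1)])
qed simp

lemma lebesgue_integral_continuous:
  "continuous_on UNIV f \<Longrightarrow> (LINT x|lebesgue. f x) = (LINT x|lborel. (f x :: real))"
  for f :: "R3 \<Rightarrow> real"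
  by (simp add: integral_completion borel_measurable_continuous_onI)

lemma lebesgue_integrable_continuous:
  "continuous_on UNIV f \<Longrightarrow> integrable lebesgue f \<longleftrightarrow> integrable lborel (f :: R3 \<Rightarrow> real)"
  by (simp add: integrable_completion borel_measurable_continuous_onI)

lemma continuous_locally_integrable:
  assumes "continuous_on UNIV f" shows "locally_integrable f"
  unfolding locally_integrable_def
proof
  fix R
  have "integrable lborel (\<lambda>x. indicator (cball 0 R) x *\<^sub>R f x)"
    by (rule borel_integrable_compact) (auto intro: continuous_on_subset[OF assms])
  then show "set_integrable lebesgue (cball 0 R) f"
    unfolding set_integrable_def
    by (subst integrable_completion) (auto dest: borel_measurable_integrable)
qed

lemma weak_partials_smooth:
  assumes f: "smooth_on UNIV f" "\<And>x. B < norm x \<Longrightarrow> f x = 0"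
  shows "weak_partials \<beta> f (partials \<beta> f)"
  unfolding weak_partials_def
proof (intro conjI allI impI)
  show "locally_integrable f" "locally_integrable (partials \<beta> f)"
    unfolding partials_eq_Dw by (intro continuous_locally_integrable smooth_on_imp_continuous_on smooth_on_Dw f)+
  fix \<phi> assume "test_function \<phi>"
  then have \<phi>: "smooth_on UNIV \<phi>" by (simp add: test_function_def)
  have c: "continuous_on UNIV f" "continuous_on UNIV \<phi>" "continuous_on UNIV (Dw w f)" "continuous_on UNIV (Dw w \<phi>)" for w
    by (intro smooth_on_imp_continuous_on smooth_on_Dw f \<phi>)+
  show "(LINT x|lebesgue. f x * partials \<beta> \<phi> x) = (-1) ^ order_of \<beta> * (LINT x|lebesgue. partials \<beta> f x * \<phi> x)"
    unfolding partials_eq_Dw length_word[symmetric]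
    by (subst (1 2) lebesgue_integral_continuous) (intro continuous_on_mult c | rule integral_Dw_by_parts[OF f \<phi>])+
qed

lemma Dw_outside:
  assumes "\<And>x. B < norm x \<Longrightarrow> f x = 0" "B < norm x" shows "Dw w f x = 0"
  using Dw_zero_outside[of "cball 0 B" f x w] assms by auto

lemma integrable_square_Dw:
  assumes f: "smooth_on UNIV f" "\<And>x. B < norm x \<Longrightarrow> f x = 0"
  shows "integrable lborel (\<lambda>x. (Dw w f x)\<^sup>2)"
proof (rule integral_ball_support(1)[where B = B])
  show "continuous_on UNIV (\<lambda>x. (Dw w f x)\<^sup>2)"
    by (intro continuous_on_power smooth_on_imp_continuous_on smooth_on_Dw f)
  show "(Dw w f x)\<^sup>2 = 0" if "B < norm x" for x
    using Dw_outside[where f = f, OF f(2) that] by simp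
qed

text \<open>The classical derivatives are one of the families over which the infimum is taken. Words
  repeat multiindices, which only enlarges the right-hand side.\<close>

lemma sobolev_norm_le:
  assumes f: "smooth_on UNIV f" "\<And>x. B < norm x \<Longrightarrow> f x = 0"
  shows "sobolev_norm k f \<le> ennreal (sqrt (LINT x|lborel. (\<Sum>w\<in>words k. (Dw w f x)\<^sup>2)))"
proof -
  have c: "continuous_on UNIV (\<lambda>x. (Dw w f x)\<^sup>2)" for w
    by (intro continuous_on_power smooth_on_imp_continuous_on smooth_on_Dw f)
  note int = integrable_square_Dw[OF f]
  have "sobolev_norm k f \<le> ennreal (sqrt (\<Sum>\<beta> | order_of \<beta> \<le> k. LINT x|lebesgue. (partials \<beta> f x)\<^sup>2))"
    unfolding sobolev_norm_def
  proof (rule INF_lower, intro CollectI allI impI conjI weak_partials_smooth[OF f])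
    show "square_integrable (partials \<beta> f)" for \<beta>
      unfolding square_integrable_def partials_eq_Dw lebesgue_integrable_continuous[OF c]
    proof
      show "Dw (word \<beta>) f \<in> borel_measurable lebesgue"
        by (rule measurable_completion)
          (simp add: borel_measurable_continuous_onI smooth_on_imp_continuous_on smooth_on_Dw f)
    qed (rule int)
  qed
  also have "(\<Sum>\<beta> | order_of \<beta> \<le> k. LINT x|lebesgue. (partials \<beta> f x)\<^sup>2) = (\<Sum>w\<in>word ` {\<beta>. order_of \<beta> \<le> k}. LINT x|lborel. (Dw w f x)\<^sup>2)"
    unfolding partials_eq_Dw sum.reindex[OF inj_word] o_def by (intro sum.cong refl lebesgue_integral_continuous c)
  also have "ennreal (sqrt \<dots>) \<le> ennreal (sqrt (\<Sum>w\<in>words k. LINT x|lborel. (Dw w f x)\<^sup>2))"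
    by (intro ennreal_leI real_sqrt_le_mono sum_mono2 finite_words) (auto simp: words_def length_word)
  also have "(\<Sum>w\<in>words k. LINT x|lborel. (Dw w f x)\<^sup>2) = (LINT x|lborel. (\<Sum>w\<in>words k. (Dw w f x)\<^sup>2))"
    by (simp add: Bochner_Integration.integral_sum int)
  finally show ?thesis .
qed

text \<open>Testing the weak derivative \<open>v\<close> against the classical derivative \<open>g\<close> gives
  \<open>\<integral> v g = \<integral> g\<^sup>2\<close>, hence \<open>0 \<le> \<integral> (v - g)\<^sup>2 = \<integral> v\<^sup>2 - \<integral> g\<^sup>2\<close>.\<close>

lemma classical_le_weak:
  assumes f: "smooth_on UNIV f" "\<And>x. B < norm x \<Longrightarrow> f x = 0"
    and v: "weak_partials \<beta> f v" "square_integrable v"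
  shows "(LINT x|lborel. (partials \<beta> f x)\<^sup>2) \<le> (LINT x|lebesgue. (v x)\<^sup>2)"
proof -
  define g where "g = partials \<beta> f"
  have sg: "smooth_on UNIV g" unfolding g_def partials_eq_Dw by (rule smooth_on_Dw[OF f(1)])
  have g0: "g x = 0" if "B < norm x" for x
    unfolding g_def partials_eq_Dw by (rule Dw_outside[where f = f, OF f(2) that])
  have "bounded {x. g x \<noteq> 0}"
    by (rule bounded_subset[OF bounded_cball[of 0 B]]) (use g0 in force)
  then have test: "test_function g" using sg by (simp add: test_function_def)
  have "(-1) ^ order_of \<beta> * (LINT x|lebesgue. v x * g x) = (-1) ^ order_of \<beta> * (LINT x|lebesgue. g x * g x)"
  proof -
    have "weak_partials \<beta> f g" unfolding g_def by (rule weak_partials_smooth[OF f])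
    then have "(LINT x|lebesgue. f x * partials \<beta> g x) = (-1) ^ order_of \<beta> * (LINT x|lebesgue. g x * g x)"
      using test unfolding weak_partials_def by blast
    moreover have "(LINT x|lebesgue. f x * partials \<beta> g x) = (-1) ^ order_of \<beta> * (LINT x|lebesgue. v x * g x)"
      using test v(1) unfolding weak_partials_def by blast
    ultimately show ?thesis by (simp only:)
  qed
  then have eq: "(LINT x|lebesgue. v x * g x) = (LINT x|lebesgue. g x * g x)" by simp
  have cg: "continuous_on UNIV g" by (rule smooth_on_imp_continuous_on[OF sg])
  have "integrable lborel (\<lambda>x. (g x)\<^sup>2)"
    unfolding g_def partials_eq_Dw by (rule integrable_square_Dw[OF f])
  then have ig: "integrable lebesgue (\<lambda>x. (g x)\<^sup>2)"
    by (subst lebesgue_integrable_continuous) (auto intro: continuous_on_power cg)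
  have iv: "integrable lebesgue (\<lambda>x. (v x)\<^sup>2)" and mv: "v \<in> borel_measurable lebesgue"
    using v(2) by (auto simp: square_integrable_def)
  have mg: "g \<in> borel_measurable lebesgue"
    by (rule measurable_completion) (simp add: borel_measurable_continuous_onI[OF cg])
  have ivg: "integrable lebesgue (\<lambda>x. v x * g x)"
  proof (rule Bochner_Integration.integrable_bound[OF Bochner_Integration.integrable_add[OF iv ig]])
    show "(\<lambda>x. v x * g x) \<in> borel_measurable lebesgue" using mv mg by simp
    show "AE x in lebesgue. norm (v x * g x) \<le> norm ((v x)\<^sup>2 + (g x)\<^sup>2)"
    proof (rule AE_I2)
      fix x
      have "2 * (\<bar>v x\<bar> * \<bar>g x\<bar>) \<le> (v x)\<^sup>2 + (g x)\<^sup>2"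
        using zero_le_power2[of "\<bar>v x\<bar> - \<bar>g x\<bar>"] by (simp add: power2_diff)
      moreover have "0 \<le> \<bar>v x\<bar> * \<bar>g x\<bar>" by simp
      ultimately show "norm (v x * g x) \<le> norm ((v x)\<^sup>2 + (g x)\<^sup>2)"
        unfolding real_norm_def abs_mult by linarith
    qed
  qed
  have "0 \<le> (LINT x|lebesgue. (v x - g x)\<^sup>2)" by simp
  also have "\<dots> = (LINT x|lebesgue. (v x)\<^sup>2 - 2 * (v x * g x) + (g x)\<^sup>2)"
    by (intro Bochner_Integration.integral_cong refl) (simp add: power2_diff)
  also have "\<dots> = (LINT x|lebesgue. (v x)\<^sup>2) - 2 * (LINT x|lebesgue. v x * g x) + (LINT x|lebesgue. (g x)\<^sup>2)"
    using iv ig ivg by simp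
  also have "(LINT x|lebesgue. v x * g x) = (LINT x|lebesgue. (g x)\<^sup>2)" by (simp add: eq power2_eq_square)
  finally have "(LINT x|lebesgue. (g x)\<^sup>2) \<le> (LINT x|lebesgue. (v x)\<^sup>2)" by simp
  then show ?thesis
    unfolding g_def[symmetric] by (subst (asm) lebesgue_integral_continuous) (auto intro: continuous_on_power cg)
qed

lemma card_words_pos: "0 < card (words k)"
proof -
  have "[] \<in> words k" by (simp add: words_def)
  then show ?thesis by (auto simp: card_gt_0_iff)
qed

text \<open>The bound is proved for every family competing in the infimum. Each word has a
  multiindex whose weak derivative dominates the classical one in square norm, and a multiindex may
  be met by several words; estimating every word by the full sum costs the factor
  \<open>card (words k)\<close>. This direction is the one for the source term of the energy
  estimate.\<close>

lemma sobolev_norm_ge: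
  assumes f: "smooth_on UNIV f" "\<And>x. B < norm x \<Longrightarrow> f x = 0"
  shows "ennreal (sqrt (LINT x|lborel. (\<Sum>w\<in>words k. (Dw w f x)\<^sup>2)) / sqrt (card (words k))) \<le> sobolev_norm k f"
  unfolding sobolev_norm_def
proof (rule INF_greatest, rule ennreal_leI)
  fix v assume v: "v \<in> {v. \<forall>\<beta>. order_of \<beta> \<le> k \<longrightarrow> weak_partials \<beta> f (v \<beta>) \<and> square_integrable (v \<beta>)}"
  define Y where "Y = (\<Sum>\<beta> | order_of \<beta> \<le> k. LINT x|lebesgue. (v \<beta> x)\<^sup>2)"
  have "(LINT x|lborel. (Dw w f x)\<^sup>2) \<le> Y" if w: "w \<in> words k" for w
  proof -
    obtain \<beta> where \<beta>: "order_of \<beta> = length w" "partials \<beta> f = Dw w f"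
      using word_representation[of w] f(1) by metis
    then have le: "order_of \<beta> \<le> k" using w by (simp add: words_def)
    have "(LINT x|lborel. (Dw w f x)\<^sup>2) \<le> (LINT x|lebesgue. (v \<beta> x)\<^sup>2)"
      unfolding \<beta>(2)[symmetric] by (rule classical_le_weak[OF f]) (use v le in auto)
    also have "\<dots> \<le> Y"
      unfolding Y_def by (rule member_le_sum) (use le finite_multiindices in auto)
    finally show ?thesis .
  qed
  then have "(\<Sum>w\<in>words k. LINT x|lborel. (Dw w f x)\<^sup>2) \<le> real (card (words k)) * Y"
    by (rule sum_bounded_above)
  then have "(LINT x|lborel. (\<Sum>w\<in>words k. (Dw w f x)\<^sup>2)) \<le> real (card (words k)) * Y"
    by (simp add: Bochner_Integration.integral_sum integrable_square_Dw[OF f])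
  then have "sqrt (LINT x|lborel. (\<Sum>w\<in>words k. (Dw w f x)\<^sup>2)) \<le> sqrt (card (words k)) * sqrt Y"
    by (metis real_sqrt_le_mono real_sqrt_mult)
  with card_words_pos[of k] show "sqrt (LINT x|lborel. (\<Sum>w\<in>words k. (Dw w f x)\<^sup>2)) / sqrt (card (words k)) \<le> sqrt Y"
    by (simp add: divide_le_eq mult.commute)
qed

section \<open>The energy inequality in Sobolev norms, with constants uniform in a parameter\<close>

definition energy_bound :: "(R3 \<Rightarrow> real) \<Rightarrow> (3 \<Rightarrow> R3 \<Rightarrow> real) \<Rightarrow> nat \<Rightarrow> real \<Rightarrow> real \<Rightarrow> bool" where
  "energy_bound a b k T C \<longleftrightarrow> (\<forall>u F B. smooth_spacetime u \<and> smooth_spacetime F \<and> cone B u \<and>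
     (\<forall>x. u 0 x = 0) \<and> (\<forall>x. Dt u 0 x = 0) \<and>
     (\<forall>t\<ge>0. \<forall>x. Dt (Dt u) t x = a x * lap (u t) x + (\<Sum>i\<in>UNIV. b i x * partial i (u t) x) + F t x) \<longrightarrow>
     (\<forall>t\<in>{0..T}. sobolev_norm (k + 1) (u t) + sobolev_norm k (Dt u t) \<le>
        ennreal C * (\<integral>\<^sup>+s\<in>{0..T}. sobolev_norm k (F s) \<partial>lborel)))"

text \<open>The commutator constants, the lower bound \<open>m\<close> and the upper bound
  \<open>M\<close> hold for the whole parameter set, and the final constant is built from these
  alone, together with \<open>k\<close> and \<open>T\<close>. Neither the solution nor the radius
  \<open>B\<close> of its support enters it.\<close>

lemma energy_bound_uniform:
  fixes a :: "'e \<Rightarrow> R3 \<Rightarrow> real" and b :: "3 \<Rightarrow> 'e \<Rightarrow> R3 \<Rightarrow> real"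
  assumes a: "bnd S a" and b: "\<And>i. bnd S (b i)" and m: "0 < m" "\<And>e x. e \<in> S \<Longrightarrow> m \<le> a e x" and T: "0 < T"
  shows "\<exists>C. \<forall>e\<in>S. energy_bound (a e) (\<lambda>i. b i e) k T C"
proof -
  obtain M where M: "\<And>e x. e \<in> S \<Longrightarrow> \<bar>a e x\<bar> \<le> M" using bnd_bounded[OF a] by blast
  define a1 a2 where "a1 = inverse m" and "a2 = \<bar>M\<bar>"
  have "\<forall>l\<in>words k. \<exists>K\<ge>0. \<forall>e\<in>S. \<forall>f x. smooth_on UNIV f \<longrightarrow>
      \<bar>Dw l (\<lambda>x. a e x * lap f x + (\<Sum>i\<in>UNIV. b i e x * partial i f x)) x - a e x * lap (Dw l f) x\<bar> \<le>
        K * sqrt (\<Sum>w\<in>words (Suc k). (Dw w f x)\<^sup>2)"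
  proof
    fix l assume l: "l \<in> words k"
    obtain qs where ok: "dop_ok S (Suc (length l)) qs" and
      eq: "\<And>e (f :: R3 \<Rightarrow> real). e \<in> S \<Longrightarrow> smooth_on UNIV f \<Longrightarrow>
        Dw l (\<lambda>x. a e x * lap f x + (\<Sum>i\<in>UNIV. b i e x * partial i f x)) = (\<lambda>x. a e x * lap (Dw l f) x + dop qs e f x)"
      using commutator[OF a, of b l, OF b] by blast
    have "dop_ok S (Suc k) qs" using ok l by (fastforce simp: dop_ok_def words_def)
    from dop_bound[OF this] obtain K where "0 \<le> K"
      "\<forall>e\<in>S. \<forall>f x. \<bar>dop qs e f x\<bar> \<le> K * sqrt (\<Sum>w\<in>words (Suc k). (Dw w f x)\<^sup>2)" by blast
    then show "\<exists>K\<ge>0. \<forall>e\<in>S. \<forall>f x. smooth_on UNIV f \<longrightarrow>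
      \<bar>Dw l (\<lambda>x. a e x * lap f x + (\<Sum>i\<in>UNIV. b i e x * partial i f x)) x - a e x * lap (Dw l f) x\<bar> \<le>
        K * sqrt (\<Sum>w\<in>words (Suc k). (Dw w f x)\<^sup>2)"
      by (intro exI[of _ K]) (simp add: eq)
  qed
  from bchoice[OF this] obtain Kf where Kf: "\<And>l. l \<in> words k \<Longrightarrow> 0 \<le> Kf l"
    "\<And>l e f x. l \<in> words k \<Longrightarrow> e \<in> S \<Longrightarrow> smooth_on UNIV f \<Longrightarrow>
      \<bar>Dw l (\<lambda>x. a e x * lap f x + (\<Sum>i\<in>UNIV. b i e x * partial i f x)) x - a e x * lap (Dw l f) x\<bar> \<le>
        Kf l * sqrt (\<Sum>w\<in>words (Suc k). (Dw w f x)\<^sup>2)"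
    by blast
  define K where "K = (\<Sum>l\<in>words k. Kf l)"
  have K: "0 \<le> K" "\<And>l. l \<in> words k \<Longrightarrow> Kf l \<le> K"
    unfolding K_def using Kf(1) by (auto intro: sum_nonneg member_le_sum)
  define c where "c = 2 + real (card (words k)) * (a1 * K\<^sup>2) + a2"
  have c: "0 \<le> c" using m(1) by (simp add: c_def a1_def a2_def)
  define n where "n = sqrt (card (words k))"
  have n: "0 < n"
    unfolding n_def using card_words_pos[of k] by simp
  \<comment> \<open>The factor \<open>1 + sqrt a2\<close> adds the two norms on the left, the
    exponential comes from Gronwall, \<open>sqrt a1\<close> from the weighted source, and
    \<open>n\<close> from passing between words and the Sobolev norm.\<close>
  define C where "C = (1 + sqrt a2) * (exp (c * T) * (sqrt a1 * n))"
  have C: "0 \<le> (1 + sqrt a2)" "0 \<le> exp (c * T) * (sqrt a1 * n)" using m(1) n by (auto simp: a1_def a2_def)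
  show ?thesis
  proof (intro exI[of _ C] ballI)
    fix e assume e: "e \<in> S"
    have ae: "smooth_on UNIV (a e)" "\<And>x. 0 < a e x" "\<And>x. inverse (a e x) \<le> a1" "\<And>x. a e x \<le> a2"
    proof -
      show "smooth_on UNIV (a e)" by (rule bnd_smooth[OF a e])
      fix x
      show "0 < a e x" "inverse (a e x) \<le> a1" using m(2)[OF e, of x] m(1) by (auto simp: a1_def intro: le_imp_inverse_le)
      show "a e x \<le> a2" using M[OF e, of x] by (simp add: a2_def)
    qed
    have a12: "0 \<le> a1" "0 \<le> a2" using m(1) by (auto simp: a1_def a2_def)
    show "energy_bound (a e) (\<lambda>i. b i e) k T C"
      unfolding energy_bound_def
    proof (intro allI impI ballI, elim conjE)
      fix u F :: "real \<Rightarrow> R3 \<Rightarrow> real" and B t :: real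
      assume u: "smooth_spacetime u" "cone B u" and F: "smooth_spacetime F"
        and 0: "\<forall>x. u 0 x = 0" "\<forall>x. Dt u 0 x = 0" and t: "t \<in> {0..T}"
        and eq: "\<forall>t\<ge>0. \<forall>x. Dt (Dt u) t x = a e x * lap (u t) x + (\<Sum>i\<in>UNIV. b i e x * partial i (u t) x) + F t x"
      have t0: "0 \<le> t" "t \<le> T" using t by auto
      have lapu: "lap (u t) x = Lap u t x" for t x by (simp add: lap_def Lap_def Dx_def[abs_def])
      have pu: "partial i (u t) x = Dx i u t x" for i t x by (simp add: Dx_def)
      \<comment> \<open>Only \<open>u\<close> is assumed to have spatially compact support; the
        equation expresses \<open>F\<close> through derivatives of \<open>u\<close> and passes the
        support on.\<close>
      have cF: "cone B F"
        unfolding cone_def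
      proof (intro allI impI)
        fix t and x :: R3 assume tx: "0 \<le> t" "B + t < norm x"
        have "Dt (Dt u) t x = 0" "Lap u t x = 0" "\<And>i. Dx i u t x = 0"
          using coneD[OF cone_Dt[OF cone_Dt[OF u(2)]] tx] coneD[OF cone_Dx[OF u(2)] tx]
            coneD[OF cone_Dx[OF cone_Dx[OF u(2)]] tx] by (auto simp: Lap_def)
        then show "F t x = 0" using eq tx(1) by (simp add: lapu pu)
      qed
      have eqn: "\<bar>Dw l (Dt (Dt u) t) x - a e x * lap (Dw l (u t)) x - Dw l (F t) x\<bar> \<le>
          K * sqrt (\<Sum>w\<in>words (Suc k). (Dw w (u t) x)\<^sup>2)" if l: "l \<in> words k" and t: "0 \<le> t" for l t x
      proof -
        have su: "smooth_on UNIV (u t)" by (rule smooth_spacetime_slice[OF u(1) t])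
        let ?L = "\<lambda>x. a e x * lap (u t) x + (\<Sum>i\<in>UNIV. b i e x * partial i (u t) x)"
        have L: "smooth_on UNIV ?L"
          by (intro smooth_on_add smooth_on_mult smooth_on_sum smooth_on_lap smooth_on_partial su rich_UNIV bnd_smooth[OF b e] ae)
        have "Dt (Dt u) t = (\<lambda>x. ?L x + F t x)" using eq t by auto
        then have "Dw l (Dt (Dt u) t) x = Dw l ?L x + Dw l (F t) x"
          by (simp add: Dw_add[OF L smooth_spacetime_slice[OF F t]])
        then have "\<bar>Dw l (Dt (Dt u) t) x - a e x * lap (Dw l (u t)) x - Dw l (F t) x\<bar> = \<bar>Dw l ?L x - a e x * lap (Dw l (u t)) x\<bar>"
          by simp
        also have "\<dots> \<le> Kf l * sqrt (\<Sum>w\<in>words (Suc k). (Dw w (u t) x)\<^sup>2)"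
          by (rule Kf(2)[OF l e su])
        also have "\<dots> \<le> K * sqrt (\<Sum>w\<in>words (Suc k). (Dw w (u t) x)\<^sup>2)"
          using K(2)[OF l] by (intro mult_right_mono) (auto intro: sum_nonneg)
        finally show ?thesis .
      qed
      let ?\<Phi> = "\<lambda>s. sqrt (LINT x|lborel. source_density k F s x)"
      let ?E = "LINT x|lborel. energy_density k (a e) u t x"
      have aen: "a e x \<noteq> 0" for x using ae(2)[of x] by simp
      have Ed: "integrable lborel (energy_density k (a e) u t)"
        by (rule cone_integrable[OF smooth_energy_density[OF u(1) ae(1) aen] cone_energy_density[OF u(2)] t0(1)])
      have E0: "0 \<le> ?E" by (rule Bochner_Integration.integral_nonneg) (rule energy_density_nonneg[OF ae(2)])
      have E: "sqrt ?E \<le> exp (c * t) * (sqrt a1 * integral {0..t} ?\<Phi>)"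
        unfolding c_def by (rule energy_estimate[OF u F cF _ _ ae K(1) eqn t0(1)]) (use 0 in auto)
      have c\<Phi>: "continuous_on {0..T} ?\<Phi>"
      proof (rule continuous_on_real_sqrt)
        show "continuous_on {0..T} (\<lambda>s. LINT x|lborel. source_density k F s x)"
          by (rule DERIV_continuous_on)
            (rule integral_time_derivative[OF smooth_source_density[OF F] cone_source_density[OF cF]])
      qed
      have \<Phi>0: "0 \<le> ?\<Phi> s" for s
        by (intro real_sqrt_ge_zero Bochner_Integration.integral_nonneg source_density_nonneg)
      have "integral {0..t} ?\<Phi> \<le> integral {0..T} ?\<Phi>"
        using t0 \<Phi>0 by (intro integral_subset_le integrable_continuous_real continuous_on_subset[OF c\<Phi>]) auto
      moreover have "exp (c * t) \<le> exp (c * T)" using c t0 by (simp add: mult_left_mono)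
      moreover have "0 \<le> integral {0..t} ?\<Phi>"
        using \<Phi>0 by (intro Henstock_Kurzweil_Integration.integral_nonneg integrable_continuous_real continuous_on_subset[OF c\<Phi>]) (use t0 in auto)
      ultimately have "exp (c * t) * (sqrt a1 * integral {0..t} ?\<Phi>) \<le> exp (c * T) * (sqrt a1 * integral {0..T} ?\<Phi>)"
        using a12 by (intro mult_mono mult_nonneg_nonneg) auto
      with E have E': "sqrt ?E \<le> exp (c * T) * (sqrt a1 * integral {0..T} ?\<Phi>)" by linarith
      have su: "smooth_on UNIV (u t)" "smooth_on UNIV (Dt u t)"
        by (intro smooth_spacetime_slice smooth_intros u t0)+
      have u0: "u t x = 0" "Dt u t x = 0" if "B + t < norm x" for x
        using coneD[OF u(2) t0(1) that] coneD[OF cone_Dt[OF u(2)] t0(1) that] by auto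
      have 1: "sobolev_norm (k + 1) (u t) \<le> ennreal (sqrt ?E)"
      proof (rule order_trans[OF sobolev_norm_le[OF su(1) u0(1)]], assumption, intro ennreal_leI real_sqrt_le_mono integral_mono Ed)
        show "integrable lborel (\<lambda>x. \<Sum>w\<in>words (k + 1). (Dw w (u t) x)\<^sup>2)"
          by (intro Bochner_Integration.integrable_sum integrable_square_Dw[OF su(1) u0(1)])
        show "(\<Sum>w\<in>words (k + 1). (Dw w (u t) x)\<^sup>2) \<le> energy_density k (a e) u t x" for x
          using sum_words_le_energy[of "a e", OF ae(2)] by simp
      qed
      have 2: "sobolev_norm k (Dt u t) \<le> ennreal (sqrt a2 * sqrt ?E)"
      proof -
        have "(LINT x|lborel. (\<Sum>w\<in>words k. (Dw w (Dt u t) x)\<^sup>2)) \<le> (LINT x|lborel. a2 * energy_density k (a e) u t x)"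
        proof (rule integral_mono)
          show "integrable lborel (\<lambda>x. \<Sum>w\<in>words k. (Dw w (Dt u t) x)\<^sup>2)"
            by (intro Bochner_Integration.integrable_sum integrable_square_Dw[OF su(2) u0(2)])
          show "integrable lborel (\<lambda>x. a2 * energy_density k (a e) u t x)"
            by (intro integrable_mult_right Ed)
          fix x
          show "(\<Sum>w\<in>words k. (Dw w (Dt u t) x)\<^sup>2) \<le> a2 * energy_density k (a e) u t x"
            unfolding energy_density_def sum_distrib_left
          proof (rule sum_mono)
            fix l
            have "(Dw l (Dt u t) x)\<^sup>2 = a e x * (inverse (a e x) * (Dw l (Dt u t) x)\<^sup>2)" using aen[of x] by simp
            also have "\<dots> \<le> a2 * (inverse (a e x) * (Dw l (Dt u t) x)\<^sup>2)"
              using ae(2,4)[of x] by (intro mult_right_mono) auto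
            also have "\<dots> \<le> a2 * (inverse (a e x) * (Dw l (Dt u t) x)\<^sup>2 + ((\<Sum>i\<in>UNIV. (Dw (i # l) (u t) x)\<^sup>2) + (Dw l (u t) x)\<^sup>2))"
              using a12 by (intro mult_left_mono) (auto intro!: add_nonneg_nonneg sum_nonneg)
            finally show "(Dw l (Dt u t) x)\<^sup>2 \<le> a2 * (inverse (a e x) * (Dw l (Dt u t) x)\<^sup>2 + ((\<Sum>i\<in>UNIV. (Dw (i # l) (u t) x)\<^sup>2) + (Dw l (u t) x)\<^sup>2))" .
          qed
        qed
        then have "sqrt (LINT x|lborel. (\<Sum>w\<in>words k. (Dw w (Dt u t) x)\<^sup>2)) \<le> sqrt a2 * sqrt ?E"
          by (simp add: real_sqrt_mult[symmetric])
        then show ?thesis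
          by (intro order_trans[OF sobolev_norm_le[OF su(2) u0(2)]] ennreal_leI)
      qed
      have 3: "ennreal (integral {0..T} ?\<Phi>) \<le> ennreal n * (\<integral>\<^sup>+s\<in>{0..T}. sobolev_norm k (F s) \<partial>lborel)"
      proof -
        have ci: "continuous_on {0..T} (\<lambda>s. ?\<Phi> s / n)" by (intro continuous_on_divide c\<Phi> continuous_on_const) (use n in auto)
        have "((\<lambda>s. ?\<Phi> s / n) has_integral integral {0..T} (\<lambda>s. ?\<Phi> s / n)) {0..T}"
          by (intro integrable_integral integrable_continuous_real ci)
        then have int_eq: "(\<integral>\<^sup>+s. ennreal (indicator {0..T} s * (?\<Phi> s / n)) \<partial>lborel) = ennreal (integral {0..T} (\<lambda>s. ?\<Phi> s / n))"
        proof (intro nn_integral_has_integral_lborel)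
          have "(\<lambda>s. indicator {0..T} s *\<^sub>R (?\<Phi> s / n)) \<in> borel_measurable borel"
            using borel_integrable_compact[OF compact_Icc ci] by (simp add: borel_measurable_integrable)
          then show "(\<lambda>s. indicator {0..T} s * (?\<Phi> s / n)) \<in> borel_measurable borel" by simp
          show "((\<lambda>s. indicator {0..T} s * (?\<Phi> s / n)) has_integral integral {0..T} (\<lambda>s. ?\<Phi> s / n)) UNIV"
          proof -
            have eq: "(\<lambda>s. indicator {0..T} s * (?\<Phi> s / n)) = (\<lambda>s. if s \<in> {0..T} then ?\<Phi> s / n else 0)"
              by (auto simp: fun_eq_iff)
            show ?thesis unfolding eq has_integral_restrict_UNIV by fact
          qed
        qed (use n \<Phi>0 in auto)
        \<comment> \<open>The left-hand integrand is a continuous function cut off to the time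
          interval. Monotonicity of the nonnegative integral is a pointwise comparison, so nothing
          has to be known about how the Sobolev norm of \<open>F s\<close> depends on
          \<open>s\<close>.\<close>
        have "(\<integral>\<^sup>+s. ennreal (indicator {0..T} s * (?\<Phi> s / n)) \<partial>lborel) \<le> (\<integral>\<^sup>+s\<in>{0..T}. sobolev_norm k (F s) \<partial>lborel)"
        proof (rule nn_integral_mono)
          fix s
          show "ennreal (indicator {0..T} s * (?\<Phi> s / n)) \<le> sobolev_norm k (F s) * indicator {0..T} s"
          proof (cases "s \<in> {0..T}")
            case True
            then have s: "0 \<le> s" by simp
            have "ennreal (?\<Phi> s / n) \<le> sobolev_norm k (F s)"
              unfolding source_density_def n_def
              by (rule sobolev_norm_ge[OF smooth_spacetime_slice[OF F s] coneD[OF cF s]])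
            then show ?thesis using True by simp
          qed simp
        qed
        then have "ennreal (integral {0..T} (\<lambda>s. ?\<Phi> s / n)) \<le> (\<integral>\<^sup>+s\<in>{0..T}. sobolev_norm k (F s) \<partial>lborel)"
          unfolding int_eq .
        then have "ennreal n * ennreal (integral {0..T} (\<lambda>s. ?\<Phi> s / n)) \<le> ennreal n * (\<integral>\<^sup>+s\<in>{0..T}. sobolev_norm k (F s) \<partial>lborel)"
          by (rule mult_left_mono) simp
        moreover have "ennreal n * ennreal (integral {0..T} (\<lambda>s. ?\<Phi> s / n)) = ennreal (integral {0..T} ?\<Phi>)"
          using n by (simp add: ennreal_mult'[symmetric])
        ultimately show ?thesis by simp
      qed
      have "sobolev_norm (k + 1) (u t) + sobolev_norm k (Dt u t) \<le> ennreal (sqrt ?E) + ennreal (sqrt a2 * sqrt ?E)"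
        by (rule add_mono[OF 1 2])
      also have "\<dots> = ennreal ((1 + sqrt a2) * sqrt ?E)"
        using a12 E0 by (simp add: ennreal_plus[symmetric] distrib_right del: ennreal_plus)
      also have "\<dots> \<le> ennreal ((1 + sqrt a2) * (exp (c * T) * (sqrt a1 * integral {0..T} ?\<Phi>)))"
        using C(1) by (intro ennreal_leI mult_left_mono E')
      also have "\<dots> = ennreal ((1 + sqrt a2) * (exp (c * T) * sqrt a1)) * ennreal (integral {0..T} ?\<Phi>)"
        using a12 by (subst ennreal_mult'[symmetric]) (auto simp: mult.assoc)
      also have "\<dots> \<le> ennreal ((1 + sqrt a2) * (exp (c * T) * sqrt a1)) * (ennreal n * (\<integral>\<^sup>+s\<in>{0..T}. sobolev_norm k (F s) \<partial>lborel))"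
        by (intro mult_left_mono 3) simp
      also have "\<dots> = ennreal C * (\<integral>\<^sup>+s\<in>{0..T}. sobolev_norm k (F s) \<partial>lborel)"
        unfolding C_def mult.assoc[symmetric] using n a12 by (subst ennreal_mult'[symmetric]) (auto simp: mult.assoc)
      finally show "sobolev_norm (k + 1) (u t) + sobolev_norm k (Dt u t) \<le>
        ennreal C * (\<integral>\<^sup>+s\<in>{0..T}. sobolev_norm k (F s) \<partial>lborel)" .
    qed
  qed
qed

section \<open>The expansion and its remainder\<close>

text \<open>Each time derivative removes one primitive. Differentiability at every stage is recorded
  along with the values, so that the iterated \<open>time_deriv\<close> is a genuine derivative and
  not a default value.\<close>

lemma time_deriv_primitive_chain:
  fixes f :: "real \<Rightarrow> real"
  assumes P: "smooth_spacetime P" and Q: "smooth_spacetime Q"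
    and f: "\<And>t. 0 \<le> t \<Longrightarrow> f t = (time_primitive ^^ n) P t x + e * (time_primitive ^^ n) Q t x"
  shows "i \<le> n \<Longrightarrow> 0 \<le> t \<Longrightarrow> (time_deriv ^^ i) f t =
      (time_primitive ^^ (n - i)) P t x + e * (time_primitive ^^ (n - i)) Q t x"
    and "i < n \<Longrightarrow> (time_deriv ^^ i) f differentiable_on {0..}"
proof -
  have sm: "smooth_spacetime ((time_primitive ^^ j) u)" if "smooth_spacetime u" for j u
    using that by (induction j) (auto intro: smooth_spacetime_primitive)
  have step: "(h has_real_derivative (time_primitive ^^ (n - Suc i)) P t x + e * (time_primitive ^^ (n - Suc i)) Q t x) (at t within {0..})"
    if "i < n" "0 \<le> t" and h: "\<And>t. 0 \<le> t \<Longrightarrow> h t = (time_primitive ^^ (n - i)) P t x + e * (time_primitive ^^ (n - i)) Q t x"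
    for h i t
  proof -
    have ni: "n - i = Suc (n - Suc i)" using that by simp
    have "((\<lambda>t. (time_primitive ^^ (n - i)) P t x + e * (time_primitive ^^ (n - i)) Q t x) has_real_derivative
        (time_primitive ^^ (n - Suc i)) P t x + e * (time_primitive ^^ (n - Suc i)) Q t x) (at t within {0..})"
      unfolding ni funpow.simps o_def
      by (intro DERIV_add DERIV_cmult time_primitive_has_derivative sm P Q that(2))
    then show ?thesis
      by (rule has_field_derivative_transform_within[OF _ zero_less_one]) (use h that(2) in auto)
  qed
  have val: "(time_deriv ^^ i) f t = (time_primitive ^^ (n - i)) P t x + e * (time_primitive ^^ (n - i)) Q t x"
    if "i \<le> n" "0 \<le> t" for i t
    using that
  proof (induction i arbitrary: t)
    case (Suc i)
    then have "i < n" by simp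
    from time_deriv_eqI[OF step[OF this Suc.prems(2)] Suc.prems(2), of "(time_deriv ^^ i) f"] Suc
    show ?case by simp
  qed (use f in simp)
  then show "i \<le> n \<Longrightarrow> 0 \<le> t \<Longrightarrow> (time_deriv ^^ i) f t =
      (time_primitive ^^ (n - i)) P t x + e * (time_primitive ^^ (n - i)) Q t x" .
  show "(time_deriv ^^ i) f differentiable_on {0..}" if "i < n"
    unfolding differentiable_on_def
  proof
    fix t :: real assume "t \<in> {0..}"
    then show "(time_deriv ^^ i) f differentiable at t within {0..}"
      using step[OF that, of t "(time_deriv ^^ i) f"] val that
      by (auto simp: has_field_derivative_def differentiable_def)
  qed
qed

lemma second_time_deriv: "(time_deriv ^^ 2) (\<lambda>s. u s x) t = Dt (Dt u) t x"
  by (simp add: Dt_def numeral_2_eq_2)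

lemma grad_inner_grad: "grad f x \<bullet> grad (u t) x = (\<Sum>i\<in>UNIV. partial i f x * Dx i u t x)"
  by (simp add: grad_def inner_vec_def Dx_def)

lemma divergence_scaled_grad:
  assumes r: "smooth_on UNIV r" "r x \<noteq> 0" and f: "smooth_on UNIV f"
  shows "divergence (\<lambda>y. (1 / r y) *\<^sub>R grad f y) x =
    inverse (r x) * lap f x - inverse (r x) * inverse (r x) * (\<Sum>i\<in>UNIV. partial i r x * partial i f x)"
proof -
  have d: "r differentiable (at x)" "partial i f differentiable (at x)" for i
    by (intro smooth_on_differentiable smooth_on_partial r f)+
  have "partial i (\<lambda>y. inverse (r y) * partial i f y) x =
      inverse (r x) * partial i (partial i f) x - inverse (r x) * inverse (r x) * (partial i r x * partial i f x)" for i
    using d r(2) by (subst partial_mult) (auto simp: partial_inverse differentiable_inverse)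
  then have "(\<Sum>i\<in>UNIV. partial i (\<lambda>y. inverse (r y) * partial i f y) x) =
    inverse (r x) * lap f x - inverse (r x) * inverse (r x) * (\<Sum>i\<in>UNIV. partial i r x * partial i f x)"
    by (simp add: lap_def sum_subtractf sum_distrib_left)
  then show ?thesis
    by (simp add: divergence_def grad_def inverse_eq_divide)
qed

text \<open>Expanding \<open>\<rho> * \<alpha> * div ((1 / \<rho>) * grad P)\<close> gives
  \<open>\<alpha>\<close> times the Laplacian of \<open>P\<close> plus a first-order term; this is
  the coefficient of the \<open>i\<close>-th derivative in it.\<close>

definition drift :: "(R3 \<Rightarrow> real) \<Rightarrow> (R3 \<Rightarrow> real) \<Rightarrow> 3 \<Rightarrow> real \<Rightarrow> R3 \<Rightarrow> real" where
  "drift A R i e x = - 1 * (perturbed A e x * inverse (perturbed R e x) * (e * partial i R x))"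

lemma smooth_on_perturbed: "smooth_on UNIV f \<Longrightarrow> smooth_on UNIV (perturbed f e)"
  unfolding perturbed_def[abs_def] by (intro smooth_on_add smooth_on_mult smooth_on_const rich_UNIV)

lemma partial_perturbed: "smooth_on UNIV f \<Longrightarrow> partial i (perturbed f e) x = e * partial i f x"
  unfolding perturbed_def[abs_def]
  by (subst partial_add) (auto simp: partial_cmult smooth_on_differentiable)

lemma bnd_perturbed:
  assumes "smooth_on UNIV f" "compact K" "\<And>x. x \<notin> K \<Longrightarrow> f x = 0" "bounded S"
  shows "bnd S (perturbed f)"
  unfolding perturbed_def[abs_def]
  by (intro bnd_add bnd_mult bnd_const bnd_compact_support[OF assms(1-3)])
    (use assms(4) in \<open>auto simp: bounded_iff\<close>)

lemma bnd_drift: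
  assumes A: "smooth_on UNIV A" and R: "smooth_on UNIV R"
    and K: "compact K" "\<And>x. x \<notin> K \<Longrightarrow> A x = 0" "\<And>x. x \<notin> K \<Longrightarrow> R x = 0"
    and S: "bounded S" and m: "0 < m" "\<And>e x. e \<in> S \<Longrightarrow> m \<le> perturbed R e x"
  shows "bnd S (drift A R i)"
proof -
  have c: "bnd S (\<lambda>e x. e)" "bnd S (\<lambda>e x. - 1)"
    by (rule bnd_const; use S in \<open>auto simp: bounded_iff\<close>)+
  show ?thesis
    unfolding drift_def[abs_def]
    by (intro bnd_mult c bnd_inverse[OF m] bnd_perturbed[OF A K(1,2) S] bnd_perturbed[OF R K(1,3) S]
        bnd_partial bnd_compact_support[OF R K(1,3)])
qed

text \<open>Two regimes of \<epsilon> are joined. Below a threshold both perturbed coefficients are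
  at least 1/2, so one constant serves the whole interval and the family is O(1) at 0. Above it each
  \<epsilon> has a constant of its own, obtained from the assumed positive lower bounds with a
  one-point parameter set.\<close>

lemma energy_constants:
  assumes A: "smooth_on UNIV A" and R: "smooth_on UNIV R"
    and K: "compact K" "\<And>x. x \<notin> K \<Longrightarrow> A x = 0" "\<And>x. x \<notin> K \<Longrightarrow> R x = 0"
  shows "\<exists>C :: nat \<Rightarrow> real \<Rightarrow> real \<Rightarrow> real. (\<forall>k T. T > 0 \<longrightarrow> C k T \<in> O[at_right 0](\<lambda>_. 1)) \<and>
    (\<forall>k T e. T > 0 \<and> e > 0 \<and> (\<exists>m>0. \<forall>x. m \<le> perturbed R e x) \<and> (\<exists>m>0. \<forall>x. m \<le> perturbed A e x) \<longrightarrow>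
      energy_bound (perturbed A e) (\<lambda>i. drift A R i e) k T (C k T e))"
proof -
  obtain M where M: "1 \<le> M" "\<And>x. \<bar>A x\<bar> \<le> M" "\<And>x. \<bar>R x\<bar> \<le> M"
  proof -
    obtain MA where "\<And>x. \<bar>A x\<bar> \<le> MA"
      using bnd_bounded[OF bnd_compact_support[OF A K(1,2), of "{0::real}"]] by auto
    moreover obtain MR where "\<And>x. \<bar>R x\<bar> \<le> MR"
      using bnd_bounded[OF bnd_compact_support[OF R K(1,3), of "{0::real}"]] by auto
    ultimately show ?thesis
      by (intro that[of "max 1 (max MA MR)"]) (auto intro: max.coboundedI2 max.coboundedI1)
  qed
  \<comment> \<open>Below this value the perturbation \<open>e * f x\<close> is at most 1/2 in
    absolute value, so \<open>1 + e * f x\<close> is at least 1/2.\<close>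
  define e1 where "e1 = 1 / (2 * M)"
  have e1: "0 < e1" using M(1) by (simp add: e1_def)
  have half: "1/2 \<le> perturbed f e x" if "e \<in> {0<..<e1}" "\<And>x. \<bar>f x\<bar> \<le> M" for f e x
  proof -
    have "\<bar>e * f x\<bar> \<le> e1 * M" unfolding abs_mult using that M(1) by (intro mult_mono) auto
    also have "\<dots> = 1/2" using M(1) by (simp add: e1_def)
    finally show ?thesis unfolding perturbed_def by linarith
  qed
  have ex1: "\<exists>C. \<forall>e\<in>{0<..<e1}. energy_bound (perturbed A e) (\<lambda>i. drift A R i e) k T C" if "0 < T" for k T
  proof (rule energy_bound_uniform[where m = "1/2", OF _ _ _ _ that])
    have b: "bounded {0<..<e1}" by (rule bounded_subset[OF bounded_closed_interval[of 0 e1]]) auto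
    show "bnd {0<..<e1} (perturbed A)" by (rule bnd_perturbed[OF A K(1,2) b])
    show "bnd {0<..<e1} (drift A R i)" for i
      by (rule bnd_drift[OF A R K b, where m = "1/2"]) (use half M(3) in auto)
  qed (use half M(2) in auto)
  define C1 where "C1 k T = (SOME c. \<forall>e\<in>{0<..<e1}. energy_bound (perturbed A e) (\<lambda>i. drift A R i e) k T c)" for k T
  have C1: "\<forall>e\<in>{0<..<e1}. energy_bound (perturbed A e) (\<lambda>i. drift A R i e) k T (C1 k T)" if "0 < T" for k T
    unfolding C1_def by (rule someI_ex[OF ex1[OF that]])
  have C2: "\<exists>C. energy_bound (perturbed A e) (\<lambda>i. drift A R i e) k T C"
    if "0 < T" "mR > 0" "\<And>x. mR \<le> perturbed R e x" "mA > 0" "\<And>x. mA \<le> perturbed A e x" for k T e mR mA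
  proof -
    have "\<exists>C. \<forall>e'\<in>{e}. energy_bound (perturbed A e') (\<lambda>i. drift A R i e') k T C"
    proof (rule energy_bound_uniform[where m = mA, OF _ _ that(4) _ that(1)])
      have b: "bounded {e}" by (simp add: finite_imp_bounded)
      show "bnd {e} (perturbed A)" by (rule bnd_perturbed[OF A K(1,2) b])
      show "bnd {e} (drift A R i)" for i
        by (rule bnd_drift[OF A R K b, where m = mR]) (use that in auto)
    qed (use that in auto)
    then show ?thesis by simp
  qed
  define C where "C k T e = (if e < e1 then C1 k T else SOME c. energy_bound (perturbed A e) (\<lambda>i. drift A R i e) k T c)" for k T e
  show ?thesis
  proof (intro exI[of _ C] conjI allI impI)
    fix k :: nat and T :: real
    show "C k T \<in> O[at_right 0](\<lambda>_. 1)"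
    proof (rule bigoI[where c = "\<bar>C1 k T\<bar>"], rule eventually_at_rightI[OF _ e1])
      show "norm (C k T e) \<le> \<bar>C1 k T\<bar> * norm (1::real)" if "e \<in> {0<..<e1}" for e
        using that by (simp add: C_def)
    qed
  next
    fix k :: nat and T e :: real
    assume *: "T > 0 \<and> e > 0 \<and> (\<exists>m>0. \<forall>x. m \<le> perturbed R e x) \<and> (\<exists>m>0. \<forall>x. m \<le> perturbed A e x)"
    show "energy_bound (perturbed A e) (\<lambda>i. drift A R i e) k T (C k T e)"
    proof (cases "e < e1")
      case True
      then show ?thesis using C1[of T k] * by (simp add: C_def)
    next
      case False
      have "\<exists>c. energy_bound (perturbed A e) (\<lambda>i. drift A R i e) k T c"
        using C2[of T _ e _ k] * by blast
      then show ?thesis using False unfolding C_def by (simp add: someI_ex)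
    qed
  qed
qed

lemma supported_in_zero: "supported_in \<Omega> f \<Longrightarrow> x \<notin> closure \<Omega> \<Longrightarrow> f x = 0"
  unfolding supported_in_def using closure_subset[of "{x. f x \<noteq> 0}"] closure_subset[of \<Omega>] by blast

lemma expansion_formula:
  fixes e :: real
  assumes A: "smooth_on UNIV A" and R: "smooth_on UNIV R" and p: "smooth_on UNIV p"
    and P0: "zeroth_order_term p P0" and P1: "first_order_term A R P0 P1"
  defines "g \<equiv> \<lambda>x t. LINT y:ball x t|lborel. green_kernel A R e t x y * p y"
  shows "i < 4 \<Longrightarrow> (time_deriv ^^ i) (g x) differentiable_on {0..}"
    and "0 \<le> t \<Longrightarrow> (time_deriv ^^ 4) (g x) t = P0 t x + e * P1 t x"
proof -
  have s0: "smooth_spacetime P0" and s1: "smooth_spacetime P1"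
    using P0 P1 by (simp_all add: zeroth_order_term_def first_order_term_def)
  have g: "g x t = (time_primitive ^^ 4) P0 t x + e * (time_primitive ^^ 4) P1 t x" if "0 \<le> t" for t
  proof -
    have "g x t = time_primitive (time_primitive (time_primitive (time_primitive P0))) t x
        + e * time_primitive (time_primitive (time_primitive (time_primitive P1))) t x"
      unfolding g_def
    proof (rule kernel_formula[OF A R p s0 _ _ _ s1 _ _ _ that])
      show "Dt (Dt P0) t x - Lap P0 t x = 0" if "0 \<le> t" for t x
        using P0 that by (simp add: zeroth_order_term_def second_time_deriv laplacian_eq_Lap)
      show "Dt P0 0 x = 0" "P0 0 x = p x" for x
        using P0 by (simp_all add: zeroth_order_term_def Dt_def)
      show "Dt (Dt P1) t x - Lap P1 t x = A x * Lap P0 t x - (\<Sum>i\<in>UNIV. partial i R x * Dx i P0 t x)" if "0 \<le> t" for t x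
        using P1 that by (simp add: first_order_term_def second_time_deriv laplacian_eq_Lap grad_inner_grad)
      show "Dt P1 0 x = 0" "P1 0 x = 0" for x
        using P1 by (simp_all add: first_order_term_def Dt_def)
    qed
    then show ?thesis by (simp add: numeral_eq_Suc)
  qed
  show "i < 4 \<Longrightarrow> (time_deriv ^^ i) (g x) differentiable_on {0..}"
    by (rule time_deriv_primitive_chain(2)[OF s0 s1 g])
  show "0 \<le> t \<Longrightarrow> (time_deriv ^^ 4) (g x) t = P0 t x + e * P1 t x"
    using time_deriv_primitive_chain(1)[OF s0 s1 g, of 4 t] by simp
qed

lemma Dt_combination:
  assumes "smooth_spacetime a" "smooth_spacetime b" "smooth_spacetime c" "0 \<le> t"
  shows "Dt (\<lambda>t x. k * (a t x - b t x - e * c t x)) t x = k * (Dt a t x - Dt b t x - e * Dt c t x)"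
  unfolding Dt_def[of "\<lambda>t x. k * (a t x - b t x - e * c t x)"]
  by (rule time_deriv_eqI[OF _ assms(4)]) (intro DERIV_cmult DERIV_diff Dt_has_derivative assms)

lemma Dx_combination:
  assumes "smooth_spacetime a" "smooth_spacetime b" "smooth_spacetime c" "0 \<le> t"
  shows "Dx i (\<lambda>t x. k * (a t x - b t x - e * c t x)) t x = k * (Dx i a t x - Dx i b t x - e * Dx i c t x)"
proof -
  have "Dx i (\<lambda>t x. k * (a t x - b t x - e * c t x)) t x = k * Dx i (\<lambda>t x. a t x - b t x - e * c t x) t x"
    by (intro Dx_cmult smooth_intros assms)
  also have "Dx i (\<lambda>t x. a t x - b t x - e * c t x) t x = Dx i (\<lambda>t x. a t x - b t x) t x - Dx i (\<lambda>t x. e * c t x) t x"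
    by (intro Dx_diff smooth_intros assms)
  finally show ?thesis by (simp add: Dx_diff Dx_cmult assms)
qed

text \<open>This is the equation of the remainder at one point, with \<open>L\<close> and
  \<open>s\<close> standing for the Laplacian and for the product of the gradients of \<rho>1 and
  the solution, and with indices 0 and 1 for the expansion terms. After multiplication by
  \<open>e\<^sup>2\<close> it is a polynomial identity up to one division by
  \<open>\<rho>\<close>.\<close>

lemma remainder_algebra:
  fixes e a r L L0 L1 s s0 s1 :: real
  assumes "e \<noteq> 0" "1 + e * r \<noteq> 0"
  defines "\<alpha> \<equiv> 1 + e * a" and "\<rho> \<equiv> 1 + e * r"
  shows "inverse (e\<^sup>2) * ((\<alpha> * L - \<alpha> * inverse \<rho> * e * s) - L0 - e * (L1 + a * L0 - s0)) =
    \<alpha> * (inverse (e\<^sup>2) * (L - L0 - e * L1)) - \<alpha> * inverse \<rho> * e * (inverse (e\<^sup>2) * (s - s0 - e * s1)) +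
    ((r - a) / \<rho> * s0 + a * L1 - \<alpha> / \<rho> * s1)"
proof -
  have r: "\<rho> \<noteq> 0" using assms by simp
  \<comment> \<open>The identity \<open>\<rho> = \<alpha> + e * (r - a)\<close> is behind this; it
    is the origin of the coefficient \<open>(r - a) / \<rho>\<close> in the source.\<close>
  have s0: "e * s0 = inverse \<rho> * e * (\<alpha> + e * (r - a)) * s0"
    using r by (simp add: \<alpha>_def \<rho>_def field_simps)
  have "e\<^sup>2 * (inverse (e\<^sup>2) * ((\<alpha> * L - \<alpha> * inverse \<rho> * e * s) - L0 - e * (L1 + a * L0 - s0))) =
    e\<^sup>2 * (\<alpha> * (inverse (e\<^sup>2) * (L - L0 - e * L1)) - \<alpha> * inverse \<rho> * e * (inverse (e\<^sup>2) * (s - s0 - e * s1)) +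
    ((r - a) / \<rho> * s0 + a * L1 - \<alpha> / \<rho> * s1))"
  proof -
    have 1: "e\<^sup>2 * (inverse (e\<^sup>2) * X) = X" for X using assms(1) by simp
    have 2: "e\<^sup>2 * (\<alpha> * (inverse (e\<^sup>2) * X) - Y * (inverse (e\<^sup>2) * Z) + W) = \<alpha> * X - Y * Z + e\<^sup>2 * W" for X Y Z W
      using assms(1) by (simp add: field_simps)
    have "\<alpha> * (L - L0 - e * L1) - \<alpha> * inverse \<rho> * e * (s - s0 - e * s1) + e\<^sup>2 * ((r - a) / \<rho> * s0 + a * L1 - \<alpha> / \<rho> * s1)
      = \<alpha> * L - \<alpha> * inverse \<rho> * e * s - \<alpha> * L0 - e * L1 * (\<alpha> - e * a) + inverse \<rho> * e * (\<alpha> + e * (r - a)) * s0"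
      by (simp add: divide_inverse algebra_simps power2_eq_square)
    also have "\<dots> = (\<alpha> * L - \<alpha> * inverse \<rho> * e * s) - L0 - e * (L1 + a * L0 - s0)"
      unfolding s0[symmetric] by (simp add: \<alpha>_def algebra_simps)
    finally show ?thesis unfolding 1 2 by simp
  qed
  then show ?thesis using assms(1) by simp
qed

lemma remainder_estimate:
  assumes A: "smooth_on UNIV A" and R: "smooth_on UNIV R"
    and K: "compact K" "\<And>x. x \<notin> K \<Longrightarrow> A x = 0" "\<And>x. x \<notin> K \<Longrightarrow> R x = 0"
    and e: "0 < e" and \<rho>: "\<And>x. 0 < perturbed R e x"
    and P: "full_solution A R p e P" and P0: "zeroth_order_term p P0" and P1: "first_order_term A R P0 P1"
    and P2: "\<And>t x. 0 \<le> t \<Longrightarrow> P t x = P0 t x + e * P1 t x + e\<^sup>2 * P2 t x"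
    and C: "energy_bound (perturbed A e) (\<lambda>i. drift A R i e) k T C"
    and t: "t \<in> {0..T}"
  shows "sobolev_norm (k + 1) (P2 t) + sobolev_norm k (\<lambda>x. time_deriv (\<lambda>s. P2 s x) t) \<le>
    ennreal C * (\<integral>\<^sup>+t\<in>{0..T}. sobolev_norm k (remainder_source A R P0 P1 e t) \<partial>lborel)"
proof -
  \<comment> \<open>The function \<open>P2\<close> is prescribed only for \<open>t \<ge> 0\<close>.
    It is replaced by the quotient determined by the expansion, which agrees with it there and is
    visibly smooth.\<close>
  define u where "u t x = inverse (e\<^sup>2) * (P t x - P0 t x - e * P1 t x)" for t x
  let ?F = "remainder_source A R P0 P1 e"
  have sP: "smooth_spacetime P" and s0: "smooth_spacetime P0" and s1: "smooth_spacetime P1"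
    using P P0 P1 by (simp_all add: full_solution_def zeroth_order_term_def first_order_term_def)
  have \<rho>n: "perturbed R e x \<noteq> 0" for x using \<rho>[of x] by simp
  have su: "smooth_spacetime u" unfolding u_def[abs_def] by (intro smooth_intros sP s0 s1)
  have sF: "smooth_spacetime ?F"
  proof (rule smooth_spacetime_cong)
    show "smooth_spacetime (\<lambda>t x. (R x - A x) * inverse (perturbed R e x) * (\<Sum>i\<in>UNIV. partial i R x * Dx i P0 t x)
        + A x * Lap P1 t x - perturbed A e x * inverse (perturbed R e x) * (\<Sum>i\<in>UNIV. partial i R x * Dx i P1 t x))"
      by (intro smooth_intros smooth_spacetime_Lap smooth_on_partial smooth_on_inverse smooth_on_perturbed A R s0 s1 rich_UNIV \<rho>n)
  qed (simp add: remainder_source_def grad_inner_grad laplacian_eq_Lap divide_inverse)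
  have P2u: "P2 t x = u t x" if "0 \<le> t" for t x
    using P2[OF that, of x] e by (simp add: u_def)
  have Dtu: "Dt u t x = inverse (e\<^sup>2) * (Dt P t x - Dt P0 t x - e * Dt P1 t x)" if "0 \<le> t" for t x
    unfolding u_def[abs_def] by (rule Dt_combination[OF sP s0 s1 that])
  have DtDtu: "Dt (Dt u) t x = inverse (e\<^sup>2) * (Dt (Dt P) t x - Dt (Dt P0) t x - e * Dt (Dt P1) t x)" if "0 \<le> t" for t x
  proof -
    have "Dt (Dt u) t x = Dt (\<lambda>t x. inverse (e\<^sup>2) * (Dt P t x - Dt P0 t x - e * Dt P1 t x)) t x"
      by (rule Dt_cong[OF _ that]) (rule Dtu)
    also have "\<dots> = inverse (e\<^sup>2) * (Dt (Dt P) t x - Dt (Dt P0) t x - e * Dt (Dt P1) t x)"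
      by (intro Dt_combination smooth_intros sP s0 s1 that)
    finally show ?thesis .
  qed
  have Dxu: "Dx i u t x = inverse (e\<^sup>2) * (Dx i P t x - Dx i P0 t x - e * Dx i P1 t x)" if "0 \<le> t" for i t x
    unfolding u_def[abs_def] by (rule Dx_combination[OF sP s0 s1 that])
  have DxDxu: "Dx i (Dx i u) t x = inverse (e\<^sup>2) * (Dx i (Dx i P) t x - Dx i (Dx i P0) t x - e * Dx i (Dx i P1) t x)" if "0 \<le> t" for i t x
  proof -
    have "Dx i (Dx i u) t x = Dx i (\<lambda>t x. inverse (e\<^sup>2) * (Dx i P t x - Dx i P0 t x - e * Dx i P1 t x)) t x"
      by (rule Dx_cong) (rule Dxu[OF that])
    also have "\<dots> = inverse (e\<^sup>2) * (Dx i (Dx i P) t x - Dx i (Dx i P0) t x - e * Dx i (Dx i P1) t x)"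
      by (intro Dx_combination smooth_intros sP s0 s1 that)
    finally show ?thesis .
  qed
  have Lapu: "Lap u t x = inverse (e\<^sup>2) * (Lap P t x - Lap P0 t x - e * Lap P1 t x)" if "0 \<le> t" for t x
    unfolding Lap_def DxDxu[OF that] by (simp add: sum_distrib_left sum_subtractf right_diff_distrib)
  let ?S = "\<lambda>u t x. \<Sum>i\<in>UNIV. partial i R x * Dx i u t x"
  have Su: "?S u t x = inverse (e\<^sup>2) * (?S P t x - ?S P0 t x - e * ?S P1 t x)" if "0 \<le> t" for t x
    unfolding Dxu[OF that] by (simp add: sum_distrib_left sum_subtractf right_diff_distrib mult_ac)
  have lap_Lap: "lap (v t) x = Lap v t x" for v t x by (simp add: lap_def Lap_def Dx_def[abs_def])
  have wP: "Dt (Dt P) t x = perturbed A e x * Lap P t x - perturbed A e x * inverse (perturbed R e x) * e * ?S P t x"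
    if "0 \<le> t" for t x
  proof -
    have "Dt (Dt P) t x = perturbed R e x * perturbed A e x * divergence (\<lambda>y. (1 / perturbed R e y) *\<^sub>R grad (P t) y) x"
      using P that by (simp add: full_solution_def second_time_deriv)
    also have "\<dots> = perturbed R e x * perturbed A e x * (inverse (perturbed R e x) * Lap P t x -
        inverse (perturbed R e x) * inverse (perturbed R e x) * (e * ?S P t x))"
      unfolding divergence_scaled_grad[OF smooth_on_perturbed[OF R] \<rho>n smooth_spacetime_slice[OF sP that]] lap_Lap partial_perturbed[OF R]
      by (simp add: sum_distrib_left Dx_def mult.assoc)
    finally have wave: "Dt (Dt P) t x = perturbed R e x * perturbed A e x * (inverse (perturbed R e x) * Lap P t x -
        inverse (perturbed R e x) * inverse (perturbed R e x) * (e * ?S P t x))" .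
    have alg: "r * a * (inverse r * L - inverse r * inverse r * (e * s)) = a * L - a * inverse r * e * s"
      if "r \<noteq> 0" for r a L s :: real
      using that by (simp add: field_simps)
    show ?thesis unfolding wave by (rule alg[OF \<rho>n])
  qed
  have w0: "Dt (Dt P0) t x = Lap P0 t x" if "0 \<le> t" for t x
    using P0 that by (simp add: zeroth_order_term_def second_time_deriv laplacian_eq_Lap)
  have w1: "Dt (Dt P1) t x = Lap P1 t x + A x * Lap P0 t x - ?S P0 t x" if "0 \<le> t" for t x
    using P1 that by (simp add: first_order_term_def second_time_deriv laplacian_eq_Lap grad_inner_grad)
  have eq: "Dt (Dt u) t x = perturbed A e x * lap (u t) x + (\<Sum>i\<in>UNIV. drift A R i e x * partial i (u t) x) + ?F t x"
    if "0 \<le> t" for t x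
  proof -
    have drift: "(\<Sum>i\<in>UNIV. drift A R i e x * partial i (u t) x) =
        - (perturbed A e x * inverse (perturbed R e x) * e * ?S u t x)"
      by (simp add: drift_def Dx_def sum_distrib_left sum_negf mult_ac)
    show ?thesis
      unfolding DtDtu[OF that] wP[OF that] w0[OF that] w1[OF that] lap_Lap drift Lapu[OF that] Su[OF that]
        remainder_source_def grad_inner_grad laplacian_eq_Lap perturbed_def
      using remainder_algebra[of e "R x" "A x" "Lap P t x" "?S P t x" "Lap P0 t x" "Lap P1 t x" "?S P0 t x" "?S P1 t x"]
        e \<rho>n[of x] by (simp add: perturbed_def)
  qed
  have u0: "u 0 x = 0" "Dt u 0 x = 0" for x
    using P P0 P1 Dtu[of 0 x] by (simp_all add: u_def full_solution_def zeroth_order_term_def first_order_term_def Dt_def)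
  obtain B where B: "\<And>x. x \<in> K \<Longrightarrow> norm x \<le> B"
    using compact_imp_bounded[OF K(1)] by (auto simp: bounded_iff)
  \<comment> \<open>All effects of the variable coefficients are put into this source. Outside
    \<open>K\<close> the coefficients are 1 and 0 and the remainder source vanishes, so the retarded
    potential of \<open>?G\<close> reaches only points within distance \<open>t\<close> of
    \<open>K\<close>.\<close>
  let ?G = "\<lambda>t x. Dt (Dt u) t x - Lap u t x"
  have sG: "smooth_spacetime ?G" by (intro smooth_intros smooth_spacetime_Lap su)
  have G0: "?G s y = 0" if "0 \<le> s" "y \<notin> K" for s y
  proof -
    have pR: "partial i R y = 0" for i
      by (rule partial_zero_on_open[of "- K"]) (use that(2) K compact_imp_closed in auto)
    show ?thesis
      unfolding eq[OF that(1)] lap_Lap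
      using K(2)[OF that(2)] by (simp add: pR drift_def perturbed_def remainder_source_def grad_inner_grad)
  qed
  have cu: "cone B u"
    unfolding cone_def
  proof (intro allI impI)
    fix t :: real and x :: R3 assume tx: "0 \<le> t" "B + t < norm x"
    have z: "zext ?G (t - norm z) (x + z) * (1 / norm z) = 0" for z
    proof (cases "norm z \<le> t")
      case True
      have "norm x \<le> norm (x + z) + norm z" using norm_triangle_ineq4[of "x + z" z] by simp
      then have "x + z \<notin> K" using B[of "x + z"] True tx(2) by auto
      then show ?thesis using G0[of "t - norm z" "x + z"] True by (simp add: zext_def)
    qed (simp add: zext_def)
    have "has_bochner_integral lborel (\<lambda>z. zext ?G (t - norm z) (x + z) * (1 / norm z)) (4 * pi * u t x)"
      by (rule retarded_potential[OF su u0 tx(1) sG]) simp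
    then show "u t x = 0" unfolding z by (simp add: has_bochner_integral_iff)
  qed
  have "sobolev_norm (k + 1) (u t) + sobolev_norm k (Dt u t) \<le> ennreal C * (\<integral>\<^sup>+s\<in>{0..T}. sobolev_norm k (?F s) \<partial>lborel)"
    using C[unfolded energy_bound_def, rule_format, of u ?F B t] su sF cu u0 eq t by blast
  moreover have "P2 t = u t" using P2u t by auto
  moreover have "(\<lambda>x. time_deriv (\<lambda>s. P2 s x) t) = Dt u t"
    unfolding Dt_def[abs_def] by (intro ext time_deriv_cong P2u) (use t in auto)
  ultimately show ?thesis by simp
qed

text \<open>The family \<open>C\<close> is chosen before \<Omega>, the pressure and the solutions,
  so it may rely on \<alpha>1 and \<rho>1 only. The case distinction extracts from these two
  functions a bounded set carrying their supports.\<close>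

theorem proposition2p1:
  fixes \<alpha>1 \<rho>1 :: "R3 \<Rightarrow> real"
  assumes "smooth_on UNIV \<alpha>1" and "smooth_on UNIV \<rho>1"
  shows "\<exists>C :: nat \<Rightarrow> real \<Rightarrow> real \<Rightarrow> real.
    (\<forall>k T. T > 0 \<longrightarrow> C k T \<in> O[at_right 0](\<lambda>_. 1)) \<and>
    (\<forall>(\<Omega> :: R3 set) (\<epsilon>0 :: real) (p :: R3 \<Rightarrow> real)
       (P :: real \<Rightarrow> real \<Rightarrow> R3 \<Rightarrow> real) (P0 :: real \<Rightarrow> R3 \<Rightarrow> real) (P1 :: real \<Rightarrow> R3 \<Rightarrow> real)
       (P2 :: real \<Rightarrow> real \<Rightarrow> R3 \<Rightarrow> real).
      open \<Omega> \<and> connected \<Omega> \<and> bounded \<Omega> \<and>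
      supported_in \<Omega> \<alpha>1 \<and> supported_in \<Omega> \<rho>1 \<and>
      smooth_on UNIV p \<and> supported_in \<Omega> p \<and>
      \<epsilon>0 > 0 \<and>
      (\<forall>\<epsilon>\<in>{0<..<\<epsilon>0}. \<exists>m M. 0 < m \<and> (\<forall>x. m \<le> perturbed \<rho>1 \<epsilon> x \<and> perturbed \<rho>1 \<epsilon> x \<le> M)) \<and>
      (\<forall>\<epsilon>\<in>{0<..<\<epsilon>0}. \<exists>m M. 0 < m \<and> (\<forall>x. m \<le> perturbed \<alpha>1 \<epsilon> x \<and> perturbed \<alpha>1 \<epsilon> x \<le> M)) \<and>
      (\<forall>\<epsilon>\<in>{0<..<\<epsilon>0}. full_solution \<alpha>1 \<rho>1 p \<epsilon> (P \<epsilon>)) \<and>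
      zeroth_order_term p P0 \<and>
      first_order_term \<alpha>1 \<rho>1 P0 P1 \<and>
      (\<forall>\<epsilon>\<in>{0<..<\<epsilon>0}. \<forall>t\<ge>0. \<forall>x. P \<epsilon> t x = P0 t x + \<epsilon> * P1 t x + \<epsilon>\<^sup>2 * P2 \<epsilon> t x)
      \<longrightarrow>
      (\<forall>\<epsilon>\<in>{0<..<\<epsilon>0}.
        (\<forall>x. let g = (\<lambda>t. LINT y:ball x t|lborel. green_kernel \<alpha>1 \<rho>1 \<epsilon> t x y * p y) in
          (\<forall>i<4. (time_deriv ^^ i) g differentiable_on {0..}) \<and>
          (\<forall>t\<ge>0. P \<epsilon> t x = (time_deriv ^^ 4) g t + \<epsilon>\<^sup>2 * P2 \<epsilon> t x)) \<and>
        (\<forall>k T. T > 0 \<longrightarrow>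
          (SUP t\<in>{0..T}. sobolev_norm (k + 1) (P2 \<epsilon> t)
             + sobolev_norm k (\<lambda>x. time_deriv (\<lambda>s. P2 \<epsilon> s x) t))
          \<le> ennreal (C k T \<epsilon>) *
            (\<integral>\<^sup>+t\<in>{0..T}. sobolev_norm k (remainder_source \<alpha>1 \<rho>1 P0 P1 \<epsilon> t) \<partial>lborel))))"
proof (cases "\<exists>\<Omega>. bounded \<Omega> \<and> supported_in \<Omega> \<alpha>1 \<and> supported_in \<Omega> \<rho>1")
  \<comment> \<open>No \<Omega> can then satisfy the hypotheses, and any family of constants will
    do.\<close>
  case False
  then show ?thesis by (intro exI[of _ "\<lambda>_ _ _. 0"] conjI) (simp, blast)
next
  case True
  \<comment> \<open>This set depends on the coefficients alone and is independent of the \<Omega>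
    quantified later, so the constants obtained from it do not depend on that \<Omega>.\<close>
  then obtain \<Omega>' where \<Omega>': "bounded \<Omega>'" "supported_in \<Omega>' \<alpha>1" "supported_in \<Omega>' \<rho>1" by blast
  note A = assms(1) and R = assms(2)
  obtain C where C: "\<And>k T. T > 0 \<Longrightarrow> C k T \<in> O[at_right 0](\<lambda>_. 1)"
    "\<And>k T e. T > 0 \<Longrightarrow> e > 0 \<Longrightarrow> (\<exists>m>0. \<forall>x. m \<le> perturbed \<rho>1 e x) \<Longrightarrow> (\<exists>m>0. \<forall>x. m \<le> perturbed \<alpha>1 e x) \<Longrightarrow>
      energy_bound (perturbed \<alpha>1 e) (\<lambda>i. drift \<alpha>1 \<rho>1 i e) k T (C k T e)"
    using energy_constants[OF A R compact_closure[THEN iffD2, OF \<Omega>'(1)] supported_in_zero[OF \<Omega>'(2)] supported_in_zero[OF \<Omega>'(3)]]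
    by blast
  show ?thesis
  proof (intro exI[of _ C] conjI, goal_cases)
    case 1
    show ?case using C(1) by blast
  next
    case 2
    show ?case
    proof (intro allI impI ballI, elim conjE)
      fix \<Omega> :: "R3 set" and \<epsilon>0 :: real and p :: "R3 \<Rightarrow> real" and P P2 :: "real \<Rightarrow> real \<Rightarrow> R3 \<Rightarrow> real"
        and P0 P1 :: "real \<Rightarrow> R3 \<Rightarrow> real" and \<epsilon> :: real
      assume \<epsilon>: "\<epsilon> \<in> {0<..<\<epsilon>0}" and p: "smooth_on UNIV p"
        and \<rho>: "\<forall>\<epsilon>\<in>{0<..<\<epsilon>0}. \<exists>m M. 0 < m \<and> (\<forall>x. m \<le> perturbed \<rho>1 \<epsilon> x \<and> perturbed \<rho>1 \<epsilon> x \<le> M)"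
        and \<alpha>: "\<forall>\<epsilon>\<in>{0<..<\<epsilon>0}. \<exists>m M. 0 < m \<and> (\<forall>x. m \<le> perturbed \<alpha>1 \<epsilon> x \<and> perturbed \<alpha>1 \<epsilon> x \<le> M)"
        and P: "\<forall>\<epsilon>\<in>{0<..<\<epsilon>0}. full_solution \<alpha>1 \<rho>1 p \<epsilon> (P \<epsilon>)"
        and P0: "zeroth_order_term p P0" and P1: "first_order_term \<alpha>1 \<rho>1 P0 P1"
        and P2: "\<forall>\<epsilon>\<in>{0<..<\<epsilon>0}. \<forall>t\<ge>0. \<forall>x. P \<epsilon> t x = P0 t x + \<epsilon> * P1 t x + \<epsilon>\<^sup>2 * P2 \<epsilon> t x"
      have \<epsilon>0: "0 < \<epsilon>" using \<epsilon> by simp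
      obtain m\<rho> where m\<rho>: "0 < m\<rho>" "\<And>x. m\<rho> \<le> perturbed \<rho>1 \<epsilon> x" using \<rho> \<epsilon> by blast
      obtain m\<alpha> where m\<alpha>: "0 < m\<alpha>" "\<And>x. m\<alpha> \<le> perturbed \<alpha>1 \<epsilon> x" using \<alpha> \<epsilon> by blast
      have P2': "P \<epsilon> t x = P0 t x + \<epsilon> * P1 t x + \<epsilon>\<^sup>2 * P2 \<epsilon> t x" if "0 \<le> t" for t x
        using P2 \<epsilon> that by blast
      show "(\<forall>x. let g = (\<lambda>t. LINT y:ball x t|lborel. green_kernel \<alpha>1 \<rho>1 \<epsilon> t x y * p y) in
          (\<forall>i<4. (time_deriv ^^ i) g differentiable_on {0..}) \<and>
          (\<forall>t\<ge>0. P \<epsilon> t x = (time_deriv ^^ 4) g t + \<epsilon>\<^sup>2 * P2 \<epsilon> t x)) \<and>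
        (\<forall>k T. T > 0 \<longrightarrow>
          (SUP t\<in>{0..T}. sobolev_norm (k + 1) (P2 \<epsilon> t)
             + sobolev_norm k (\<lambda>x. time_deriv (\<lambda>s. P2 \<epsilon> s x) t))
          \<le> ennreal (C k T \<epsilon>) *
            (\<integral>\<^sup>+t\<in>{0..T}. sobolev_norm k (remainder_source \<alpha>1 \<rho>1 P0 P1 \<epsilon> t) \<partial>lborel))"
      proof (intro conjI allI impI)
        fix x
        show "let g = (\<lambda>t. LINT y:ball x t|lborel. green_kernel \<alpha>1 \<rho>1 \<epsilon> t x y * p y) in
          (\<forall>i<4. (time_deriv ^^ i) g differentiable_on {0..}) \<and>
          (\<forall>t\<ge>0. P \<epsilon> t x = (time_deriv ^^ 4) g t + \<epsilon>\<^sup>2 * P2 \<epsilon> t x)"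
          using expansion_formula[OF A R p P0 P1, of _ x \<epsilon>] expansion_formula(2)[OF A R p P0 P1, of _ x \<epsilon>] P2'
          unfolding Let_def by simp
      next
        fix k :: nat and T :: real assume T: "0 < T"
        show "(SUP t\<in>{0..T}. sobolev_norm (k + 1) (P2 \<epsilon> t)
             + sobolev_norm k (\<lambda>x. time_deriv (\<lambda>s. P2 \<epsilon> s x) t))
          \<le> ennreal (C k T \<epsilon>) *
            (\<integral>\<^sup>+t\<in>{0..T}. sobolev_norm k (remainder_source \<alpha>1 \<rho>1 P0 P1 \<epsilon> t) \<partial>lborel)"
        proof (rule SUP_least)
          fix t assume t: "t \<in> {0..T}"
          show "sobolev_norm (k + 1) (P2 \<epsilon> t) + sobolev_norm k (\<lambda>x. time_deriv (\<lambda>s. P2 \<epsilon> s x) t)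
            \<le> ennreal (C k T \<epsilon>) *
            (\<integral>\<^sup>+t\<in>{0..T}. sobolev_norm k (remainder_source \<alpha>1 \<rho>1 P0 P1 \<epsilon> t) \<partial>lborel)"
          proof (rule remainder_estimate[OF A R compact_closure[THEN iffD2, OF \<Omega>'(1)]
                supported_in_zero[OF \<Omega>'(2)] supported_in_zero[OF \<Omega>'(3)] \<epsilon>0 _ _ P0 P1 P2' _ t])
            show "0 < perturbed \<rho>1 \<epsilon> x" for x using m\<rho>(1) m\<rho>(2)[of x] by linarith
            show "full_solution \<alpha>1 \<rho>1 p \<epsilon> (P \<epsilon>)" using P \<epsilon> by blast
            show "energy_bound (perturbed \<alpha>1 \<epsilon>) (\<lambda>i. drift \<alpha>1 \<rho>1 i \<epsilon>) k T (C k T \<epsilon>)"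
              by (rule C(2)[OF T \<epsilon>0]) (use m\<rho> m\<alpha> in blast)+
          qed
        qed
      qed
    qed
  qed
qed

end
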